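(* Let $n\ge 2$, $r>0$, and let $D\subset\mathbb{R}^n$ be an open ball of radius $r$, so that $\Gamma=\partial D$ is the sphere $S^{n-1}(r)$. Let $\sigma_-,\sigma_+>0$ with $\sigma_-\neq\sigma_+$, let $\lambda_{k,\varepsilon}$ be the $k$-th eigenvalue of the two-phase Neumann eigenvalue problem on $\Omega(\varepsilon)$ described in the context, and let $\lambda_k$ be the $k$-th eigenvalue of the Laplace--Beltrami operator on $S^{n-1}(r)$. Then for every $k\ge1$, $$\lambda_{k,\varepsilon}=\frac{\sigma_-+\sigma_+}{2}\lambda_k+\frac{n-3}{4r}(\sigma_+-\sigma_-)\lambda_k\,\varepsilon+o(\varepsilon)\quad\text{as }\varepsilon\to0.$$
   Context: For small $\varepsilon>0$ put $\Omega_-(\varepsilon)=\{x\in D: d(x,\Gamma)<\varepsilon\}$, $\Omega_+(\varepsilon)=\{x\in\mathbb{R}^n\setminus\overline D: d(x,\Gamma)<\varepsilon\}$ (Euclidean distance), $\Omega(\varepsilon)=\Omega_-(\varepsilon)\cup\Omega_+(\varepsilon)\cup\Gamma$, and $\sigma=\sigma_-$ on $\Omega_-(\varepsilon)\cup\Gamma$, $\sigma=\sigma_+$ on $\Omega_+(\varepsilon)$. $\lambda$ is an eigenvalue if there is $\Phi\in H^1(\Omega(\varepsilon))$, $\Phi\not\equiv0$, with $\int_{\Omega(\varepsilon)}\sigma\nabla\Phi\cdot\nabla\psi\,dx=\lambda\int_{\Omega(\varepsilon)}\Phi\psi\,dx$ for all $\psi\in H^1(\Omega(\varepsilon))$; eigenvalues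 $0=\lambda_{1,\varepsilon}\le\lambda_{2,\varepsilon}\le\cdots$ and the Laplace--Beltrami eigenvalues $0=\lambda_1\le\lambda_2\le\cdots$ of $\Gamma$ are counted with multiplicity. The $o(\varepsilon)$ remainder may depend on $\sigma_\pm$ and $k$. *)

theory Defs
  imports "HOL-Analysis.Analysis" "HOL-Library.Landau_Symbols"
begin

definition test_fun :: "'a::euclidean_space set \<Rightarrow> ('a \<Rightarrow> real) \<Rightarrow> bool" where
  "test_fun U \<phi> \<longleftrightarrow>
     (\<exists>\<phi>'. (\<forall>x. (\<phi> has_derivative \<phi>' x) (at x)) \<and> (\<forall>v. continuous_on UNIV (\<lambda>x. \<phi>' x v)))
     \<and> compact (closure {x. \<phi> x \<noteq> 0}) \<and> closure {x. \<phi> x \<noteq> 0} \<subseteq> U"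

definition L2_on :: "'a::euclidean_space set \<Rightarrow> ('a \<Rightarrow> real) \<Rightarrow> bool" where
  "L2_on U f \<longleftrightarrow> set_borel_measurable lebesgue U f \<and> set_integrable lebesgue U (\<lambda>x. (f x)\<^sup>2)"

definition weak_grad :: "'a::euclidean_space set \<Rightarrow> ('a \<Rightarrow> real) \<Rightarrow> ('a \<Rightarrow> 'a) \<Rightarrow> bool" where
  "weak_grad U \<Phi> G \<longleftrightarrow> (\<forall>\<phi>. test_fun U \<phi> \<longrightarrow> (\<forall>i\<in>Basis.
      set_integrable lebesgue U (\<lambda>x. \<Phi> x * frechet_derivative \<phi> (at x) i) \<and>
      set_integrable lebesgue U (\<lambda>x. (G x \<bullet> i) * \<phi> x) \<and>
      (LINT x:U|lebesgue. \<Phi> x * frechet_derivative \<phi> (at x) i)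
        = - (LINT x:U|lebesgue. (G x \<bullet> i) * \<phi> x)))"

definition H1_on :: "'a::euclidean_space set \<Rightarrow> ('a \<Rightarrow> real) \<Rightarrow> ('a \<Rightarrow> 'a) \<Rightarrow> bool" where
  "H1_on U \<Phi> G \<longleftrightarrow> L2_on U \<Phi> \<and> (\<forall>i\<in>Basis. L2_on U (\<lambda>x. G x \<bullet> i)) \<and> weak_grad U \<Phi> G"

definition Omega_minus :: "'a::euclidean_space \<Rightarrow> real \<Rightarrow> real \<Rightarrow> 'a set" where
  "Omega_minus c r \<epsilon> = {x \<in> ball c r. setdist {x} (sphere c r) < \<epsilon>}"

definition Omega_plus :: "'a::euclidean_space \<Rightarrow> real \<Rightarrow> real \<Rightarrow> 'a set" where
  "Omega_plus c r \<epsilon> = {x \<in> - cball c r. setdist {x} (sphere c r) < \<epsilon>}"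

definition Omega_eps :: "'a::euclidean_space \<Rightarrow> real \<Rightarrow> real \<Rightarrow> 'a set" where
  "Omega_eps c r \<epsilon> = Omega_minus c r \<epsilon> \<union> Omega_plus c r \<epsilon> \<union> sphere c r"

definition sigma_coef :: "'a::euclidean_space \<Rightarrow> real \<Rightarrow> real \<Rightarrow> real \<Rightarrow> real \<Rightarrow> 'a \<Rightarrow> real" where
  "sigma_coef c r sm sp \<epsilon> x = (if x \<in> Omega_plus c r \<epsilon> then sp else sm)"

definition tp_efun :: "'a::euclidean_space \<Rightarrow> real \<Rightarrow> real \<Rightarrow> real \<Rightarrow> real \<Rightarrow> real \<Rightarrow> ('a \<Rightarrow> real) \<Rightarrow> bool" where
  "tp_efun c r sm sp \<epsilon> lam \<Phi> \<longleftrightarrow>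
     (let \<Omega> = Omega_eps c r \<epsilon>; \<sigma> = sigma_coef c r sm sp \<epsilon> in
      \<exists>G. H1_on \<Omega> \<Phi> G \<and> \<not> (AE x in lebesgue. x \<in> \<Omega> \<longrightarrow> \<Phi> x = 0) \<and>
        (\<forall>\<psi> H. H1_on \<Omega> \<psi> H \<longrightarrow>
           (LINT x:\<Omega>|lebesgue. \<sigma> x * (G x \<bullet> H x)) = lam * (LINT x:\<Omega>|lebesgue. \<Phi> x * \<psi> x)))"

definition tp_eig :: "'a::euclidean_space \<Rightarrow> real \<Rightarrow> real \<Rightarrow> real \<Rightarrow> real \<Rightarrow> nat \<Rightarrow> real" where
  "tp_eig c r sm sp \<epsilon> k = Inf {\<mu>. \<exists>\<Phi>s :: nat \<Rightarrow> 'a \<Rightarrow> real.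
      (\<forall>j<k. \<exists>lam. lam \<le> \<mu> \<and> tp_efun c r sm sp \<epsilon> lam (\<Phi>s j)) \<and>
      (\<forall>a::nat \<Rightarrow> real. (AE x in lebesgue. x \<in> Omega_eps c r \<epsilon> \<longrightarrow> (\<Sum>j<k. a j * \<Phi>s j x) = 0)
          \<longrightarrow> (\<forall>j<k. a j = 0))}"

(* f (restricted to the sphere S(c,r)) is an eigenfunction of -Laplace-Beltrami with
   eigenvalue \<lambda>: its 0-homogeneous extension F is C^2 off c and -\<Delta>F = \<lambda> f on the sphere *)
definition LB_efun :: "'a::euclidean_space \<Rightarrow> real \<Rightarrow> real \<Rightarrow> ('a \<Rightarrow> real) \<Rightarrow> bool" where
  "LB_efun c r lam f \<longleftrightarrow>
     (\<exists>F DF D2F.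
        (\<forall>x. x \<noteq> c \<longrightarrow> F x = f (c + (r / norm (x - c)) *\<^sub>R (x - c))) \<and>
        (\<forall>x. x \<noteq> c \<longrightarrow> (F has_derivative DF x) (at x)) \<and>
        (\<forall>x i. x \<noteq> c \<longrightarrow> ((\<lambda>y. DF y i) has_derivative D2F x i) (at x)) \<and>
        (\<forall>i j. continuous_on (- {c}) (\<lambda>x. D2F x i j)) \<and>
        (\<forall>x\<in>sphere c r. - (\<Sum>i\<in>Basis. D2F x i i) = lam * f x)) \<and>
     (\<exists>x\<in>sphere c r. f x \<noteq> 0)"

definition LB_eig :: "'a::euclidean_space \<Rightarrow> real \<Rightarrow> nat \<Rightarrow> real" where
  "LB_eig c r k = Inf {\<mu>. \<exists>fs :: nat \<Rightarrow> 'a \<Rightarrow> real.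
      (\<forall>j<k. \<exists>lam. lam \<le> \<mu> \<and> LB_efun c r lam (fs j)) \<and>
      (\<forall>a::nat \<Rightarrow> real. (\<forall>x\<in>sphere c r. (\<Sum>j<k. a j * fs j x) = 0) \<longrightarrow> (\<forall>j<k. a j = 0))}"

end

theory Submission
  imports Defs "HOL-Real_Asymp.Real_Asymp"
begin

text \<open>
  Separate variables. If \<open>Y\<close> is an eigenfunction of the Laplace--Beltrami operator on the unit sphere with
  eigenvalue \<open>\<Lambda>\<close>, then \<open>p(\<bar>x - c\<bar>) Y\<close> is an eigenfunction on the shell with eigenvalue \<open>\<nu>\<close> iff \<open>p\<close>
  solves a Neumann Sturm--Liouville problem on \<open>[r - \<epsilon>, r + \<epsilon>]\<close>. In a thin shell the solutions of the
  initial value problem are positive and \<open>1 + O(\<epsilon>\<^sup>2)\<close>, so for each \<open>\<Lambda>\<close> exactly one eigenvalue \<open>\<nu>(\<Lambda>)\<close> is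
  bounded as \<open>\<epsilon> \<rightarrow> 0\<close>, Wronskians show that \<open>\<nu>\<close> is increasing in \<open>\<Lambda>\<close>, and integrating the equation gives
  \<open>\<nu> \<integral> t\<^sup>n\<^sup>-\<^sup>1 = \<Lambda> \<integral> \<sigma> t\<^sup>n\<^sup>-\<^sup>3 + O(\<epsilon>\<^sup>3)\<close>, which is the claimed expansion.

  That there are no other bounded eigenvalues is seen by duality, without slicing \<open>H\<^sup>1\<close> functions: testing
  an eigenfunction \<open>\<Phi>\<close> for \<open>lam\<close> against \<open>p Y\<close>, where \<open>p\<close> solves the inhomogeneous radial problem with right-hand
  side \<open>q\<close>, gives \<open>\<integral> q(\<bar>x - c\<bar>) Y \<Phi> = 0\<close> whenever \<open>lam\<close> is not a radial eigenvalue for \<open>\<Lambda>\<close>. The functions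
  \<open>q Y\<close> span a dense set by the Stone--Weierstrass theorem, as every polynomial restricted to a sphere is a sum
  of eigenfunctions; so comparing dimensions yields \<open>\<lambda>\<^sub>k\<^sub>,\<^sub>\<epsilon> = \<nu>(r\<^sup>2 \<lambda>\<^sub>k)\<close>.
\<close>

section \<open>The radial Sturm--Liouville problem\<close>

text \<open>Both eigenvalues are infima over families of \<open>k\<close> independent
  eigenfunctions, without a variational principle, so the comparison has to build such families for
  the upper bound and to rule them out for the lower one. The obstacle is uniformity: a single
  \<epsilon> has to serve infinitely many angular eigenvalues \<Lambda>. Hence two thresholds:
  \<open>M\<close> bounds the shell eigenvalues under consideration, and \<open>L\<close> separates
  the \<Lambda> for which thinness of the shell is used from those so large that the zero-order term
  has a sign. The coefficient (n - 3) / (4 r) arises as follows. In the integrated equation the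
  linear part of t^(n-1) at r cancels over the symmetric interval, whereas that of t^(n-3), weighted
  with the jumping \<sigma>, leaves (n - 3) r^(n-4) (sp - sm) \<epsilon>^2 / 2 times \<Lambda>;
  dividing by 2 \<epsilon> r^(n-1) and inserting \<Lambda> = r^2 \<lambda> gives the second
  term.\<close>

lemma integral_exp_le:
  fixes K a x C :: real
  assumes "K > 0" "a \<le> x" "C \<ge> 0"
  shows "(\<lambda>y. C * exp (K * (y - a))) integrable_on {a..x}"
    and "integral {a..x} (\<lambda>y. C * exp (K * (y - a))) \<le> C * exp (K * (x - a)) / K"
proof -
  have "((\<lambda>y. C * exp (K * (y - a))) has_integral (C * exp (K * (x - a)) / K - C * exp (K * (a - a)) / K)) {a..x}"
    using assms by (intro fundamental_theorem_of_calculus)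
      (auto intro!: derivative_eq_intros simp: has_real_derivative_iff_has_vector_derivative[symmetric])
  then show "(\<lambda>y. C * exp (K * (y - a))) integrable_on {a..x}"
    and "integral {a..x} (\<lambda>y. C * exp (K * (y - a))) \<le> C * exp (K * (x - a)) / K"
    using assms by (auto simp: has_integral_iff)
qed

text \<open>A Volterra system is solved by a contraction for the weighted norm
  \<open>sup exp (- K (t - a)) \<bar>p t\<bar>\<close>, so no smallness of the interval is required.\<close>

lemma volterra_system:
  fixes m g k :: "real \<Rightarrow> real" and a b C \<alpha> :: real
  assumes ab: "a \<le> b"
    and m: "\<And>u. continuous_on {a..b} u \<Longrightarrow> (\<lambda>x. m x * u x) integrable_on {a..b}"
    and g: "\<And>u. continuous_on {a..b} u \<Longrightarrow> (\<lambda>x. g x * u x) integrable_on {a..b}"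
    and k: "k integrable_on {a..b}"
    and mC: "\<And>x. x \<in> {a..b} \<Longrightarrow> \<bar>m x\<bar> \<le> C" and gC: "\<And>x. x \<in> {a..b} \<Longrightarrow> \<bar>g x\<bar> \<le> C"
  shows "\<exists>p w. continuous_on {a..b} p \<and> continuous_on {a..b} w \<and>
     (\<forall>t\<in>{a..b}. p t = \<alpha> + integral {a..t} (\<lambda>x. m x * w x)) \<and>
     (\<forall>t\<in>{a..b}. w t = integral {a..t} (\<lambda>x. g x * p x + k x))"
proof -
  have C0: "C \<ge> 0" using mC[of a] ab by fastforce
  \<comment> \<open>Each of the two nested integrations against the weight gains a factor
    \<open>C / K\<close>, at most 1/2, so the map contracts by 1/4; the added 1 keeps
    \<open>K\<close> positive when \<open>C\<close> is 0.\<close>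
  define K where "K = 2 * C + 1"
  have K: "K > 0" "C \<le> K / 2" using C0 by (auto simp: K_def)
  define W where "W u x = integral {a..x} (\<lambda>y. g y * (exp (K * (y - a)) * u y) + k y)" for u :: "real \<Rightarrow> real" and x
  define P where "P u t = \<alpha> + integral {a..t} (\<lambda>x. m x * W u x)" for u t
  have iW: "(\<lambda>y. g y * (exp (K * (y - a)) * u y) + k y) integrable_on {a..b}" if "continuous_on {a..b} u" for u
    by (intro integrable_add g k continuous_intros that)
  have cW: "continuous_on {a..b} (W u)" if "continuous_on {a..b} u" for u
    unfolding W_def by (rule indefinite_integral_continuous_1) (rule iW[OF that])
  have cP: "continuous_on {a..b} (P u)" if "continuous_on {a..b} u" for u
    unfolding P_def by (intro continuous_intros indefinite_integral_continuous_1 m cW that)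
  \<comment> \<open>Banach's theorem is applied on the type of bounded continuous functions on the
    whole line; clamping to \<open>{a..b}\<close> extends the iterates to it.\<close>
  define cl where "cl t = max a (min b t)" for t
  have cl: "cl t \<in> {a..b}" for t using ab by (auto simp: cl_def)
  have clid: "cl t = t" if "t \<in> {a..b}" for t using that by (auto simp: cl_def)
  have clc: "continuous_on UNIV cl" unfolding cl_def by (intro continuous_intros)
  \<comment> \<open>The unknown is \<open>u\<close>, with p = exp (K (t - a)) u, so that the
    weighted norm of \<open>p\<close> is the plain sup norm of \<open>u\<close>.\<close>
  define F where "F u t = exp (- (K * (cl t - a))) * P u (cl t)" for u t
  have Fb: "F u \<in> bcontfun" if "continuous_on {a..b} u" for u
  proof -
    have c0: "continuous_on {a..b} (\<lambda>t. exp (- (K * (t - a))) * P u t)"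
      by (intro continuous_intros cP that)
    have "continuous_on UNIV (\<lambda>t. (\<lambda>t. exp (- (K * (t - a))) * P u t) (cl t))"
      by (rule continuous_on_compose2[OF c0 clc]) (use cl in auto)
    moreover have "bounded (range (F u))"
    proof (rule bounded_subset)
      show "bounded ((\<lambda>t. exp (- (K * (t - a))) * P u t) ` {a..b})"
        by (intro compact_imp_bounded compact_continuous_image c0) auto
      show "range (F u) \<subseteq> (\<lambda>t. exp (- (K * (t - a))) * P u t) ` {a..b}"
        using cl by (auto simp: F_def)
    qed
    ultimately show ?thesis by (simp add: bcontfun_def F_def)
  qed
  define T where "T u = Bcontfun (F (apply_bcontfun u))" for u :: "real \<Rightarrow>\<^sub>C real"
  have Tap: "apply_bcontfun (T u) = F u" for u
    unfolding T_def by (rule Bcontfun_inverse) (rule Fb, simp)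
  have lip: "dist (T u) (T v) \<le> (1/4) * dist u v" for u v
  proof (rule dist_bound)
    fix t
    define s where "s = cl t"
    have s: "s \<in> {a..b}" using cl by (simp add: s_def)
    define D where "D = dist u v"
    have D0: "D \<ge> 0" by (simp add: D_def)
    have uv: "\<bar>u y - v y\<bar> \<le> D" for y
      using dist_bounded[of u y v] by (simp add: dist_real_def D_def)
    have W: "\<bar>W u x - W v x\<bar> \<le> C * D * exp (K * (x - a)) / K" if x: "x \<in> {a..b}" for x
    proof -
      have sub: "{a..x} \<subseteq> {a..b}" using x by auto
      have i: "(\<lambda>y. g y * (exp (K * (y - a)) * u y) + k y) integrable_on {a..x}" for u :: "real \<Rightarrow>\<^sub>C real"
        using iW[of u] sub integrable_on_subinterval by fastforce
      have "\<bar>W u x - W v x\<bar> = norm (integral {a..x} (\<lambda>y. (g y * (exp (K * (y - a)) * u y) + k y) - (g y * (exp (K * (y - a)) * v y) + k y)))"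
        unfolding W_def by (subst integral_diff[symmetric]) (auto intro: i)
      also have "\<dots> \<le> integral {a..x} (\<lambda>y. (C * D) * exp (K * (y - a)))"
      proof (rule integral_norm_bound_integral)
        show "(\<lambda>y. (C * D) * exp (K * (y - a))) integrable_on {a..x}"
          by (rule integral_exp_le) (use K x C0 D0 in auto)
        fix y assume y: "y \<in> {a..x}"
        have "(g y * (exp (K * (y - a)) * u y) + k y) - (g y * (exp (K * (y - a)) * v y) + k y) = g y * (u y - v y) * exp (K * (y - a))"
          by (simp add: algebra_simps)
        moreover have "\<bar>g y * (u y - v y)\<bar> \<le> C * D"
          unfolding abs_mult using gC[of y] uv[of y] y sub by (intro mult_mono) (auto simp: C0)
        ultimately show "norm ((g y * (exp (K * (y - a)) * u y) + k y) - (g y * (exp (K * (y - a)) * v y) + k y)) \<le> C * D * exp (K * (y - a))"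
          by (simp add: abs_mult)
      qed (intro integrable_diff i)
      also have "\<dots> \<le> C * D * exp (K * (x - a)) / K"
        by (rule integral_exp_le) (use K x C0 D0 in auto)
      finally show ?thesis .
    qed
    have sub: "{a..s} \<subseteq> {a..b}" using s by auto
    have i: "(\<lambda>x. m x * W u x) integrable_on {a..s}" for u :: "real \<Rightarrow>\<^sub>C real"
      using m[OF cW, of u] sub integrable_on_subinterval by fastforce
    have "\<bar>P u s - P v s\<bar> = norm (integral {a..s} (\<lambda>x. m x * W u x - m x * W v x))"
      unfolding P_def by (simp add: integral_diff i)
    also have "\<dots> \<le> integral {a..s} (\<lambda>x. (C * (C * D / K)) * exp (K * (x - a)))"
    proof (rule integral_norm_bound_integral)
      show "(\<lambda>y. (C * (C * D / K)) * exp (K * (y - a))) integrable_on {a..s}"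
        by (rule integral_exp_le) (use K s C0 D0 in auto)
      fix x assume x: "x \<in> {a..s}"
      have "\<bar>m x * (W u x - W v x)\<bar> \<le> C * (C * D * exp (K * (x - a)) / K)"
        unfolding abs_mult using mC[of x] W[of x] x sub by (intro mult_mono) (auto simp: C0)
      then show "norm (m x * W u x - m x * W v x) \<le> C * (C * D / K) * exp (K * (x - a))"
        by (simp add: algebra_simps)
    qed (intro integrable_diff i)
    also have "\<dots> \<le> C * (C * D / K) * exp (K * (s - a)) / K"
      by (rule integral_exp_le) (use K s C0 D0 in auto)
    also have "\<dots> = (C / K) * (C / K) * D * exp (K * (s - a))" by simp
    also have "\<dots> \<le> (1/2) * (1/2) * D * exp (K * (s - a))"
      using K C0 D0 by (intro mult_right_mono mult_mono) (auto simp: field_simps)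
    finally have "\<bar>P u s - P v s\<bar> \<le> (1/4) * D * exp (K * (s - a))" by simp
    then have "exp (- (K * (s - a))) * \<bar>P u s - P v s\<bar> \<le> exp (- (K * (s - a))) * ((1/4) * D * exp (K * (s - a)))"
      by (intro mult_left_mono) auto
    also have "\<dots> = 1/4 * D"
    proof -
      have "x * (1/4 * D * y) = 1/4 * D" if "x * y = 1" for x y :: real using that by algebra
      then show ?thesis by (simp add: exp_minus)
    qed
    finally show "dist (T u t) (T v t) \<le> 1/4 * dist u v"
      unfolding Tap F_def dist_real_def s_def[symmetric] D_def[symmetric]
      by (simp add: abs_mult right_diff_distrib[symmetric])
  qed
  obtain u where u: "T u = u"
    using banach_fix_type[of "1/4" T] lip by auto
  have uF: "u t = exp (- (K * (t - a))) * P u t" if "t \<in> {a..b}" for t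
    using fun_cong[OF Tap[of u], of t] unfolding u F_def clid[OF that] .
  define p where "p t = exp (K * (t - a)) * u t" for t
  have pP: "p t = P u t" if "t \<in> {a..b}" for t
    using uF[OF that] by (simp add: p_def exp_minus)
  show ?thesis
  proof (intro exI conjI ballI)
    show "continuous_on {a..b} p" unfolding p_def by (intro continuous_intros) auto
    show "continuous_on {a..b} (W u)" by (rule cW) auto
    show "p t = \<alpha> + integral {a..t} (\<lambda>x. m x * W u x)" if "t \<in> {a..b}" for t
      using pP[OF that] by (simp add: P_def)
    show "W u t = integral {a..t} (\<lambda>x. g x * p x + k x)" if "t \<in> {a..b}" for t
      by (simp add: W_def p_def)
  qed
qed

lemma integral_has_real_derivative_at:
  fixes f :: "real \<Rightarrow> real"
  assumes "f integrable_on {a..b}" "t \<in> {a<..<b}" "isCont f t"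
  shows "((\<lambda>u. integral {a..u} f) has_real_derivative f t) (at t)"
proof -
  have "((\<lambda>u. integral {a..u} f) has_vector_derivative f t) (at t within {a..b} - {})"
    using assms by (intro integral_has_vector_derivative_continuous_at)
      (auto intro: continuous_at_imp_continuous_at_within)
  moreover have "at t within {a..b} = at t" using assms(2) by (intro at_within_Icc_at) auto
  ultimately show ?thesis by (simp add: has_real_derivative_iff_has_vector_derivative)
qed

section \<open>The radial system on an interval containing the interface\<close>

definition phase_coef :: "real \<Rightarrow> real \<Rightarrow> real \<Rightarrow> real \<Rightarrow> real" where
  "phase_coef sm sp r t = (if t > r then sp else sm)"

lemma isCont_phase_coef:
  assumes "t \<noteq> r" shows "isCont (phase_coef sm sp r) t"
proof (cases "t > r")
  case True
  then have "eventually (\<lambda>x. phase_coef sm sp r x = sp) (nhds t)"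
    by (auto simp: phase_coef_def eventually_nhds intro!: exI[of _ "{r<..}"])
  then show ?thesis using isCont_cong by fastforce
next
  case False
  then have "eventually (\<lambda>x. phase_coef sm sp r x = sm) (nhds t)"
    using assms by (auto simp: phase_coef_def eventually_nhds intro!: exI[of _ "{..<r}"])
  then show ?thesis using isCont_cong by fastforce
qed

text \<open>\<open>N\<close> is the dimension of the ambient space and \<open>e\<close> the
  half-width \<epsilon>; the differential equations see the space only through the weight
  t^(N-1).\<close>

locale radial_interval =
  fixes r e sm sp :: real and N :: nat
  assumes e0: "0 < e" and er: "e < r" and sm0: "0 < sm" and sp0: "0 < sp"
begin

abbreviation "a \<equiv> r - e"
abbreviation "b \<equiv> r + e"
abbreviation "\<sigma> \<equiv> phase_coef sm sp r"

lemma a0: "0 < a" and ab: "a < b" and r0: "0 < r" and rab: "r \<in> {a<..<b}"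
  using e0 er by auto

lemma phase_coef_pos: "\<sigma> t > 0" using sm0 sp0 by (auto simp: phase_coef_def)

lemma phase_coef_le: "\<sigma> t \<le> sm + sp" using sm0 sp0 by (auto simp: phase_coef_def)

lemma phase_coef_ge: "min sm sp \<le> \<sigma> t" using sm0 sp0 by (auto simp: phase_coef_def)

text \<open>The integrands carry \<sigma> and jump at \<open>r\<close>; a continuous representative
  on each side is enough, whatever the value at \<open>r\<close>.\<close>

lemma piecewise_integrable:
  fixes f f1 f2 :: "real \<Rightarrow> real"
  assumes "continuous_on {a..b} f1" "continuous_on {a..b} f2"
    and "\<And>t. t \<in> {a..b} \<Longrightarrow> t < r \<Longrightarrow> f t = f1 t"
    and "\<And>t. t \<in> {a..b} \<Longrightarrow> r < t \<Longrightarrow> f t = f2 t"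
  shows "f integrable_on {a..b}"
proof (rule Henstock_Kurzweil_Integration.integrable_combine[where c = r])
  show "f integrable_on {a..r}"
  proof (rule integrable_spike_finite[of "{r}" _ _ f1])
    show "f1 integrable_on {a..r}"
      by (rule integrable_continuous_real, rule continuous_on_subset[OF assms(1)]) (use e0 in auto)
  qed (use assms e0 in auto)
  show "f integrable_on {r..b}"
  proof (rule integrable_spike_finite[of "{r}" _ _ f2])
    show "f2 integrable_on {r..b}"
      by (rule integrable_continuous_real, rule continuous_on_subset[OF assms(2)]) (use e0 in auto)
  qed (use assms e0 in auto)
qed (use e0 in auto)

text \<open>\<open>w\<close> is the flux \<open>\<sigma> t\<^sup>n\<^sup>-\<^sup>1 p'\<close>, which unlike \<open>p'\<close> is continuous across the interface
  \<open>t = r\<close>. If \<open>Y\<close> is a spherical eigenfunction with eigenvalue \<open>\<Lambda>\<close> on the unit sphere, then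
  \<open>\<Phi> = p Y\<close> satisfies \<open>- div (\<sigma> \<nabla>\<Phi>) = h Y\<close>; the Neumann condition is \<open>w = 0\<close> at both ends.\<close>

definition radial_sol :: "real \<Rightarrow> (real \<Rightarrow> real) \<Rightarrow> (real \<Rightarrow> real) \<Rightarrow> (real \<Rightarrow> real) \<Rightarrow> bool" where
  "radial_sol \<Lambda> h p w \<longleftrightarrow> continuous_on {a..b} p \<and> continuous_on {a..b} w \<and>
    (\<forall>t\<in>{a<..<b} - {r}. (p has_real_derivative w t / (\<sigma> t * t ^ (N - 1))) (at t) \<and>
       (w has_real_derivative t ^ (N - 1) * (\<Lambda> * \<sigma> t / t\<^sup>2 * p t - h t)) (at t))"

text \<open>For the pair (p, w) the equation is a first-order linear system with bounded, piecewise
  continuous coefficients, so its integrated form is a Volterra system on the whole interval. The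
  right-hand side contains \<open>p\<close> itself, and \<open>w a = 0\<close> is the left Neumann
  condition.\<close>

lemma radial_sol_exists:
  assumes q: "continuous_on {a..b} q"
  obtains p w where "radial_sol \<Lambda> (\<lambda>t. lam * p t + q t) p w" "p a = \<alpha>" "w a = 0"
proof -
  \<comment> \<open>The system reads p' = m w and w' = g p + k.\<close>
  define m where "m t = 1 / (\<sigma> t * t ^ (N - 1))" for t
  define g where "g t = t ^ (N - 1) * (\<Lambda> * \<sigma> t / t\<^sup>2 - lam)" for t
  define k where "k t = - (t ^ (N - 1) * q t)" for t
  define C1 where "C1 = 1 / (min sm sp * a ^ (N - 1))"
  define C2 where "C2 = b ^ (N - 1) * (\<bar>\<Lambda>\<bar> * (sm + sp) / a\<^sup>2 + \<bar>lam\<bar>)"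
  have pos: "t > 0" if "t \<in> {a..b}" for t using that a0 by auto
  have mC: "\<bar>m t\<bar> \<le> C1" if t: "t \<in> {a..b}" for t
  proof -
    have "min sm sp * a ^ (N - 1) \<le> \<sigma> t * t ^ (N - 1)"
      using t a0 sm0 sp0 phase_coef_pos[of t] by (intro mult_mono power_mono phase_coef_ge) auto
    moreover have "0 < min sm sp * a ^ (N - 1)" using a0 sm0 sp0 by auto
    ultimately have "1 / (\<sigma> t * t ^ (N - 1)) \<le> C1" unfolding C1_def by (intro divide_left_mono) auto
    moreover have "m t \<ge> 0" using pos[OF t] phase_coef_pos[of t] by (auto simp: m_def)
    ultimately show ?thesis by (simp add: m_def)
  qed
  have gC: "\<bar>g t\<bar> \<le> C2" if t: "t \<in> {a..b}" for t
  proof -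
    have "\<bar>\<Lambda> * \<sigma> t / t\<^sup>2 - lam\<bar> \<le> \<bar>\<Lambda> * \<sigma> t / t\<^sup>2\<bar> + \<bar>lam\<bar>" by (rule abs_triangle_ineq4)
    also have "\<bar>\<Lambda> * \<sigma> t / t\<^sup>2\<bar> = \<bar>\<Lambda>\<bar> * \<sigma> t / t\<^sup>2" using phase_coef_pos[of t] by (simp add: abs_mult)
    also have "\<dots> \<le> \<bar>\<Lambda>\<bar> * (sm + sp) / a\<^sup>2"
      using t a0 phase_coef_le phase_coef_pos sm0 sp0 by (intro frac_le mult_left_mono power_mono) auto
    finally have "\<bar>\<Lambda> * \<sigma> t / t\<^sup>2 - lam\<bar> \<le> \<bar>\<Lambda>\<bar> * (sm + sp) / a\<^sup>2 + \<bar>lam\<bar>" by simp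
    then show ?thesis unfolding g_def C2_def abs_mult
      using t a0 by (intro mult_mono) (auto simp: power_mono)
  qed
  have cm: "continuous_on {a..b} (\<lambda>x. 1 / (s * x ^ (N - 1)) * u x)" if "continuous_on {a..b} u" "s > 0" for u s
    using pos that by (intro continuous_intros) force+
  have cg: "continuous_on {a..b} (\<lambda>x. x ^ (N - 1) * (\<Lambda> * s / x\<^sup>2 - lam) * u x)" if "continuous_on {a..b} u" for u s
    using pos that by (intro continuous_intros) force+
  have im: "(\<lambda>x. m x * u x) integrable_on {a..b}" if "continuous_on {a..b} u" for u
    by (rule piecewise_integrable[OF cm[OF that sm0] cm[OF that sp0]]) (auto simp: m_def phase_coef_def)
  have ig: "(\<lambda>x. g x * u x) integrable_on {a..b}" if "continuous_on {a..b} u" for u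
    by (rule piecewise_integrable[OF cg[OF that, of sm] cg[OF that, of sp]]) (auto simp: g_def phase_coef_def)
  have ck: "continuous_on {a..b} k" unfolding k_def using q by (intro continuous_intros)
  have ik: "k integrable_on {a..b}" by (rule integrable_continuous_real[OF ck])
  have "\<exists>p w. continuous_on {a..b} p \<and> continuous_on {a..b} w \<and>
     (\<forall>t\<in>{a..b}. p t = \<alpha> + integral {a..t} (\<lambda>x. m x * w x)) \<and>
     (\<forall>t\<in>{a..b}. w t = integral {a..t} (\<lambda>x. g x * p x + k x))"
    by (rule volterra_system[where C = "max C1 C2"])
      (use ab im ig ik mC gC in \<open>auto simp: le_max_iff_disj\<close>)
  then obtain p w where pw: "continuous_on {a..b} p" "continuous_on {a..b} w"
     "\<And>t. t \<in> {a..b} \<Longrightarrow> p t = \<alpha> + integral {a..t} (\<lambda>x. m x * w x)"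
     "\<And>t. t \<in> {a..b} \<Longrightarrow> w t = integral {a..t} (\<lambda>x. g x * p x + k x)"
    by blast
  have cont: "isCont u t" if "continuous_on {a..b} u" "t \<in> {a<..<b}" for u :: "real \<Rightarrow> real" and t
    using that continuous_on_interior by fastforce
  have "(p has_real_derivative w t / (\<sigma> t * t ^ (N - 1))) (at t) \<and>
       (w has_real_derivative t ^ (N - 1) * (\<Lambda> * \<sigma> t / t\<^sup>2 * p t - (lam * p t + q t))) (at t)"
    if t: "t \<in> {a<..<b} - {r}" for t
  proof
    have t': "t \<in> {a<..<b}" "t \<noteq> r" "t \<noteq> 0" using t a0 by auto
    note c = cont[OF _ t'(1)] isCont_phase_coef[OF t'(2)]
    have nz: "\<sigma> t * t ^ (N - 1) \<noteq> 0" using t' phase_coef_pos[of t] by auto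
    have "isCont (\<lambda>x. m x * w x) t" unfolding m_def
      using nz by (intro continuous_intros c pw)
    then have "((\<lambda>u. \<alpha> + integral {a..u} (\<lambda>x. m x * w x)) has_real_derivative m t * w t) (at t)"
      by (auto intro!: derivative_eq_intros integral_has_real_derivative_at[OF im[OF pw(2)] t'(1)])
    then show "(p has_real_derivative w t / (\<sigma> t * t ^ (N - 1))) (at t)"
      using has_field_derivative_transform_within_open[of _ _ t "{a<..<b}" p] pw(3) t'
      by (auto simp: m_def)
    have "isCont (\<lambda>x. g x * p x + k x) t" unfolding g_def k_def
      using t' by (intro continuous_intros c pw q) auto
    then have "((\<lambda>u. integral {a..u} (\<lambda>x. g x * p x + k x)) has_real_derivative g t * p t + k t) (at t)"
      by (auto intro!: derivative_eq_intros integral_has_real_derivative_at[OF integrable_add[OF ig[OF pw(1)] ik] t'(1)])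
    then have "(w has_real_derivative g t * p t + k t) (at t)"
      using has_field_derivative_transform_within_open[of _ _ t "{a<..<b}" w] pw(4) t'
      by auto
    then show "(w has_real_derivative t ^ (N - 1) * (\<Lambda> * \<sigma> t / t\<^sup>2 * p t - (lam * p t + q t))) (at t)"
      by (simp add: g_def k_def algebra_simps)
  qed
  then have "radial_sol \<Lambda> (\<lambda>t. lam * p t + q t) p w" using pw by (auto simp: radial_sol_def)
  moreover have "p a = \<alpha>" "w a = 0" using pw(3)[of a] pw(4)[of a] ab by auto
  ultimately show ?thesis using that by blast
qed

lemma radial_sol_add:
  assumes "radial_sol \<Lambda> h1 p1 w1" "radial_sol \<Lambda> h2 p2 w2"
  shows "radial_sol \<Lambda> (\<lambda>t. h1 t + \<beta> * h2 t) (\<lambda>t. p1 t + \<beta> * p2 t) (\<lambda>t. w1 t + \<beta> * w2 t)"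
  unfolding radial_sol_def
proof (intro conjI ballI)
  fix t assume t: "t \<in> {a<..<b} - {r}"
  have d: "(p1 has_real_derivative w1 t / (\<sigma> t * t ^ (N - 1))) (at t)"
    "(w1 has_real_derivative t ^ (N - 1) * (\<Lambda> * \<sigma> t / t\<^sup>2 * p1 t - h1 t)) (at t)"
    "(p2 has_real_derivative w2 t / (\<sigma> t * t ^ (N - 1))) (at t)"
    "(w2 has_real_derivative t ^ (N - 1) * (\<Lambda> * \<sigma> t / t\<^sup>2 * p2 t - h2 t)) (at t)"
    using assms t by (auto simp: radial_sol_def)
  show "((\<lambda>t. p1 t + \<beta> * p2 t) has_real_derivative (w1 t + \<beta> * w2 t) / (\<sigma> t * t ^ (N - 1))) (at t)"
    using DERIV_add[OF d(1) DERIV_cmult[OF d(3), of \<beta>]] by (simp add: add_divide_distrib)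
  show "((\<lambda>t. w1 t + \<beta> * w2 t) has_real_derivative
           t ^ (N - 1) * (\<Lambda> * \<sigma> t / t\<^sup>2 * (p1 t + \<beta> * p2 t) - (h1 t + \<beta> * h2 t))) (at t)"
    using DERIV_add[OF d(2) DERIV_cmult[OF d(4), of \<beta>]]
    by (rule DERIV_cong) (simp add: algebra_simps add_divide_distrib)
qed (use assms in \<open>auto simp: radial_sol_def intro!: continuous_intros\<close>)

text \<open>\<open>p\<close> and \<open>w\<close> are continuous at \<open>r\<close>, so the one
  exceptional point does not disturb the fundamental theorem.\<close>

lemma radial_sol_has_integral:
  assumes "radial_sol \<Lambda> h p w" "t \<in> {a..b}"
  shows "((\<lambda>s. w s / (\<sigma> s * s ^ (N - 1))) has_integral (p t - p a)) {a..t}"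
    and "((\<lambda>s. s ^ (N - 1) * (\<Lambda> * \<sigma> s / s\<^sup>2 * p s - h s)) has_integral (w t - w a)) {a..t}"
proof -
  have "continuous_on {a..t} p" "continuous_on {a..t} w"
    using assms by (auto simp: radial_sol_def intro: continuous_on_subset)
  then show "((\<lambda>s. w s / (\<sigma> s * s ^ (N - 1))) has_integral (p t - p a)) {a..t}"
    "((\<lambda>s. s ^ (N - 1) * (\<Lambda> * \<sigma> s / s\<^sup>2 * p s - h s)) has_integral (w t - w a)) {a..t}"
    using assms by (auto simp: radial_sol_def has_real_derivative_iff_has_vector_derivative
        intro!: fundamental_theorem_of_calculus_interior_strong[of "{r}"])
qed

text \<open>In the derivative of w p' - w' p the products of the two fluxes cancel. Primes mark the
  second solution, not derivatives.\<close>

lemma wronskian: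
  assumes "radial_sol \<Lambda> h p w" "radial_sol \<Lambda>' h' p' w'"
  shows "((\<lambda>t. t ^ (N - 1) * ((\<Lambda> - \<Lambda>') * \<sigma> t / t\<^sup>2 * p t * p' t - h t * p' t + h' t * p t)) has_integral
     (w b * p' b - w' b * p b - (w a * p' a - w' a * p a))) {a..b}"
proof (rule fundamental_theorem_of_calculus_interior_strong[of "{r}"])
  show "continuous_on {a..b} (\<lambda>t. w t * p' t - w' t * p t)"
    using assms by (intro continuous_intros) (auto simp: radial_sol_def)
  fix t assume t: "t \<in> {a<..<b} - {r}"
  have d: "(p has_real_derivative w t / (\<sigma> t * t ^ (N - 1))) (at t)"
    "(w has_real_derivative t ^ (N - 1) * (\<Lambda> * \<sigma> t / t\<^sup>2 * p t - h t)) (at t)"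
    "(p' has_real_derivative w' t / (\<sigma> t * t ^ (N - 1))) (at t)"
    "(w' has_real_derivative t ^ (N - 1) * (\<Lambda>' * \<sigma> t / t\<^sup>2 * p' t - h' t)) (at t)"
    using assms t by (auto simp: radial_sol_def)
  show "((\<lambda>t. w t * p' t - w' t * p t) has_vector_derivative
      t ^ (N - 1) * ((\<Lambda> - \<Lambda>') * \<sigma> t / t\<^sup>2 * p t * p' t - h t * p' t + h' t * p t)) (at t)"
    unfolding has_real_derivative_iff_has_vector_derivative[symmetric]
    by (rule derivative_eq_intros d refl)+ (simp add: algebra_simps diff_divide_distrib)
qed (use ab in auto)

end

section \<open>Positivity of radial solutions and their distance from 1\<close>

lemma has_integral_Icc_bound:
  fixes f :: "real \<Rightarrow> real"
  assumes "(f has_integral i) {a..b}" "0 \<le> B" "\<And>x. x \<in> {a..b} \<Longrightarrow> norm (f x) \<le> B"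
  shows "norm i \<le> B * measure lborel {a..b}"
  using has_integral_bound_real[of B "{}" f i a b] assms by auto

context radial_interval
begin

text \<open>Up to a first point with \<open>p \<le> 0\<close> the sign condition keeps the flux
  nondecreasing from 0, hence nonnegative, hence \<open>p\<close> nondecreasing from 1; such a point
  cannot exist.\<close>

lemma radial_sol_pos:
  assumes sol: "radial_sol \<Lambda> (\<lambda>t. lam * p t) p w" and init: "p a = 1" "w a = 0"
    and g: "\<And>t. t \<in> {a..b} \<Longrightarrow> lam \<le> \<Lambda> * \<sigma> t / t\<^sup>2" and t: "t \<in> {a..b}"
  shows "p t > 0"
proof (rule ccontr)
  assume neg: "\<not> p t > 0"
  define Z where "Z = {t \<in> {a..b}. p t \<in> {..0}}"
  have cp: "continuous_on {a..b} p" using sol by (simp add: radial_sol_def)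
  have "closed Z" unfolding Z_def
    using continuous_closed_preimage[OF cp, of "{..0}"] by (simp add: vimage_def Int_def)
  then have "compact Z" by (rule compact_eq_bounded_closed[THEN iffD2, OF conjI, rotated])
      (auto simp: Z_def intro: bounded_subset[OF bounded_closed_interval])
  moreover have "t \<in> Z" using t neg by (auto simp: Z_def)
  ultimately obtain t1 where t1: "t1 \<in> Z" "\<And>s. s \<in> Z \<Longrightarrow> t1 \<le> s"
    using compact_attains_inf[of Z] by auto
  have t1': "t1 \<in> {a..b}" "p t1 \<le> 0" using t1 by (auto simp: Z_def)
  have pp: "p s \<ge> 0" if "s \<in> {a..<t1}" for s using t1(2)[of s] that t1' by (force simp: Z_def)
  have w: "w s \<ge> 0" if s: "s \<in> {a..<t1}" for s
  proof -
    have "s \<in> {a..b}" using s t1' by auto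
    from radial_sol_has_integral(2)[OF sol this]
    have "w s - w a \<ge> 0"
    proof (rule has_integral_nonneg)
      fix x assume x: "x \<in> {a..s}"
      then have "x \<in> {a..b}" "x \<in> {a..<t1}" using s t1' by auto
      then have "0 \<le> (\<Lambda> * \<sigma> x / x\<^sup>2 - lam) * p x" using g[of x] pp[of x] by (intro mult_nonneg_nonneg) auto
      moreover have "x ^ (N - 1) \<ge> 0" using x a0 by auto
      ultimately show "0 \<le> x ^ (N - 1) * (\<Lambda> * \<sigma> x / x\<^sup>2 * p x - lam * p x)"
        by (metis left_diff_distrib mult_nonneg_nonneg)
    qed
    then show ?thesis using init by simp
  qed
  have wt: "w s \<ge> 0" if s: "s \<in> {a..t1}" for s
  proof (rule continuous_ge_on_closure[where S = "{a..<t1}" and f = w and a = 0])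
    have "t1 > a" using t1' init by (cases "t1 = a") auto
    then have cl: "closure {a..<t1} = {a..t1}" by simp
    show "continuous_on (closure {a..<t1}) w"
      unfolding cl using sol t1' by (auto simp: radial_sol_def elim: continuous_on_subset)
    show "s \<in> closure {a..<t1}" unfolding cl by (rule s)
  qed (use w in auto)
  have "p t1 - p a \<ge> 0"
    by (rule has_integral_nonneg[OF radial_sol_has_integral(1)[OF sol t1'(1)]])
      (use wt a0 phase_coef_pos[THEN less_imp_le] in auto)
  then show False using init t1' by simp
qed

text \<open>The bounds below only involve \<open>r\<close>, \<open>sm\<close>, \<open>sp\<close>, \<open>N\<close>, \<open>L\<close> and \<open>M\<close>, never \<open>e\<close>.\<close>

definition near_one_const :: "real \<Rightarrow> real \<Rightarrow> real" where
  "near_one_const L M = 4 * (1 / (min sm sp * (r/2) ^ (N - 1))) * ((2 * r) ^ (N - 1) * (L * (sm + sp) / (r/2)\<^sup>2 + M))"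

text \<open>\<open>C1\<close> bounds 1 / (\<sigma> t^(N-1)) and \<open>C2\<close> the coefficient in
  the flux equation, both on r/2 \<le> t \<le> 2 r. Two integrations over a length of at most 2 e
  give |p - 1| \<le> 4 C1 C2 e^2 sup |p|, and smallness of the factor absorbs the supremum.\<close>

lemma radial_sol_near_one:
  assumes sol: "radial_sol \<Lambda> (\<lambda>t. lam * p t) p w" and init: "p a = 1" "w a = 0"
    and \<Lambda>: "0 \<le> \<Lambda>" "\<Lambda> \<le> L" and lam: "0 \<le> lam" "lam \<le> M"
    and e: "e \<le> r / 2" "near_one_const L M * e\<^sup>2 \<le> 1 / 4" and t: "t \<in> {a..b}"
  shows "\<bar>p t - 1\<bar> \<le> 2 * near_one_const L M * e\<^sup>2"
proof -
  define C1 where "C1 = 1 / (min sm sp * (r/2) ^ (N - 1))"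
  define C2 where "C2 = (2 * r) ^ (N - 1) * (L * (sm + sp) / (r/2)\<^sup>2 + M)"
  have C: "C1 \<ge> 0" "C2 \<ge> 0" "near_one_const L M = 4 * C1 * C2"
    using \<Lambda> lam r0 sm0 sp0 by (auto simp: C1_def C2_def near_one_const_def)
  have cp: "continuous_on {a..b} (\<lambda>t. \<bar>p t\<bar>)" using sol by (auto simp: radial_sol_def intro!: continuous_intros)
  obtain tm where tm: "tm \<in> {a..b}" "\<And>s. s \<in> {a..b} \<Longrightarrow> \<bar>p s\<bar> \<le> \<bar>p tm\<bar>"
    using continuous_attains_sup[OF _ _ cp] ab by auto
  define P where "P = \<bar>p tm\<bar>"
  have P0: "P \<ge> 0" by (simp add: P_def)
  have rng: "r / 2 \<le> s" "s \<le> 2 * r" "0 < s" if "s \<in> {a..b}" for s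
    using that e r0 by auto
  have w: "\<bar>w s\<bar> \<le> C2 * P * (2 * e)" if s: "s \<in> {a..b}" for s
  proof -
    have "norm (w s - w a) \<le> C2 * P * measure lborel {a..s}"
    proof (rule has_integral_Icc_bound[OF radial_sol_has_integral(2)[OF sol s]])
      fix x assume "x \<in> {a..s}"
      then have x: "x \<in> {a..b}" using s by auto
      note R = rng[OF x]
      have "\<bar>\<Lambda> * \<sigma> x / x\<^sup>2 - lam\<bar> \<le> \<bar>\<Lambda> * \<sigma> x / x\<^sup>2\<bar> + \<bar>lam\<bar>" by (rule abs_triangle_ineq4)
      also have "\<bar>\<Lambda> * \<sigma> x / x\<^sup>2\<bar> = \<Lambda> * \<sigma> x / x\<^sup>2" using phase_coef_pos[of x] \<Lambda> by (simp add: abs_mult)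
      also have "\<dots> \<le> L * (sm + sp) / (r/2)\<^sup>2"
        using R r0 \<Lambda> phase_coef_le[of x] phase_coef_pos[of x] sm0 sp0 by (intro frac_le mult_mono power_mono) auto
      finally have 1: "\<bar>\<Lambda> * \<sigma> x / x\<^sup>2 - lam\<bar> \<le> L * (sm + sp) / (r/2)\<^sup>2 + M" using lam by simp
      have "\<bar>x ^ (N - 1) * ((\<Lambda> * \<sigma> x / x\<^sup>2 - lam) * p x)\<bar> \<le> (2 * r) ^ (N - 1) * ((L * (sm + sp) / (r/2)\<^sup>2 + M) * P)"
        unfolding abs_mult using R 1 tm(2)[OF x] \<Lambda> lam sm0 sp0 power_mono[of x "2 * r" "N - 1"]
        by (intro mult_mono) (auto simp: P_def)
      then show "norm (x ^ (N - 1) * (\<Lambda> * \<sigma> x / x\<^sup>2 * p x - lam * p x)) \<le> C2 * P"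
        by (simp add: C2_def left_diff_distrib mult.assoc)
    qed (use C P0 in auto)
    also have "\<dots> \<le> C2 * P * (2 * e)" using s C P0 by (intro mult_left_mono) auto
    finally show ?thesis using init by simp
  qed
  have main: "\<bar>p s - 1\<bar> \<le> near_one_const L M * e\<^sup>2 * P" if s: "s \<in> {a..b}" for s
  proof -
    have "norm (p s - p a) \<le> C1 * (C2 * P * (2 * e)) * measure lborel {a..s}"
    proof (rule has_integral_Icc_bound[OF radial_sol_has_integral(1)[OF sol s]])
      fix x assume "x \<in> {a..s}"
      then have x: "x \<in> {a..b}" using s by auto
      note R = rng[OF x]
      have "min sm sp * (r/2) ^ (N - 1) \<le> \<sigma> x * x ^ (N - 1)"
        using R r0 sm0 sp0 phase_coef_pos[of x] by (intro mult_mono power_mono phase_coef_ge) auto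
      moreover have "0 < min sm sp * (r/2) ^ (N - 1)" using r0 sm0 sp0 by auto
      ultimately have "1 / (\<sigma> x * x ^ (N - 1)) \<le> C1" unfolding C1_def by (intro divide_left_mono) auto
      then have "\<bar>1 / (\<sigma> x * x ^ (N - 1)) * w x\<bar> \<le> C1 * (C2 * P * (2 * e))"
        unfolding abs_mult using w[OF x] R phase_coef_pos[of x] C by (intro mult_mono) auto
      then show "norm (w x / (\<sigma> x * x ^ (N - 1))) \<le> C1 * (C2 * P * (2 * e))" by simp
    qed (use C P0 e0 in auto)
    also have "\<dots> \<le> C1 * (C2 * P * (2 * e)) * (2 * e)" using s C P0 e0 by (intro mult_left_mono) auto
    also have "\<dots> = near_one_const L M * e\<^sup>2 * P" by (simp add: C power2_eq_square)
    finally show ?thesis using init by simp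
  qed
  have "P \<le> 1 + \<bar>p tm - 1\<bar>" by (simp add: P_def)
  also have "\<dots> \<le> 1 + (1/4) * P" using main[OF tm(1)] mult_right_mono[OF e(2) P0] by simp
  finally have "P \<le> 2" by simp
  moreover have "near_one_const L M * e\<^sup>2 \<ge> 0" using C by auto
  ultimately have "near_one_const L M * e\<^sup>2 * P \<le> near_one_const L M * e\<^sup>2 * 2" by (intro mult_left_mono) auto
  then show ?thesis using main[OF t] by simp
qed

text \<open>Only the left Neumann condition is imposed, so that the right one becomes the scalar
  equation \<open>w b = 0\<close> in \<open>lam\<close>; \<open>p a = 1\<close> is a
  normalisation.\<close>

definition shooting :: "real \<Rightarrow> real \<Rightarrow> (real \<Rightarrow> real) \<Rightarrow> (real \<Rightarrow> real) \<Rightarrow> bool" where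
  "shooting \<Lambda> lam p w \<longleftrightarrow> radial_sol \<Lambda> (\<lambda>t. lam * p t) p w \<and> p a = 1 \<and> w a = 0"

lemma shooting_exists: obtains p w where "shooting \<Lambda> lam p w"
  using radial_sol_exists[of "\<lambda>_. 0" \<Lambda> lam 1] by (force simp: shooting_def)

lemma shooting_wronskian:
  assumes "shooting \<Lambda> lam p w" "shooting \<Lambda>' lam' p' w'"
  shows "((\<lambda>t. t ^ (N - 1) * (((\<Lambda> - \<Lambda>') * \<sigma> t / t\<^sup>2 + (lam' - lam)) * (p t * p' t))) has_integral
     (w b * p' b - w' b * p b)) {a..b}"
proof -
  have "((\<lambda>t. t ^ (N - 1) * ((\<Lambda> - \<Lambda>') * \<sigma> t / t\<^sup>2 * p t * p' t - (lam * p t) * p' t + (lam' * p' t) * p t)) has_integral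
     (w b * p' b - w' b * p b)) {a..b}"
    using wronskian[of \<Lambda> "\<lambda>t. lam * p t" p w \<Lambda>' "\<lambda>t. lam' * p' t" p' w'] assms
    by (auto simp: shooting_def)
  then show ?thesis
    by (rule has_integral_eq[rotated]) (simp add: algebra_simps)
qed

end

text \<open>Radial solutions with \<open>p a = 1\<close> and \<open>w a = 0\<close> stay positive for every \<open>\<Lambda> \<ge> 0\<close> and
  \<open>lam \<in> {0..M}\<close>: for \<open>\<Lambda> \<le> L\<close> since the shell is thin, for \<open>\<Lambda> \<ge> L\<close> since they increase.\<close>

locale thin_shell = radial_interval +
  fixes L M :: real
  assumes L0: "L \<ge> 0" and M0: "M \<ge> 0" and e_half: "e \<le> r / 2" and e_small: "near_one_const L M * e\<^sup>2 \<le> 1 / 4"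
    and LM: "M * (2 * r)\<^sup>2 \<le> L * min sm sp"
begin

lemma shooting_near_one:
  assumes "shooting \<Lambda> lam p w" "0 \<le> \<Lambda>" "\<Lambda> \<le> L" "0 \<le> lam" "lam \<le> M" "t \<in> {a..b}"
  shows "1/2 \<le> p t" "p t \<le> 3/2"
proof -
  have "\<bar>p t - 1\<bar> \<le> 2 * near_one_const L M * e\<^sup>2"
    using radial_sol_near_one[of \<Lambda> lam p w L M t] assms e_half e_small by (auto simp: shooting_def)
  then show "1/2 \<le> p t" "p t \<le> 3/2" using e_small by (auto simp: abs_le_iff)
qed

lemma shooting_pos:
  assumes sh: "shooting \<Lambda> lam p w" and "0 \<le> \<Lambda>" "0 \<le> lam" "lam \<le> M" and t: "t \<in> {a..b}"
  shows "p t > 0"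
proof (cases "\<Lambda> \<le> L")
  case True
  then show ?thesis using shooting_near_one(1)[of \<Lambda> lam p w t] assms by auto
next
  case False
  have "lam \<le> \<Lambda> * \<sigma> s / s\<^sup>2" if s: "s \<in> {a..b}" for s
  proof -
    have s': "0 < s" "s \<le> 2 * r" using s a0 e_half r0 by auto
    \<comment> \<open>\<open>LM\<close> is made for this chain: it gives the zero-order coefficient
      the sign that \<open>radial_sol_pos\<close> asks for.\<close>
    have "lam * s\<^sup>2 \<le> M * (2 * r)\<^sup>2" using s' assms M0 by (intro mult_mono power_mono) auto
    also have "\<dots> \<le> L * min sm sp" by (rule LM)
    also have "\<dots> \<le> \<Lambda> * \<sigma> s" using False L0 sm0 sp0 phase_coef_pos[of s] by (intro mult_mono phase_coef_ge) auto
    finally show ?thesis using s' by (simp add: pos_le_divide_eq)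
  qed
  then show ?thesis using sh t by (intro radial_sol_pos[of \<Lambda> lam p w t]) (auto simp: shooting_def)
qed

section \<open>Radial Neumann eigenvalues and solvability of the radial problem\<close>

text \<open>The relation whose graph is the branch \<nu>(\<Lambda>) of the overview; for \<Lambda>
  \<ge> 0 and \<open>lam\<close> between 0 and \<open>M\<close> it is single-valued.\<close>

definition root :: "real \<Rightarrow> real \<Rightarrow> bool" where
  "root \<Lambda> lam \<longleftrightarrow> (\<exists>p w. shooting \<Lambda> lam p w \<and> w b = 0)"

text \<open>The fluxes vanish at both ends, so the Wronskian integral is 0; both solutions being
  positive, \<open>lam > lam'\<close> would make its integrand positive.\<close>

lemma root_mono:
  assumes "root \<Lambda> lam" "root \<Lambda>' lam'" "0 \<le> \<Lambda>" "\<Lambda> \<le> \<Lambda>'" "0 \<le> lam" "lam \<le> M" "0 \<le> lam'" "lam' \<le> M"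
  shows "lam \<le> lam'"
proof (rule ccontr)
  assume less: "\<not> lam \<le> lam'"
  obtain p w p' w' where sh: "shooting \<Lambda> lam p w" "w b = 0" "shooting \<Lambda>' lam' p' w'" "w' b = 0"
    using assms by (auto simp: root_def)
  define F where "F t = t ^ (N - 1) * (((\<Lambda>' - \<Lambda>) * \<sigma> t / t\<^sup>2 + (lam - lam')) * (p' t * p t))" for t
  \<comment> \<open>\<open>F\<close> jumps at \<open>r\<close> with \<sigma>; its continuous
    minorant \<open>F0\<close> admits the argument that a nonnegative continuous function with
    integral 0 vanishes.\<close>
  define F0 where "F0 t = t ^ (N - 1) * ((lam - lam') * (p' t * p t))" for t
  have int: "(F has_integral 0) {a..b}"
    using shooting_wronskian[OF sh(3,1)] sh unfolding F_def by simp
  have pp: "0 < p t" "0 < p' t" if "t \<in> {a..b}" for t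
    using shooting_pos[OF sh(1) _ _ _ that] shooting_pos[OF sh(3) _ _ _ that] assms by auto
  have c: "continuous_on {a..b} F0" unfolding F0_def
    using sh by (intro continuous_intros) (auto simp: shooting_def radial_sol_def)
  have F0pos: "F0 t > 0" if "t \<in> {a..b}" for t
    using pp[OF that] that less a0 by (auto simp: F0_def)
  have le: "F0 t \<le> F t" if t: "t \<in> {a..b}" for t
    unfolding F0_def F_def using pp[OF t] t a0 assms phase_coef_pos[of t]
    by (intro mult_left_mono mult_right_mono) auto
  have i0: "F0 integrable_on {a..b}" by (rule integrable_continuous_real[OF c])
  have "integral {a..b} F0 \<le> integral {a..b} F"
    by (rule integral_le[OF i0 _ le]) (use int in auto)
  then have "integral {a..b} F0 \<le> 0" using int by (simp add: integral_unique)
  moreover have "integral {a..b} F0 \<ge> 0" using F0pos by (intro integral_nonneg i0) (auto intro: less_imp_le)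
  ultimately have "(F0 has_integral 0) (cbox a b)" using i0 by (simp add: has_integral_iff)
  then have "F0 a = 0"
    using has_integral_0_cbox_imp_0[of a b F0 a] c F0pos ab by (force intro: less_imp_le)
  then show False using F0pos[of a] ab by auto
qed

lemma root_unique:
  assumes "root \<Lambda> lam" "root \<Lambda> lam'" "0 \<le> \<Lambda>" "0 \<le> lam" "lam \<le> M" "0 \<le> lam'" "lam' \<le> M"
  shows "lam = lam'"
  using root_mono[of \<Lambda> lam \<Lambda> lam'] root_mono[of \<Lambda> lam' \<Lambda> lam] assms by auto

text \<open>The intermediate value theorem is applied to the quotient w(b) / p(b) as a function of
  \<open>lam\<close>. The Wronskian of two shooting solutions controls its dependence on
  \<open>lam\<close>, and integrating the flux equation gives its signs at 0 and at
  \<open>M\<close>.\<close>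

lemma root_exists:
  assumes \<Lambda>: "0 \<le> \<Lambda>" "\<Lambda> \<le> L" and M: "\<Lambda> * (sm + sp) < M * (r/2)\<^sup>2"
  obtains lam where "0 \<le> lam" "lam \<le> M" "root \<Lambda> lam"
proof -
  have "\<forall>lam. \<exists>pw. shooting \<Lambda> lam (fst pw) (snd pw)"
    using shooting_exists by (metis fst_conv snd_conv)
  then obtain f where f: "\<And>lam. shooting \<Lambda> lam (fst (f lam)) (snd (f lam))" by metis
  define p where "p lam = fst (f lam)" for lam
  define w where "w lam = snd (f lam)" for lam
  have sh: "shooting \<Lambda> lam (p lam) (w lam)" for lam using f by (simp add: p_def w_def)
  have p1: "1/2 \<le> p lam t" "p lam t \<le> 3/2" if "lam \<in> {0..M}" "t \<in> {a..b}" for lam t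
    using shooting_near_one[OF sh _ _ _ _ that(2)] that(1) \<Lambda> by auto
  have bb: "b \<in> {a..b}" using ab by auto
  define G where "G lam = w lam b / p lam b" for lam
  \<comment> \<open>Here 3/2 bounds both solutions from above, and the 4 comes from their lower
    bound 1/2 at \<open>b\<close>.\<close>
  define C where "C = 4 * (b ^ (N - 1) * (3/2 * (3/2)) * (b - a))"
  have C0: "C \<ge> 0" using ab a0 by (auto simp: C_def)
  have lip: "\<bar>G x - G y\<bar> \<le> C * \<bar>x - y\<bar>" if xy: "x \<in> {0..M}" "y \<in> {0..M}" for x y
  proof -
    have "norm (w x b * p y b - w y b * p x b) \<le> (\<bar>x - y\<bar> * (b ^ (N - 1) * (3/2 * (3/2)))) * measure lborel {a..b}"
    proof (rule has_integral_Icc_bound[OF shooting_wronskian[OF sh[of x] sh[of y]]])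
      fix t assume t: "t \<in> {a..b}"
      note P = p1[OF xy(1) t] p1[OF xy(2) t]
      have "\<bar>t ^ (N - 1) * (p x t * p y t)\<bar> \<le> b ^ (N - 1) * (3/2 * (3/2))"
        unfolding abs_mult using P t a0 by (intro mult_mono) (auto simp: power_mono)
      then have "\<bar>y - x\<bar> * \<bar>t ^ (N - 1) * (p x t * p y t)\<bar> \<le> \<bar>y - x\<bar> * (b ^ (N - 1) * (3/2 * (3/2)))"
        by (intro mult_left_mono) auto
      then show "norm (t ^ (N - 1) * (((\<Lambda> - \<Lambda>) * \<sigma> t / t\<^sup>2 + (y - x)) * (p x t * p y t))) \<le> \<bar>x - y\<bar> * (b ^ (N - 1) * (3/2 * (3/2)))"
        by (simp add: abs_mult abs_minus_commute mult.left_commute)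
    qed (use ab a0 in auto)
    then have 1: "\<bar>w x b * p y b - w y b * p x b\<bar> \<le> (C / 4) * \<bar>x - y\<bar>"
      using ab by (simp add: C_def algebra_simps)
    note P = p1[OF xy(1) bb] p1[OF xy(2) bb]
    have "G x - G y = (w x b * p y b - w y b * p x b) / (p x b * p y b)"
      using P by (simp add: G_def field_simps)
    then have "\<bar>G x - G y\<bar> = \<bar>w x b * p y b - w y b * p x b\<bar> / (p x b * p y b)"
      using P by (simp add: abs_mult)
    also have "\<dots> \<le> ((C / 4) * \<bar>x - y\<bar>) / (1/2 * (1/2))"
      using P C0 1 by (intro frac_le mult_mono) auto
    finally show ?thesis by simp
  qed
  have cG: "continuous_on {0..M} G"
    by (rule lipschitz_on_continuous_on[of C]) (use lip C0 in \<open>auto simp: lipschitz_on_def dist_real_def\<close>)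
  have wint: "((\<lambda>s. s ^ (N - 1) * ((\<Lambda> * \<sigma> s / s\<^sup>2 - lam) * p lam s)) has_integral w lam b) {a..b}" for lam
    using radial_sol_has_integral(2)[of \<Lambda> "\<lambda>t. lam * p lam t" "p lam" "w lam" b] sh[of lam] bb
    by (simp add: shooting_def left_diff_distrib)
  have "w 0 b \<ge> 0"
  proof (rule has_integral_nonneg[OF wint[of 0]])
    fix t assume t: "t \<in> {a..b}"
    then show "0 \<le> t ^ (N - 1) * ((\<Lambda> * \<sigma> t / t\<^sup>2 - 0) * p 0 t)"
      using p1[of 0 t] \<Lambda> M0 a0 phase_coef_pos[of t] by auto
  qed
  then have G0: "G 0 \<ge> 0" using p1[of 0 b] bb M0 by (auto simp: G_def)
  \<comment> \<open>The assumption on \<open>M\<close> makes it dominate \<Lambda> \<sigma> / t^2 on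
    the whole interval, so the flux can only decrease from 0.\<close>
  have "0 \<le> - w M b"
  proof (rule has_integral_nonneg[OF has_integral_neg[OF wint[of M]]])
    fix t assume t: "t \<in> {a..b}"
    have "\<Lambda> * \<sigma> t \<le> \<Lambda> * (sm + sp)" using \<Lambda> phase_coef_le[of t] by (intro mult_left_mono) auto
    also have "\<dots> \<le> M * (r/2)\<^sup>2" using M by simp
    also have "\<dots> \<le> M * t\<^sup>2" using t e_half M0 r0 by (intro mult_left_mono power_mono) auto
    finally have "\<Lambda> * \<sigma> t / t\<^sup>2 \<le> M" using t a0 by (simp add: pos_divide_le_eq)
    then have "0 \<le> t ^ (N - 1) * ((M - \<Lambda> * \<sigma> t / t\<^sup>2) * p M t)"
      using p1[of M t] t M0 a0 by (intro mult_nonneg_nonneg) auto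
    then show "0 \<le> - (t ^ (N - 1) * ((\<Lambda> * \<sigma> t / t\<^sup>2 - M) * p M t))"
      by (simp add: algebra_simps)
  qed
  then have GM: "G M \<le> 0" using p1[of M b] bb M0 by (auto simp: G_def divide_nonpos_pos)
  obtain x where x: "0 \<le> x" "x \<le> M" "G x = 0"
    using IVT2'[of G M 0 0] G0 GM M0 cG by auto
  then have "w x b = 0" using p1[of x b] bb by (auto simp: G_def)
  then have "root \<Lambda> x" using sh[of x] by (auto simp: root_def)
  then show ?thesis using that x by auto
qed

text \<open>The Fredholm alternative. Away from roots a multiple of the shooting solution corrects
  the flux of a particular solution at \<open>b\<close>; at a root the Wronskian with the shooting
  solution turns orthogonality into \<open>w b = 0\<close>.\<close>

lemma radial_neumann_solvable:
  assumes sh: "shooting \<Lambda> lam p1 w1" and \<Lambda>: "0 \<le> \<Lambda>" "0 \<le> lam" "lam \<le> M" and q: "continuous_on {a..b} q"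
    and alt: "w1 b \<noteq> 0 \<or> integral {a..b} (\<lambda>t. t ^ (N - 1) * (q t * p1 t)) = 0"
  obtains p w where "radial_sol \<Lambda> (\<lambda>t. lam * p t + q t) p w" "w a = 0" "w b = 0"
proof -
  obtain p w where pw: "radial_sol \<Lambda> (\<lambda>t. lam * p t + q t) p w" "p a = 0" "w a = 0"
    using radial_sol_exists[OF q] by metis
  show ?thesis
  proof (cases "w1 b = 0")
    case True
    have "((\<lambda>t. t ^ (N - 1) * ((\<Lambda> - \<Lambda>) * \<sigma> t / t\<^sup>2 * p t * p1 t - (lam * p t + q t) * p1 t + lam * p1 t * p t))
       has_integral w b * p1 b) {a..b}"
      using wronskian[OF pw(1), of \<Lambda> "\<lambda>t. lam * p1 t" p1 w1] sh True pw by (simp add: shooting_def)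
    then have "((\<lambda>t. - (t ^ (N - 1) * (q t * p1 t))) has_integral w b * p1 b) {a..b}"
      by (rule has_integral_eq[rotated]) (simp add: algebra_simps)
    then have "((\<lambda>t. t ^ (N - 1) * (q t * p1 t)) has_integral - (w b * p1 b)) {a..b}"
      by (simp only: has_integral_neg_iff)
    then have "w b * p1 b = 0" using alt True by (simp add: integral_unique)
    moreover have "p1 b > 0" using shooting_pos[OF sh] \<Lambda> ab by auto
    ultimately show ?thesis using that pw by auto
  next
    case False
    have "radial_sol \<Lambda> (\<lambda>t. (lam * p t + q t) + (- w b / w1 b) * (lam * p1 t)) (\<lambda>t. p t + (- w b / w1 b) * p1 t) (\<lambda>t. w t + (- w b / w1 b) * w1 t)"
      by (rule radial_sol_add) (use pw sh in \<open>auto simp: shooting_def\<close>)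
    moreover have "(\<lambda>t. (lam * p t + q t) + (- w b / w1 b) * (lam * p1 t)) = (\<lambda>t. lam * (p t + (- w b / w1 b) * p1 t) + q t)"
      by (simp add: algebra_simps)
    ultimately have "radial_sol \<Lambda> (\<lambda>t. lam * (p t + (- w b / w1 b) * p1 t) + q t) (\<lambda>t. p t + (- w b / w1 b) * p1 t) (\<lambda>t. w t + (- w b / w1 b) * w1 t)"
      by simp
    then show ?thesis by (rule that) (use False pw sh in \<open>auto simp: shooting_def\<close>)
  qed
qed

end

section \<open>Laplace--Beltrami eigenfunctions as homogeneous functions\<close>

text \<open>Functions on the sphere are represented by their \<open>0\<close>-homogeneous extensions \<open>Y\<close>; then
  \<open>K = \<bar>x - c\<bar>\<^sup>2 \<Delta>Y\<close> is the Laplace--Beltrami operator of the unit sphere.\<close>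

definition has_lb :: "'a::euclidean_space \<Rightarrow> ('a \<Rightarrow> real) \<Rightarrow> ('a \<Rightarrow> 'a \<Rightarrow> real) \<Rightarrow> ('a \<Rightarrow> 'a \<Rightarrow> 'a \<Rightarrow> real) \<Rightarrow> ('a \<Rightarrow> real) \<Rightarrow> bool" where
  "has_lb c Y DY D2Y K \<longleftrightarrow>
     (\<forall>x t. x \<noteq> c \<longrightarrow> t > 0 \<longrightarrow> Y (c + t *\<^sub>R (x - c)) = Y x) \<and>
     (\<forall>x. x \<noteq> c \<longrightarrow> (Y has_derivative DY x) (at x)) \<and>
     (\<forall>x i. x \<noteq> c \<longrightarrow> ((\<lambda>y. DY y i) has_derivative D2Y x i) (at x)) \<and>
     (\<forall>i j. continuous_on (- {c}) (\<lambda>x. D2Y x i j)) \<and>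
     (\<forall>x. x \<noteq> c \<longrightarrow> (\<Sum>i\<in>Basis. D2Y x i i) = K x / (norm (x - c))\<^sup>2)"

definition harmonic0 :: "'a::euclidean_space \<Rightarrow> real \<Rightarrow> ('a \<Rightarrow> real) \<Rightarrow> bool" where
  "harmonic0 c \<Lambda> Y \<longleftrightarrow> (\<exists>DY D2Y. has_lb c Y DY D2Y (\<lambda>x. - \<Lambda> * Y x))"

lemma has_lb_add:
  assumes "has_lb c Y DY D2Y K" "has_lb c Z DZ D2Z K'"
  shows "has_lb c (\<lambda>x. Y x + Z x) (\<lambda>x v. DY x v + DZ x v) (\<lambda>x i v. D2Y x i v + D2Z x i v) (\<lambda>x. K x + K' x)"
  using assms unfolding has_lb_def
  by (auto intro!: has_derivative_add continuous_on_add simp: sum.distrib add_divide_distrib)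

lemma has_lb_cmul:
  assumes "has_lb c Y DY D2Y K"
  shows "has_lb c (\<lambda>x. \<beta> * Y x) (\<lambda>x v. \<beta> * DY x v) (\<lambda>x i v. \<beta> * D2Y x i v) (\<lambda>x. \<beta> * K x)"
  using assms unfolding has_lb_def
  by (auto intro!: has_derivative_mult_right continuous_on_mult_left simp: sum_distrib_left[symmetric])

lemma has_lb_zero: "has_lb c (\<lambda>x. 0) (\<lambda>x v. 0) (\<lambda>x i v. 0) (\<lambda>x. 0)"
  unfolding has_lb_def by auto

lemma has_lb_sum:
  assumes "\<And>l. l \<in> S \<Longrightarrow> \<exists>DY D2Y. has_lb c (Y l) DY D2Y (K l)" "finite S"
  shows "\<exists>DY D2Y. has_lb c (\<lambda>x. \<Sum>l\<in>S. Y l x) DY D2Y (\<lambda>x. \<Sum>l\<in>S. K l x)"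
  using assms(2,1)
proof (induction S rule: finite_induct)
  case empty
  then show ?case using has_lb_zero[of c] by auto
next
  case (insert l S)
  obtain D D2 where "has_lb c (Y l) D D2 (K l)" using insert(4)[of l] by blast
  moreover obtain D' D2' where "has_lb c (\<lambda>x. \<Sum>l\<in>S. Y l x) D' D2' (\<lambda>x. \<Sum>l\<in>S. K l x)"
    using insert(3,4) by blast
  ultimately have "has_lb c (\<lambda>x. \<Sum>l\<in>insert l S. Y l x) (\<lambda>x v. D x v + D' x v) (\<lambda>x i v. D2 x i v + D2' x i v)
     (\<lambda>x. \<Sum>l\<in>insert l S. K l x)"
    using has_lb_add[of c "Y l" D D2 "K l"] insert(1,2) by simp
  then show ?case by blast
qed

lemma has_lb_cong:
  assumes "has_lb c Y DY D2Y K" "\<And>x. x \<noteq> c \<Longrightarrow> K x = K' x"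
  shows "has_lb c Y DY D2Y K'"
  using assms unfolding has_lb_def by auto

lemma harmonic0_cmul:
  assumes "harmonic0 c \<Lambda> Y" shows "harmonic0 c \<Lambda> (\<lambda>x. \<beta> * Y x)"
proof -
  obtain DY D2Y where "has_lb c Y DY D2Y (\<lambda>x. - \<Lambda> * Y x)" using assms by (auto simp: harmonic0_def)
  from has_lb_cong[OF has_lb_cmul[OF this, of \<beta>], of "\<lambda>x. - \<Lambda> * (\<beta> * Y x)"]
  show ?thesis unfolding harmonic0_def by auto
qed

section \<open>Homogeneous polynomials and their Laplacians\<close>

inductive hpoly :: "nat \<Rightarrow> ('a::euclidean_space \<Rightarrow> real) \<Rightarrow> bool" where
  const: "hpoly 0 (\<lambda>x. \<alpha>)"
| mult: "hpoly m P \<Longrightarrow> i \<in> Basis \<Longrightarrow> hpoly (Suc m) (\<lambda>x. (x \<bullet> i) * P x)"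
| add: "hpoly m P \<Longrightarrow> hpoly m Q \<Longrightarrow> hpoly m (\<lambda>x. P x + Q x)"

lemma hpoly_cmul: "hpoly m P \<Longrightarrow> hpoly m (\<lambda>x. \<beta> * P x)"
proof (induction rule: hpoly.induct)
  case (mult m P i)
  then show ?case using hpoly.mult[OF mult(3,2)] by (simp add: mult.left_commute)
next
  case (add m P Q)
  then show ?case using hpoly.add[OF add(3,4)] by (simp add: distrib_left)
qed (rule hpoly.const)

lemma hpoly_zero: "hpoly m (\<lambda>x::'a::euclidean_space. 0)"
proof (induction m)
  case (Suc m)
  then show ?case using hpoly.mult[OF Suc, of "SOME i. i \<in> Basis"] by (simp add: some_in_eq)
qed (rule hpoly.const)

lemma hpoly_sum:
  assumes "\<And>i. i \<in> S \<Longrightarrow> hpoly m (P i)" "finite S"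
  shows "hpoly m (\<lambda>x. \<Sum>i\<in>S. P i x)"
  using assms(2,1) by (induction S rule: finite_induct) (auto intro: hpoly.add hpoly_zero)

lemma hpoly_mult:
  assumes "hpoly m P" "hpoly k Q" shows "hpoly (m + k) (\<lambda>x. P x * Q x)"
  using assms
proof (induction rule: hpoly.induct)
  case (const \<alpha>)
  then show ?case using hpoly_cmul by auto
next
  case (mult m P i)
  then show ?case using hpoly.mult[OF mult(3)[OF mult(4)] mult(2)] by (simp add: mult.assoc)
next
  case (add m P R)
  then show ?case using hpoly.add[OF add(3)[OF add(5)] add(4)[OF add(5)]] by (simp add: distrib_right)
qed

lemma hpoly_scaleR: "hpoly m P \<Longrightarrow> P (t *\<^sub>R x) = t ^ m * P x"
  by (induction rule: hpoly.induct) (auto simp: algebra_simps)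

text \<open>The last conjunct is Euler's identity. The clause for \<open>m = 0\<close> makes up for
  truncated subtraction, by which degree \<open>m - 1\<close> would only say that the derivative of
  a constant is constant.\<close>

lemma hpoly_derivative:
  assumes "hpoly m (P :: 'a::euclidean_space \<Rightarrow> real)"
  shows "\<exists>D. (\<forall>x. (P has_derivative D x) (at x)) \<and> (\<forall>v. hpoly (m - 1) (\<lambda>x. D x v)) \<and>
     (m = 0 \<longrightarrow> (\<forall>x v. D x v = 0)) \<and> (\<forall>x. D x x = m * P x)"
  using assms
proof (induction rule: hpoly.induct)
  case (const \<alpha>)
  show ?case by (rule exI[of _ "\<lambda>x v. 0"]) (auto intro: hpoly_zero)
next
  case (mult m P i)
  then obtain D where D: "\<And>x. (P has_derivative D x) (at x)" "\<And>v. hpoly (m - 1) (\<lambda>x. D x v)"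
    "\<And>x v. m = 0 \<Longrightarrow> D x v = 0" "\<And>x. D x x = m * P x" by blast
  have "hpoly m (\<lambda>x. (x \<bullet> i) * D x v)" for v
  proof (cases m)
    case 0
    then show ?thesis using D(3) hpoly_zero[of m] by simp
  next
    case (Suc k)
    then show ?thesis using hpoly.mult[OF D(2)[of v] mult(2)] by simp
  qed
  then have "hpoly m (\<lambda>x. (x \<bullet> i) * D x v + (v \<bullet> i) * P x)" for v
    by (intro hpoly.add hpoly_cmul mult)
  moreover have "((\<lambda>x. (x \<bullet> i) * P x) has_derivative (\<lambda>v. (x \<bullet> i) * D x v + (v \<bullet> i) * P x)) (at x)" for x
    by (rule derivative_eq_intros D(1) refl)+ auto
  ultimately show ?case
    by (intro exI[of _ "\<lambda>x v. (x \<bullet> i) * D x v + (v \<bullet> i) * P x"]) (auto simp: D(4) algebra_simps)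
next
  case (add m P Q)
  then obtain D E where D: "\<And>x. (P has_derivative D x) (at x)" "\<And>v. hpoly (m - 1) (\<lambda>x. D x v)"
    "\<And>x v. m = 0 \<Longrightarrow> D x v = 0" "\<And>x. D x x = m * P x"
    and E: "\<And>x. (Q has_derivative E x) (at x)" "\<And>v. hpoly (m - 1) (\<lambda>x. E x v)"
    "\<And>x v. m = 0 \<Longrightarrow> E x v = 0" "\<And>x. E x x = m * Q x" by metis
  show ?case
    by (intro exI[of _ "\<lambda>x v. D x v + E x v"])
      (auto intro!: has_derivative_add hpoly.add D(1) E(1) D(2)[simplified] E(2)[simplified] simp: D(3,4) E(3,4) algebra_simps)
qed

lemma hpoly_continuous: "hpoly m P \<Longrightarrow> continuous_on S P"
  by (induction rule: hpoly.induct) (auto intro!: continuous_intros)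

text \<open>The derivative of |y|^(-k) is written with |y|^(k+2), so the result again consists of
  quotients by powers of the norm and a second application yields the second derivatives.\<close>

lemma has_derivative_over_norm_power:
  fixes Q :: "'a::euclidean_space \<Rightarrow> real"
  assumes "(Q has_derivative Q') (at (x - c))" "x \<noteq> c"
  shows "((\<lambda>x. Q (x - c) / norm (x - c) ^ k) has_derivative
     (\<lambda>v. Q' v / norm (x - c) ^ k - k * Q (x - c) * ((x - c) \<bullet> v) / norm (x - c) ^ (k + 2))) (at x)"
proof -
  let ?n = "norm (x - c)"
  have n: "?n > 0" using assms by auto
  have 1: "((\<lambda>x. Q (x - c)) has_derivative Q') (at x)"
    by (rule has_derivative_compose[where g = Q and f = "\<lambda>x. x - c", of "\<lambda>v. v", unfolded o_def])
      (use assms in \<open>auto intro!: derivative_eq_intros\<close>)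
  have 2: "((\<lambda>x. norm (x - c)) has_derivative (\<lambda>v. v \<bullet> sgn (x - c))) (at x)"
    by (rule has_derivative_compose[where g = norm and f = "\<lambda>x. x - c", of "\<lambda>v. v", unfolded o_def])
      (use assms in \<open>auto intro!: derivative_eq_intros has_derivative_norm\<close>)
  show ?thesis
  proof (cases k)
    case 0
    then show ?thesis using 1 by simp
  next
    case (Suc j)
    have 3: "((\<lambda>x. Q (x - c) / norm (x - c) ^ k) has_derivative
       (\<lambda>v. (Q' v * ?n ^ k - Q (x - c) * (k * (v \<bullet> sgn (x - c)) * ?n ^ (k - 1))) / (?n ^ k * ?n ^ k))) (at x)"
      by (rule has_derivative_divide' has_derivative_power 1 2)+ (use n in auto)
    have "(Q' v * ?n ^ k - Q (x - c) * (k * (v \<bullet> sgn (x - c)) * ?n ^ (k - 1))) / (?n ^ k * ?n ^ k)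
       = Q' v / ?n ^ k - k * Q (x - c) * ((x - c) \<bullet> v) / ?n ^ (k + 2)" for v
      using n by (simp add: Suc sgn_div_norm inner_commute divide_simps) (simp add: algebra_simps)
    then show ?thesis using 3 by simp
  qed
qed

text \<open>Euler's identity evaluates the mixed term in the Laplacian of P |y|^(-m); together with
  the Laplacian of |y|^(-m) everything of order zero in \<open>P\<close> collects to -m (m + n - 2)
  P |y|^(-m-2). \<open>E v x\<close> differentiates \<open>D x v\<close> in \<open>x\<close>, so
  \<open>LP\<close> is the Laplacian of \<open>P\<close>. The form for arbitrary homogeneous
  functions also serves the explicit harmonic polynomials.\<close>

lemma homogeneous_has_lb:
  fixes P :: "'a::euclidean_space \<Rightarrow> real"
  assumes D: "\<And>x. (P has_derivative D x) (at x)"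
    and E: "\<And>v x. ((\<lambda>x. D x v) has_derivative E v x) (at x)" "\<And>v w. continuous_on UNIV (\<lambda>x. E v x w)"
    and hom: "\<And>t x. P (t *\<^sub>R x) = t ^ m * P x" and euler: "\<And>x. D x x = m * P x"
    and LP: "\<And>x. LP x = (\<Sum>i\<in>Basis. E i x i)" and LP0: "\<And>x. m < 2 \<Longrightarrow> LP x = 0"
  shows "\<exists>DY D2Y. has_lb c (\<lambda>x. P (x - c) / norm (x - c) ^ m) DY D2Y
       (\<lambda>x. LP (x - c) / norm (x - c) ^ (m - 2) - m * (m + real DIM('a) - 2) * (P (x - c) / norm (x - c) ^ m))"
proof -
  define DY where "DY x v = D (x - c) v / norm (x - c) ^ m - m * P (x - c) * ((x - c) \<bullet> v) / norm (x - c) ^ (m + 2)" for x v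
  define D2Y where "D2Y x i v = (E i (x - c) v / norm (x - c) ^ m - real m * D (x - c) i * ((x - c) \<bullet> v) / norm (x - c) ^ (m + 2))
     - real m * ((D (x - c) v * ((x - c) \<bullet> i) + P (x - c) * (v \<bullet> i)) / norm (x - c) ^ (m + 2)
        - (real m + 2) * (P (x - c) * ((x - c) \<bullet> i)) * ((x - c) \<bullet> v) / norm (x - c) ^ (m + 2 + 2))" for x i v
  have lb: "has_lb c (\<lambda>x. P (x - c) / norm (x - c) ^ m) DY D2Y
       (\<lambda>x. LP (x - c) / norm (x - c) ^ (m - 2) - m * (m + real DIM('a) - 2) * (P (x - c) / norm (x - c) ^ m))"
    unfolding has_lb_def
  proof (intro conjI allI impI)
    fix x :: 'a and t :: real assume "x \<noteq> c" "t > 0"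
    then show "P (c + t *\<^sub>R (x - c) - c) / norm (c + t *\<^sub>R (x - c) - c) ^ m = P (x - c) / norm (x - c) ^ m"
      by (simp add: hom power_mult_distrib)
  next
    fix x :: 'a assume "x \<noteq> c"
    then show "((\<lambda>x. P (x - c) / norm (x - c) ^ m) has_derivative DY x) (at x)"
      unfolding DY_def by (rule has_derivative_over_norm_power[OF D])
  next
    fix x i :: 'a assume x: "x \<noteq> c"
    have 1: "((\<lambda>x. P x * (x \<bullet> i)) has_derivative (\<lambda>v. P (x - c) * (v \<bullet> i) + D (x - c) v * ((x - c) \<bullet> i))) (at (x - c))"
      by (rule derivative_eq_intros D refl)+
    note 2 = has_derivative_diff[OF has_derivative_over_norm_power[OF E(1)[of i "x - c"] x, of m]
        has_derivative_mult_right[OF has_derivative_over_norm_power[OF 1 x, of "m + 2"], of "real m"]]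
    have "((\<lambda>x. D (x - c) i / norm (x - c) ^ m - m * (P (x - c) * ((x - c) \<bullet> i) / norm (x - c) ^ (m + 2))) has_derivative D2Y x i) (at x)"
      unfolding D2Y_def by (rule has_derivative_eq_rhs[OF 2]) (simp add: fun_eq_iff add_divide_distrib algebra_simps)
    then show "((\<lambda>y. DY y i) has_derivative D2Y x i) (at x)"
      unfolding DY_def by (simp add: mult.assoc)
  next
    fix i j :: 'a
    have c1: "continuous_on (- {c}) (\<lambda>x. f (x - c))" if "continuous_on UNIV f" for f :: "'a \<Rightarrow> real"
      by (rule continuous_on_compose2[OF that]) (auto intro!: continuous_intros)
    have "continuous_on UNIV P" "\<And>v. continuous_on UNIV (\<lambda>x. D x v)"
      using D E(1) by (auto intro!: continuous_at_imp_continuous_on intro: has_derivative_continuous)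
    note c2 = c1[OF this(1)] c1[OF this(2)] c1[OF E(2)]
    show "continuous_on (- {c}) (\<lambda>x. D2Y x i j)"
      unfolding D2Y_def by (intro continuous_intros c2) auto
  next
    fix x assume x: "x \<noteq> c"
    define y where "y = x - c"
    define n where "n = norm y"
    have n: "n > 0" using x by (simp add: n_def y_def)
    have lin: "linear (D y)" using D has_derivative_linear by blast
    have "m * P y = D y (\<Sum>i\<in>Basis. (y \<bullet> i) *\<^sub>R i)" by (simp add: euler euclidean_representation)
    also have "\<dots> = (\<Sum>i\<in>Basis. D y i * (y \<bullet> i))"
      by (simp add: linear_sum[OF lin] linear_scale[OF lin] mult.commute)
    finally have yy: "(\<Sum>i\<in>Basis. D y i * (y \<bullet> i)) = m * P y" by simp
    have nn: "(\<Sum>i\<in>Basis. (y \<bullet> i) * (y \<bullet> i)) = n\<^sup>2"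
      by (simp add: n_def power2_norm_eq_inner euclidean_inner[of y y])
    have ii: "(\<Sum>i\<in>(Basis::'a set). i \<bullet> i) = real DIM('a)" by (simp add: inner_Basis)
    define k where "k = real m"
    have id: "(e / A - k * d * u / B) - k * ((d * u + p * v) / B - (k + 2) * (p * u) * u / C)
       = e / A - k / B * (d * u) - k / B * (d * u) - k / B * p * v + k * (k + 2) * p / C * (u * u)" for e A d u B p v C
      by (simp add: algebra_simps add_divide_distrib diff_divide_distrib)
    have "(\<Sum>i\<in>Basis. D2Y x i i) = (\<Sum>i\<in>Basis. E i y i / n ^ m - k / n ^ (m + 2) * (D y i * (y \<bullet> i))
        - k / n ^ (m + 2) * (D y i * (y \<bullet> i)) - k / n ^ (m + 2) * P y * (i \<bullet> i)
        + k * (k + 2) * P y / n ^ (m + 2 + 2) * ((y \<bullet> i) * (y \<bullet> i)))"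
      unfolding D2Y_def y_def[symmetric] n_def[symmetric] k_def[symmetric] id ..
    also have "\<dots> = LP y / n ^ m - k / n ^ (m + 2) * (k * P y) - k / n ^ (m + 2) * (k * P y)
       - k / n ^ (m + 2) * P y * real DIM('a) + k * (k + 2) * P y / n ^ (m + 2 + 2) * n\<^sup>2"
      by (simp only: sum.distrib sum_subtractf sum_distrib_left[symmetric] sum_divide_distrib[symmetric] yy[folded k_def] nn ii LP)
    also have "\<dots> = LP y / n ^ m - k * (k + real DIM('a) - 2) * (P y / n ^ m) / n\<^sup>2"
    proof -
      have "l / A - k / (A * B) * (k * p) - k / (A * B) * (k * p) - k / (A * B) * p * d + k * (k + 2) * p / (A * B * B) * B
        = l / A - k * (k + d - 2) * (p / A) / B" if "A > 0" "B > 0" for l A B p d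
        using that by (simp add: field_simps)
      from this[of "n ^ m" "n\<^sup>2"] show ?thesis using n by (simp only: power_add zero_less_power)
    qed
    finally have tr: "(\<Sum>i\<in>Basis. D2Y x i i) = LP y / n ^ m - k * (k + real DIM('a) - 2) * (P y / n ^ m) / n\<^sup>2" .
    \<comment> \<open>For \<open>m < 2\<close> the exponent \<open>m - 2\<close> is truncated to 0,
      and the identity holds because \<open>LP\<close> vanishes.\<close>
    have "LP y / n ^ m = LP y / n ^ (m - 2) / n\<^sup>2"
    proof (cases "m < 2")
      case True
      then show ?thesis by (simp add: LP0)
    next
      case False
      then have "m = (m - 2) + 2" by simp
      then have "n ^ m = n ^ (m - 2) * n\<^sup>2" by (metis power_add)
      then show ?thesis by simp
    qed
    with tr show "(\<Sum>i\<in>Basis. D2Y x i i) = (LP (x - c) / norm (x - c) ^ (m - 2) - m * (m + real DIM('a) - 2) * (P (x - c) / norm (x - c) ^ m)) / (norm (x - c))\<^sup>2"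
      unfolding y_def n_def k_def by (simp only: diff_divide_distrib)
  qed
  then show ?thesis by blast
qed

lemma hpoly_has_lb:
  fixes P :: "'a::euclidean_space \<Rightarrow> real"
  assumes P: "hpoly m P"
  shows "\<exists>LP DY D2Y. hpoly (m - 2) LP \<and> (m < 2 \<longrightarrow> (\<forall>x. LP x = 0)) \<and>
     has_lb c (\<lambda>x. P (x - c) / norm (x - c) ^ m) DY D2Y
       (\<lambda>x. LP (x - c) / norm (x - c) ^ (m - 2) - m * (m + real DIM('a) - 2) * (P (x - c) / norm (x - c) ^ m))"
proof -
  obtain D where D: "\<And>x. (P has_derivative D x) (at x)" "\<And>v. hpoly (m - 1) (\<lambda>x. D x v)"
    "\<And>x v. m = 0 \<Longrightarrow> D x v = 0" "\<And>x. D x x = m * P x" using hpoly_derivative[OF P] by blast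
  have "\<forall>v. \<exists>E. (\<forall>x. ((\<lambda>x. D x v) has_derivative E x) (at x)) \<and> (\<forall>w. hpoly (m - 2) (\<lambda>x. E x w)) \<and>
     (m - 1 = 0 \<longrightarrow> (\<forall>x w. E x w = 0))"
    using hpoly_derivative[OF D(2)] by (metis diff_diff_add one_add_one)
  then obtain E where E: "\<And>v x. ((\<lambda>x. D x v) has_derivative E v x) (at x)" "\<And>v w. hpoly (m - 2) (\<lambda>x. E v x w)"
     "\<And>v x w. m - 1 = 0 \<Longrightarrow> E v x w = 0" by metis
  define LP where "LP x = (\<Sum>i\<in>Basis. E i x i)" for x
  have LP: "hpoly (m - 2) LP" unfolding LP_def by (intro hpoly_sum E(2)) auto
  have LP0: "LP x = 0" if "m < 2" for x unfolding LP_def using that by (intro sum.neutral ballI E(3)) auto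
  have "\<exists>DY D2Y. has_lb c (\<lambda>x. P (x - c) / norm (x - c) ^ m) DY D2Y
       (\<lambda>x. LP (x - c) / norm (x - c) ^ (m - 2) - m * (m + real DIM('a) - 2) * (P (x - c) / norm (x - c) ^ m))"
    by (rule homogeneous_has_lb[OF D(1) E(1) hpoly_continuous[OF E(2)] hpoly_scaleR[OF P] D(4) LP_def LP0])
  then show ?thesis using LP LP0 by blast
qed

abbreviation lb_eigenvalue :: "'a::euclidean_space itself \<Rightarrow> nat \<Rightarrow> real" where
  "lb_eigenvalue T l \<equiv> real l * (real l + real DIM('a) - 2)"

text \<open>In dimension 1 the values at 0 and 1 would coincide.\<close>

lemma strict_mono_lb_eigenvalue:
  assumes "DIM('a::euclidean_space) \<ge> 2" "l < m"
  shows "lb_eigenvalue TYPE('a) l < lb_eigenvalue TYPE('a) m"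
proof (rule mult_strict_mono')
  show "real l + real DIM('a) - 2 < real m + real DIM('a) - 2" using assms by simp
qed (use assms in auto)

text \<open>The Laplace--Beltrami operator maps the restriction of \<open>P\<close> to that of
  \<open>\<Delta>P - m (m + n - 2) P\<close>; its eigenvalues being distinct, \<open>P\<close> is decomposed by induction on \<open>m\<close>
  without dividing by \<open>\<bar>x\<bar>\<^sup>2\<close>.\<close>

lemma hpoly_decomposition:
  fixes P :: "'a::euclidean_space \<Rightarrow> real"
  assumes "hpoly m P" "DIM('a) \<ge> 2"
  shows "\<exists>Y. (\<forall>l. harmonic0 c (lb_eigenvalue TYPE('a) l) (Y l)) \<and>
    (\<forall>x. x \<noteq> c \<longrightarrow> P (x - c) / norm (x - c) ^ m = (\<Sum>l\<le>m. Y l x))"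
  using assms(1)
proof (induction m arbitrary: P rule: less_induct)
  case (less m)
  let ?ev = "lb_eigenvalue TYPE('a)"
  let ?F = "\<lambda>x. P (x - c) / norm (x - c) ^ m"
  obtain LP DY D2Y where LP: "hpoly (m - 2) LP" "\<And>x. m < 2 \<Longrightarrow> LP x = 0"
    and lb: "has_lb c ?F DY D2Y (\<lambda>x. LP (x - c) / norm (x - c) ^ (m - 2) - ?ev m * ?F x)"
    using hpoly_has_lb[OF less.prems, of c] by auto
  have "\<exists>Z. (\<forall>l. harmonic0 c (?ev l) (Z l)) \<and>
    (\<forall>x. x \<noteq> c \<longrightarrow> LP (x - c) / norm (x - c) ^ (m - 2) = (\<Sum>l<m. Z l x))"
  proof (cases "m < 2")
    case True
    have "harmonic0 c \<Lambda> (\<lambda>x. 0)" for \<Lambda>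
      unfolding harmonic0_def using has_lb_zero[of c] by auto
    then show ?thesis using True LP(2) by (intro exI[of _ "\<lambda>l x. 0"]) auto
  next
    case False
    then obtain Z where Z: "\<And>l. harmonic0 c (?ev l) (Z l)"
      "\<And>x. x \<noteq> c \<Longrightarrow> LP (x - c) / norm (x - c) ^ (m - 2) = (\<Sum>l\<le>m - 2. Z l x)"
      using less.IH[OF _ LP(1)] by force
    \<comment> \<open>The components up to degree \<open>m - 2\<close> are padded by zero to all
      \<open>l < m\<close>, the form that also covers \<open>m < 2\<close>.\<close>
    have "(\<Sum>l\<le>m - 2. Z l x) = (\<Sum>l<m. if l \<le> m - 2 then Z l x else 0)" for x
      by (rule sum.mono_neutral_cong_left) (use False in auto)
    moreover have "harmonic0 c (?ev l) (\<lambda>x. if l \<le> m - 2 then Z l x else 0)" for l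
      using Z(1)[of l] harmonic0_cmul[OF Z(1), of l 0] by (cases "l \<le> m - 2") auto
    ultimately show ?thesis using Z(2)
      by (intro exI[of _ "\<lambda>l x. if l \<le> m - 2 then Z l x else 0"]) auto
  qed
  then obtain Z where Z: "\<And>l. harmonic0 c (?ev l) (Z l)"
    "\<And>x. x \<noteq> c \<Longrightarrow> LP (x - c) / norm (x - c) ^ (m - 2) = (\<Sum>l<m. Z l x)" by blast
  have ev: "?ev m - ?ev l \<noteq> 0" if "l < m" for l
    using strict_mono_lb_eigenvalue[OF assms(2) that] by simp
  \<comment> \<open>Comparing eigencomponents in the Laplace--Beltrami image forces (ev m - ev l) Y
    l = Z l for \<open>l < m\<close>; what then remains of the restriction is
    \<open>Y m\<close>.\<close>
  define Y where "Y l x = (if l < m then (1 / (?ev m - ?ev l)) * Z l x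
     else if l = m then ?F x + (\<Sum>j<m. (- 1 / (?ev m - ?ev j)) * Z j x) else 0)" for l x
  have Yl: "harmonic0 c (?ev l) (Y l)" if "l < m" for l
    using harmonic0_cmul[OF Z(1)[of l], of "1 / (?ev m - ?ev l)"] that by (simp add: Y_def[abs_def])
  have Yb: "harmonic0 c (?ev l) (Y l)" if "l > m" for l
    using harmonic0_cmul[OF Z(1)[of l], of 0] that by (simp add: Y_def[abs_def])
  have Ym: "harmonic0 c (?ev m) (Y m)"
  proof -
    have "\<exists>DY D2Y. has_lb c (\<lambda>x. (- 1 / (?ev m - ?ev j)) * Z j x) DY D2Y (\<lambda>x. - ?ev j * ((- 1 / (?ev m - ?ev j)) * Z j x))" for j
      using harmonic0_cmul[OF Z(1)[of j], of "- 1 / (?ev m - ?ev j)"] unfolding harmonic0_def .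
    then obtain D' D2' where lb': "has_lb c (\<lambda>x. \<Sum>j<m. (- 1 / (?ev m - ?ev j)) * Z j x) D' D2'
       (\<lambda>x. \<Sum>j<m. - ?ev j * ((- 1 / (?ev m - ?ev j)) * Z j x))"
      using has_lb_sum[of "{..<m}" c "\<lambda>j x. (- 1 / (?ev m - ?ev j)) * Z j x" "\<lambda>j x. - ?ev j * ((- 1 / (?ev m - ?ev j)) * Z j x)"]
      by blast
    have "has_lb c (Y m) (\<lambda>x v. DY x v + D' x v) (\<lambda>x i v. D2Y x i v + D2' x i v) (\<lambda>x. - ?ev m * Y m x)"
    proof (rule has_lb_cong)
      show "has_lb c (Y m) (\<lambda>x v. DY x v + D' x v) (\<lambda>x i v. D2Y x i v + D2' x i v)
         (\<lambda>x. (LP (x - c) / norm (x - c) ^ (m - 2) - ?ev m * ?F x) + (\<Sum>j<m. - ?ev j * ((- 1 / (?ev m - ?ev j)) * Z j x)))"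
        using has_lb_add[OF lb lb'] by (simp add: Y_def[abs_def])
      fix x assume "x \<noteq> c"
      have "Z j x + - ?ev j * ((- 1 / (?ev m - ?ev j)) * Z j x) = - ?ev m * ((- 1 / (?ev m - ?ev j)) * Z j x)" if "j < m" for j
      proof -
        have "z + - p * ((- 1 / (q - p)) * z) = - q * ((- 1 / (q - p)) * z)" if "q - p \<noteq> 0" for z p q :: real
          using that by (simp add: field_simps)
        then show ?thesis using ev[OF that] by blast
      qed
      then have "(\<Sum>j<m. Z j x) + (\<Sum>j<m. - ?ev j * ((- 1 / (?ev m - ?ev j)) * Z j x)) = (\<Sum>j<m. - ?ev m * ((- 1 / (?ev m - ?ev j)) * Z j x))"
        unfolding sum.distrib[symmetric] by (intro sum.cong) auto
      then show "(LP (x - c) / norm (x - c) ^ (m - 2) - ?ev m * ?F x) + (\<Sum>j<m. - ?ev j * ((- 1 / (?ev m - ?ev j)) * Z j x)) = - ?ev m * Y m x"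
        using Z(2)[OF \<open>x \<noteq> c\<close>] unfolding Y_def by (simp add: sum_distrib_left distrib_left)
    qed
    then show ?thesis unfolding harmonic0_def by blast
  qed
  have "?F x = (\<Sum>l\<le>m. Y l x)" for x
  proof -
    have "(\<Sum>l\<le>m. Y l x) = (\<Sum>l<m. Y l x) + Y m x" by (simp add: lessThan_Suc_atMost[symmetric])
    also have "(\<Sum>l<m. Y l x) = - (\<Sum>j<m. (- 1 / (?ev m - ?ev j)) * Z j x)"
      unfolding sum_negf[symmetric] by (intro sum.cong) (auto simp: Y_def)
    finally show ?thesis by (simp add: Y_def)
  qed
  then show ?case using Yl Yb Ym by (intro exI[of _ Y]) (metis linorder_neqE_nat)
qed

text \<open>The equation is given on one sphere only. As the extension is constant on rays, its
  second derivatives scale by t^(-2) along them, which carries the equation to every point off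
  \<open>c\<close>.\<close>

lemma LB_efun_imp_harmonic0:
  fixes f :: "'a::euclidean_space \<Rightarrow> real"
  assumes f: "LB_efun c r lam f" and r: "r > 0"
  shows "harmonic0 c (lam * r\<^sup>2) (\<lambda>x. f (c + (r / norm (x - c)) *\<^sub>R (x - c)))"
proof -
  obtain F DF D2F where F: "\<And>x. x \<noteq> c \<Longrightarrow> F x = f (c + (r / norm (x - c)) *\<^sub>R (x - c))"
    "\<And>x. x \<noteq> c \<Longrightarrow> (F has_derivative DF x) (at x)"
    "\<And>x i. x \<noteq> c \<Longrightarrow> ((\<lambda>y. DF y i) has_derivative D2F x i) (at x)"
    "\<And>i j. continuous_on (- {c}) (\<lambda>x. D2F x i j)"
    "\<And>x. x \<in> sphere c r \<Longrightarrow> - (\<Sum>i\<in>Basis. D2F x i i) = lam * f x"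
    using f unfolding LB_efun_def by blast
  define Y where "Y x = f (c + (r / norm (x - c)) *\<^sub>R (x - c))" for x
  have FY: "F x = Y x" if "x \<noteq> c" for x using F(1)[OF that] by (simp add: Y_def)
  have Yd: "(Y has_derivative DF x) (at x)" if "x \<noteq> c" for x
    by (rule has_derivative_transform_within_open[OF F(2)[OF that], of "- {c}"]) (use that FY in auto)
  have Yhom: "Y (c + t *\<^sub>R (x - c)) = Y x" if "t > 0" for x t
    using that by (cases "x = c") (simp_all add: Y_def)
  have sc: "((\<lambda>y. c + t *\<^sub>R (y - c)) has_derivative (\<lambda>v. t *\<^sub>R v)) (at x)" for t :: real and x :: 'a
    by (auto intro!: derivative_eq_intros)
  have D1: "DF (c + t *\<^sub>R (x - c)) (t *\<^sub>R v) = DF x v" if t: "t > 0" and x: "x \<noteq> c" for t x v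
  proof -
    have "((\<lambda>y. Y (c + t *\<^sub>R (y - c))) has_derivative (\<lambda>v. DF (c + t *\<^sub>R (x - c)) (t *\<^sub>R v))) (at x)"
      by (rule has_derivative_compose[OF sc Yd]) (use t x in auto)
    then have "(Y has_derivative (\<lambda>v. DF (c + t *\<^sub>R (x - c)) (t *\<^sub>R v))) (at x)"
      using Yhom[OF t] by simp
    then show ?thesis using has_derivative_unique[OF _ Yd[OF x]] by metis
  qed
  have lin1: "DF x (t *\<^sub>R v) = t * DF x v" if "x \<noteq> c" for x t v
    using linear_scale[OF has_derivative_linear[OF F(2)[OF that]]] by simp
  have lin2: "D2F x i (t *\<^sub>R v) = t * D2F x i v" if "x \<noteq> c" for x i t v
    using linear_scale[OF has_derivative_linear[OF F(3)[OF that]]] by simp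
  have D2: "t\<^sup>2 * D2F (c + t *\<^sub>R (x - c)) i v = D2F x i v" if t: "t > 0" and x: "x \<noteq> c" for t x i v
  proof -
    have "((\<lambda>y. t * DF (c + t *\<^sub>R (y - c)) i) has_derivative (\<lambda>v. t * D2F (c + t *\<^sub>R (x - c)) i (t *\<^sub>R v))) (at x)"
      by (rule has_derivative_mult_right has_derivative_compose[OF sc F(3)])+ (use t x in auto)
    then have "((\<lambda>y. DF y i) has_derivative (\<lambda>v. t * D2F (c + t *\<^sub>R (x - c)) i (t *\<^sub>R v))) (at x)"
      by (rule has_derivative_transform_within_open[of _ _ _ _ "- {c}"]) (use x t D1 lin1 in auto)
    then have "t * D2F (c + t *\<^sub>R (x - c)) i (t *\<^sub>R v) = D2F x i v"
      using has_derivative_unique[OF _ F(3)[OF x, of i]] by metis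
    moreover have "c + t *\<^sub>R (x - c) \<noteq> c" using x t by simp
    ultimately show ?thesis using lin2 by (simp add: power2_eq_square)
  qed
  have "has_lb c Y DF D2F (\<lambda>x. - (lam * r\<^sup>2) * Y x)"
    unfolding has_lb_def
  proof (intro conjI allI impI)
    fix x assume x: "x \<noteq> c"
    define t where "t = r / norm (x - c)"
    have t: "t > 0" using x r by (simp add: t_def)
    have S: "c + t *\<^sub>R (x - c) \<in> sphere c r" using x r by (simp add: t_def dist_norm)
    have "(\<Sum>i\<in>Basis. D2F x i i) = t\<^sup>2 * (\<Sum>i\<in>Basis. D2F (c + t *\<^sub>R (x - c)) i i)"
      unfolding sum_distrib_left using D2[OF t x] by simp
    also have "(\<Sum>i\<in>Basis. D2F (c + t *\<^sub>R (x - c)) i i) = - (lam * Y x)"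
      using F(5)[OF S] unfolding Y_def t_def by linarith
    finally show "(\<Sum>i\<in>Basis. D2F x i i) = - (lam * r\<^sup>2) * Y x / (norm (x - c))\<^sup>2"
      by (simp add: t_def power_divide)
  qed (use Yhom Yd F in auto)
  then show ?thesis unfolding harmonic0_def Y_def[abs_def] by blast
qed

lemma harmonic0_imp_LB_efun:
  fixes Y :: "'a::euclidean_space \<Rightarrow> real"
  assumes "harmonic0 c \<Lambda> Y" "r > 0" "x \<in> sphere c r" "Y x \<noteq> 0"
  shows "LB_efun c r (\<Lambda> / r\<^sup>2) Y"
proof -
  obtain DY D2Y where lb: "has_lb c Y DY D2Y (\<lambda>x. - \<Lambda> * Y x)" using assms(1) by (auto simp: harmonic0_def)
  show ?thesis unfolding LB_efun_def
  proof (intro conjI exI[of _ Y] exI[of _ DY] exI[of _ D2Y])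
    show "\<forall>x. x \<noteq> c \<longrightarrow> Y x = Y (c + (r / norm (x - c)) *\<^sub>R (x - c))"
      using lb assms(2) by (simp add: has_lb_def)
    show "\<forall>x\<in>sphere c r. - (\<Sum>i\<in>Basis. D2Y x i i) = \<Lambda> / r\<^sup>2 * Y x"
    proof
      fix x assume x: "x \<in> sphere c r"
      then have "x \<noteq> c" "norm (x - c) = r" using assms(2) by (auto simp: dist_norm norm_minus_commute)
      then show "- (\<Sum>i\<in>Basis. D2Y x i i) = \<Lambda> / r\<^sup>2 * Y x" using lb by (simp add: has_lb_def)
    qed
    show "\<exists>x\<in>sphere c r. Y x \<noteq> 0" using assms by blast
  qed (use lb in \<open>auto simp: has_lb_def\<close>)
qed

section \<open>Integration by parts in the shell\<close>

text \<open>Smoothness is required only on a neighbourhood \<open>V\<close> of the support; the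
  derivative is glued from \<open>D\<close> on \<open>V\<close> and 0 off \<open>K\<close>, which
  agree on the overlap by uniqueness of derivatives.\<close>

lemma test_funI:
  fixes \<phi> :: "'a::euclidean_space \<Rightarrow> real"
  assumes V: "open V" and K: "compact K" "K \<subseteq> V" "K \<subseteq> U" and zero: "\<And>x. x \<notin> K \<Longrightarrow> \<phi> x = 0"
    and D: "\<And>x. x \<in> V \<Longrightarrow> (\<phi> has_derivative D x) (at x)" and cD: "\<And>v. continuous_on V (\<lambda>x. D x v)"
  shows "test_fun U \<phi>"
proof -
  define D' where "D' x = (if x \<in> V then D x else (\<lambda>v. 0))" for x
  have oK: "open (- K)" using K by (simp add: compact_imp_closed open_Compl)
  have d0: "(\<phi> has_derivative (\<lambda>v. 0)) (at x)" if "x \<notin> K" for x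
    by (rule has_derivative_transform_within_open[OF has_derivative_const[of 0], of "- K"])
      (use that oK zero in auto)
  have D'0: "D' x v = 0" if "x \<notin> K" for x v
    using has_derivative_unique[OF d0[OF that] D] by (auto simp: D'_def fun_eq_iff)
  have "(\<phi> has_derivative D' x) (at x)" for x
    using D[of x] d0[of x] K by (cases "x \<in> V") (auto simp: D'_def)
  moreover have "continuous_on UNIV (\<lambda>x. D' x v)" for v
  proof -
    have "continuous_on V (\<lambda>x. D' x v)"
      using cD[of v] by (rule continuous_on_eq) (simp add: D'_def)
    moreover have "continuous_on (- K) (\<lambda>x. D' x v)"
      using continuous_on_const[of "- K" "0::real"] by (rule continuous_on_eq) (simp add: D'0)
    ultimately have "continuous_on (V \<union> - K) (\<lambda>x. D' x v)"
      using V oK by (intro continuous_on_open_Un) auto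
    moreover have "V \<union> - K = UNIV" using K by auto
    ultimately show ?thesis by simp
  qed
  moreover have cl: "closure {x. \<phi> x \<noteq> 0} \<subseteq> K"
    using zero K by (intro closure_minimal) (auto simp: compact_imp_closed)
  moreover have "compact (closure {x. \<phi> x \<noteq> 0})"
    using compact_Int_closed[OF K(1), of "closure {x. \<phi> x \<noteq> 0}"] cl by (simp add: inf.absorb2)
  ultimately show ?thesis unfolding test_fun_def using K by blast
qed

lemma test_fun_derivative:
  assumes "test_fun U \<phi>"
  shows "(\<phi> has_derivative frechet_derivative \<phi> (at x)) (at x)"
    and "continuous_on UNIV (\<lambda>x. frechet_derivative \<phi> (at x) v)"
proof -
  obtain D where D: "\<And>x. (\<phi> has_derivative D x) (at x)" "\<And>v. continuous_on UNIV (\<lambda>x. D x v)"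
    using assms unfolding test_fun_def by blast
  have "D = (\<lambda>x. frechet_derivative \<phi> (at x))" by (rule ext) (rule frechet_derivative_at[OF D(1)])
  with D show "(\<phi> has_derivative frechet_derivative \<phi> (at x)) (at x)"
    "continuous_on UNIV (\<lambda>x. frechet_derivative \<phi> (at x) v)" by simp_all
qed

text \<open>The nearest point is the radial projection; at the centre any point of the sphere will
  do.\<close>

lemma setdist_sphere:
  fixes c x :: "'a::euclidean_space"
  assumes "r > 0"
  shows "setdist {x} (sphere c r) = \<bar>norm (x - c) - r\<bar>"
proof -
  obtain y where y: "y \<in> sphere c r" "dist x y = \<bar>norm (x - c) - r\<bar>"
  proof (cases "x = c")
    case True
    obtain i :: 'a where "i \<in> Basis" using nonempty_Basis by blast
    then show ?thesis using that[of "c + r *\<^sub>R i"] True assms by (simp add: dist_norm)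
  next
    case False
    have "x - (c + (r / norm (x - c)) *\<^sub>R (x - c)) = (1 - r / norm (x - c)) *\<^sub>R (x - c)"
      by (simp add: algebra_simps)
    moreover have "norm ((1 - r / norm (x - c)) *\<^sub>R (x - c)) = \<bar>(1 - r / norm (x - c)) * norm (x - c)\<bar>"
      by (simp add: abs_mult)
    moreover have "(1 - r / norm (x - c)) * norm (x - c) = norm (x - c) - r"
      using False by (simp add: field_simps)
    ultimately show ?thesis using that[of "c + (r / norm (x - c)) *\<^sub>R (x - c)"] False assms
      by (simp add: dist_norm)
  qed
  have ge: "\<bar>norm (x - c) - r\<bar> \<le> dist x z" if "z \<in> sphere c r" for z
    using that norm_triangle_ineq3[of "x - c" "z - c"] by (simp add: dist_norm norm_minus_commute)
  show ?thesis
  proof (rule antisym)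
    show "setdist {x} (sphere c r) \<le> \<bar>norm (x - c) - r\<bar>"
      using setdist_le_dist[of x "{x}" y "sphere c r"] y by simp
    show "\<bar>norm (x - c) - r\<bar> \<le> setdist {x} (sphere c r)"
      using y ge by (intro le_setdistI) auto
  qed
qed

section \<open>The shell: geometry, measurability, passage to the limit\<close>

locale shell =
  fixes c :: "'a::euclidean_space" and r e sm sp :: real
  assumes sh: "0 < e" "e < r" "0 < sm" "0 < sp"

sublocale shell \<subseteq> radial_interval r e sm sp "DIM('a)"
  by unfold_locales (use sh in auto)

context shell
begin

abbreviation "\<Omega> \<equiv> Omega_eps c r e"
abbreviation "\<rho> x \<equiv> norm (x - c)"

lemma mem_shell_iff:
  "x \<in> ball c r \<longleftrightarrow> \<rho> x < r" "x \<in> - cball c r \<longleftrightarrow> \<rho> x > r" "x \<in> sphere c r \<longleftrightarrow> \<rho> x = r"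
  by (auto simp: dist_norm norm_minus_commute)

lemma Omega_plus_iff: "x \<in> Omega_plus c r e \<longleftrightarrow> \<rho> x > r \<and> \<rho> x < b"
  unfolding Omega_plus_def mem_Collect_eq setdist_sphere[OF r0] mem_shell_iff by auto

lemma Omega_iff: "x \<in> \<Omega> \<longleftrightarrow> \<rho> x \<in> {a<..<b}"
  unfolding Omega_eps_def Un_iff Omega_plus_iff Omega_minus_def mem_Collect_eq setdist_sphere[OF r0] mem_shell_iff
  using e0 by auto

lemma sigma_coef_eq: "x \<in> \<Omega> \<Longrightarrow> sigma_coef c r sm sp e x = \<sigma> (\<rho> x)"
  by (auto simp: sigma_coef_def phase_coef_def Omega_plus_iff Omega_iff)

lemma center_notin: "c \<notin> \<Omega>" using a0 by (simp add: Omega_iff)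

lemma rho_pos: "x \<in> \<Omega> \<Longrightarrow> \<rho> x > 0" using center_notin by auto

lemma open_shell: "open S \<Longrightarrow> open {x. \<rho> x \<in> S}"
  by (rule open_vimage[of S \<rho>, unfolded vimage_def]) (auto intro!: continuous_intros)

lemma compact_shell: "compact S \<Longrightarrow> compact {x. \<rho> x \<in> S}"
proof -
  assume S: "compact S"
  have "closed {x. \<rho> x \<in> S}"
    by (rule closed_vimage[of S \<rho>, unfolded vimage_def]) (use S in \<open>auto intro!: continuous_intros compact_imp_closed\<close>)
  moreover obtain B where "\<And>s. s \<in> S \<Longrightarrow> \<bar>s\<bar> \<le> B" using compact_imp_bounded[OF S] by (auto simp: bounded_iff)
  then have "{x. \<rho> x \<in> S} \<subseteq> cball c B" by (force simp: dist_norm norm_minus_commute)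
  then have "bounded {x. \<rho> x \<in> S}" using bounded_cball bounded_subset by blast
  ultimately show ?thesis by (simp add: compact_eq_bounded_closed)
qed

lemma open_Omega: "open \<Omega>"
proof -
  have "\<Omega> = {x. \<rho> x \<in> {a<..<b}}" using Omega_iff by blast
  then show ?thesis using open_shell[of "{a<..<b}"] by simp
qed

lemma Omega_subset_compact: "\<Omega> \<subseteq> {x. \<rho> x \<in> {a..b}}" by (auto simp: Omega_iff)

lemma Omega_lmeasurable: "\<Omega> \<in> lmeasurable"
proof -
  have "bounded \<Omega>"
    using compact_imp_bounded[OF compact_shell[of "{a..b}"]] Omega_subset_compact bounded_subset by blast
  then show ?thesis using open_Omega by (simp add: lmeasurable_open)
qed

text \<open>The closed shell is compact and avoids the centre.\<close>

lemma bounded_on_Omega: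
  assumes "continuous_on (- {c}) (u :: 'a \<Rightarrow> real)"
  obtains B where "\<And>x. x \<in> \<Omega> \<Longrightarrow> \<bar>u x\<bar> \<le> B"
proof -
  have "{x. \<rho> x \<in> {a..b}} \<subseteq> - {c}" using a0 by auto
  then have "compact (u ` {x. \<rho> x \<in> {a..b}})"
    by (intro compact_continuous_image compact_shell continuous_on_subset[OF assms]) auto
  then have "bounded (u ` {x. \<rho> x \<in> {a..b}})" by (rule compact_imp_bounded)
  then obtain B where "\<forall>y \<in> u ` {x. \<rho> x \<in> {a..b}}. norm y \<le> B" unfolding bounded_iff by blast
  then show ?thesis using that[of B] Omega_subset_compact by (force simp del: atLeastAtMost_iff)
qed

lemma measurable_continuous_off_center:
  assumes "continuous_on (- {c}) (u :: 'a \<Rightarrow> real)"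
  shows "set_borel_measurable lebesgue \<Omega> u"
proof -
  have "continuous_on \<Omega> u" using center_notin by (intro continuous_on_subset[OF assms]) auto
  then have "(\<lambda>x. indicat_real \<Omega> x *\<^sub>R u x) \<in> borel_measurable borel"
    using open_Omega by (intro borel_measurable_continuous_on_indicator) auto
  then show ?thesis unfolding set_borel_measurable_def
    by (simp add: measurable_completion)
qed

text \<open>\<open>Q\<close> may jump at \<open>r\<close>: the open rest of the shell is handled by
  continuity, and on the interface the function is the constant \<open>Q r\<close>.\<close>

lemma measurable_radial:
  fixes Q :: "real \<Rightarrow> real"
  assumes "continuous_on ({a<..<b} - {r}) Q"
  shows "set_borel_measurable lebesgue \<Omega> (\<lambda>x. Q (\<rho> x))"
proof -
  let ?U = "{x. \<rho> x \<in> {a<..<b} - {r}}"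
  have "continuous_on ?U (\<lambda>x. Q (\<rho> x))"
    by (rule continuous_on_compose2[OF assms]) (auto intro!: continuous_intros)
  moreover have "open ?U" by (intro open_shell open_Diff) auto
  ultimately have "(\<lambda>x. indicat_real ?U x *\<^sub>R Q (\<rho> x)) \<in> borel_measurable borel"
    by (intro borel_measurable_continuous_on_indicator) auto
  moreover have "(\<lambda>x. indicat_real {x. \<rho> x \<in> {r}} x * Q r) \<in> borel_measurable borel"
    using compact_shell[of "{r}"] by (intro borel_measurable_times borel_measurable_const borel_measurable_indicator borel_closed compact_imp_closed) auto
  ultimately have "(\<lambda>x. indicat_real ?U x *\<^sub>R Q (\<rho> x) + indicat_real {x. \<rho> x \<in> {r}} x * Q r) \<in> borel_measurable borel"
    by (rule borel_measurable_add)
  also have "(\<lambda>x. indicat_real ?U x *\<^sub>R Q (\<rho> x) + indicat_real {x. \<rho> x \<in> {r}} x * Q r) = (\<lambda>x. indicat_real \<Omega> x *\<^sub>R Q (\<rho> x))"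
    using e0 by (auto simp: fun_eq_iff indicator_def Omega_iff)
  finally show ?thesis unfolding set_borel_measurable_def
    by (simp add: measurable_completion)
qed

lemma set_integrable_mult_bounded:
  fixes g u :: "'a \<Rightarrow> real"
  assumes "set_integrable lebesgue \<Omega> g" "set_borel_measurable lebesgue \<Omega> u" "\<And>x. x \<in> \<Omega> \<Longrightarrow> \<bar>u x\<bar> \<le> B"
  shows "set_integrable lebesgue \<Omega> (\<lambda>x. u x * g x)"
  unfolding set_integrable_def
proof (rule Bochner_Integration.integrable_bound)
  show "integrable lebesgue (\<lambda>x. B * (indicat_real \<Omega> x *\<^sub>R g x))"
    using assms(1) by (auto simp: set_integrable_def)
  have "(\<lambda>x. (indicat_real \<Omega> x *\<^sub>R u x) * (indicat_real \<Omega> x *\<^sub>R g x)) \<in> borel_measurable lebesgue"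
    using assms by (intro borel_measurable_times) (auto simp: set_borel_measurable_def set_integrable_def)
  also have "(\<lambda>x. (indicat_real \<Omega> x *\<^sub>R u x) * (indicat_real \<Omega> x *\<^sub>R g x)) = (\<lambda>x. indicat_real \<Omega> x *\<^sub>R (u x * g x))"
    by (auto simp: indicator_def)
  finally show "(\<lambda>x. indicat_real \<Omega> x *\<^sub>R (u x * g x)) \<in> borel_measurable lebesgue" .
  show "AE x in lebesgue. norm (indicat_real \<Omega> x *\<^sub>R (u x * g x)) \<le> norm (B * (indicat_real \<Omega> x *\<^sub>R g x))"
  proof (intro AE_I2)
    fix x
    have "\<bar>u x\<bar> * \<bar>g x\<bar> \<le> \<bar>B\<bar> * \<bar>g x\<bar>" if "x \<in> \<Omega>" using assms(3)[OF that] by (intro mult_right_mono) auto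
    then show "norm (indicat_real \<Omega> x *\<^sub>R (u x * g x)) \<le> norm (B * (indicat_real \<Omega> x *\<^sub>R g x))"
      by (auto simp: indicator_def abs_mult)
  qed
qed

lemma set_integrable_const: "set_integrable lebesgue \<Omega> (\<lambda>x. k :: real)"
  using integrable_mult_left[of k lebesgue "indicat_real \<Omega>"] Omega_lmeasurable[unfolded lmeasurable_iff_integrable]
  unfolding set_integrable_def real_scaleR_def by blast

lemma L2_set_integrable:
  assumes "L2_on \<Omega> f" shows "set_integrable lebesgue \<Omega> f"
proof (rule set_integrable_bound)
  show "set_integrable lebesgue \<Omega> (\<lambda>x. 1 + (f x)\<^sup>2)"
    using assms by (intro set_integral_add set_integrable_const) (auto simp: L2_on_def)
  show "set_borel_measurable lebesgue \<Omega> f" using assms by (simp add: L2_on_def)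
  have "\<bar>t\<bar> \<le> 1 + t\<^sup>2" for t :: real
  proof -
    have "0 \<le> (\<bar>t\<bar> - 1/2)\<^sup>2" by simp
    then show ?thesis by (simp add: power2_eq_square algebra_simps)
  qed
  then show "AE x in lebesgue. x \<in> \<Omega> \<longrightarrow> norm (f x) \<le> norm (1 + (f x)\<^sup>2)"
    by (intro AE_I2) (auto simp: abs_of_nonneg add_nonneg_nonneg)
qed

text \<open>The tool for removing cut-offs: convergence may fail on the interface, which is a null
  set.\<close>

lemma radial_limit:
  fixes g :: "'a \<Rightarrow> real"
  assumes Qk: "\<And>k. continuous_on ({a<..<b} - {r}) (Q k)" "\<And>k t. t \<in> {a<..<b} \<Longrightarrow> \<bar>Q k t\<bar> \<le> B"
    and Q: "continuous_on ({a<..<b} - {r}) Q'" "\<And>t. t \<in> {a<..<b} - {r} \<Longrightarrow> (\<lambda>k. Q k t) \<longlonglongrightarrow> Q' t"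
    and g: "set_integrable lebesgue \<Omega> g"
  shows "(\<lambda>k. LINT x:\<Omega>|lebesgue. Q k (\<rho> x) * g x) \<longlonglongrightarrow> (LINT x:\<Omega>|lebesgue. Q' (\<rho> x) * g x)"
  unfolding set_lebesgue_integral_def
proof (rule integral_dominated_convergence[where w = "\<lambda>x. B * \<bar>indicat_real \<Omega> x *\<^sub>R g x\<bar>"])
  have m: "(\<lambda>x. indicat_real \<Omega> x *\<^sub>R (Q (\<rho> x) * g x)) \<in> borel_measurable lebesgue" if "continuous_on ({a<..<b} - {r}) Q" for Q
  proof -
    have "(\<lambda>x. (indicat_real \<Omega> x *\<^sub>R Q (\<rho> x)) * (indicat_real \<Omega> x *\<^sub>R g x)) \<in> borel_measurable lebesgue"
      using measurable_radial[OF that] g by (intro borel_measurable_times) (auto simp: set_borel_measurable_def set_integrable_def)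
    also have "(\<lambda>x. (indicat_real \<Omega> x *\<^sub>R Q (\<rho> x)) * (indicat_real \<Omega> x *\<^sub>R g x)) = (\<lambda>x. indicat_real \<Omega> x *\<^sub>R (Q (\<rho> x) * g x))"
      by (auto simp: indicator_def)
    finally show ?thesis .
  qed
  show "(\<lambda>x. indicat_real \<Omega> x *\<^sub>R (Q' (\<rho> x) * g x)) \<in> borel_measurable lebesgue" by (rule m[OF Q(1)])
  show "(\<lambda>x. indicat_real \<Omega> x *\<^sub>R (Q k (\<rho> x) * g x)) \<in> borel_measurable lebesgue" for k by (rule m[OF Qk(1)])
  show "integrable lebesgue (\<lambda>x. B * \<bar>indicat_real \<Omega> x *\<^sub>R g x\<bar>)"
    using g by (auto simp: set_integrable_def)
  show "AE x in lebesgue. (\<lambda>k. indicat_real \<Omega> x *\<^sub>R (Q k (\<rho> x) * g x)) \<longlonglongrightarrow> indicat_real \<Omega> x *\<^sub>R (Q' (\<rho> x) * g x)"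
  proof (rule AE_I')
    show "sphere c r \<in> null_sets lebesgue" using negligible_sphere negligible_iff_null_sets by blast
    show "{x \<in> space lebesgue. \<not> (\<lambda>k. indicat_real \<Omega> x *\<^sub>R (Q k (\<rho> x) * g x)) \<longlonglongrightarrow> indicat_real \<Omega> x *\<^sub>R (Q' (\<rho> x) * g x)} \<subseteq> sphere c r"
    proof
      fix x assume x: "x \<in> {x \<in> space lebesgue. \<not> (\<lambda>k. indicat_real \<Omega> x *\<^sub>R (Q k (\<rho> x) * g x)) \<longlonglongrightarrow> indicat_real \<Omega> x *\<^sub>R (Q' (\<rho> x) * g x)}"
      show "x \<in> sphere c r"
      proof (rule ccontr)
        assume "x \<notin> sphere c r"
        then have "\<rho> x \<noteq> r" by (simp add: dist_norm norm_minus_commute)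
        then have "(\<lambda>k. indicat_real \<Omega> x *\<^sub>R (Q k (\<rho> x) * g x)) \<longlonglongrightarrow> indicat_real \<Omega> x *\<^sub>R (Q' (\<rho> x) * g x)"
          by (cases "x \<in> \<Omega>") (auto intro!: tendsto_intros Q(2) simp: Omega_iff)
        then show False using x by simp
      qed
    qed
  qed
  fix k
  show "AE x in lebesgue. norm (indicat_real \<Omega> x *\<^sub>R (Q k (\<rho> x) * g x)) \<le> B * \<bar>indicat_real \<Omega> x *\<^sub>R g x\<bar>"
  proof (intro AE_I2)
    fix x
    show "norm (indicat_real \<Omega> x *\<^sub>R (Q k (\<rho> x) * g x)) \<le> B * \<bar>indicat_real \<Omega> x *\<^sub>R g x\<bar>"
      using Qk(2)[of "\<rho> x" k] by (cases "x \<in> \<Omega>") (auto simp: abs_mult Omega_iff intro!: mult_right_mono)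
  qed
qed

end

lemma has_lb_continuous:
  assumes "has_lb c Y DY D2Y K"
  shows "continuous_on (- {c}) Y" "continuous_on (- {c}) (\<lambda>x. DY x v)"
proof -
  have "isCont Y x" "isCont (\<lambda>y. DY y v) x" if "x \<noteq> c" for x
    using assms that unfolding has_lb_def by (blast intro: has_derivative_continuous)+
  then show "continuous_on (- {c}) Y" "continuous_on (- {c}) (\<lambda>x. DY x v)"
    by (auto intro!: continuous_at_imp_continuous_on)
qed

text \<open>\<open>Y\<close> is constant along rays. Its gradient being tangential, radial and
  angular parts decouple in the divergences computed below.\<close>

lemma has_lb_radial:
  assumes "has_lb c Y DY D2Y K" "x \<noteq> c"
  shows "DY x (x - c) = 0"
proof -
  have "(Y has_derivative DY x) (at (c + 1 *\<^sub>R (x - c)))" using assms by (auto simp: has_lb_def)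
  moreover have "((\<lambda>t. c + t *\<^sub>R (x - c)) has_derivative (\<lambda>h. h *\<^sub>R (x - c))) (at 1)"
    by (auto intro!: derivative_eq_intros)
  ultimately have "((\<lambda>t. Y (c + t *\<^sub>R (x - c))) has_derivative (\<lambda>h. DY x (h *\<^sub>R (x - c)))) (at (1::real))"
    by (rule has_derivative_compose[rotated])
  moreover have "((\<lambda>t. Y (c + t *\<^sub>R (x - c))) has_derivative (\<lambda>h. 0)) (at (1::real))"
    by (rule has_derivative_transform_within_open[OF has_derivative_const[of "Y x"], of "{0<..}"])
      (use assms in \<open>auto simp: has_lb_def\<close>)
  ultimately have "(\<lambda>h. DY x (h *\<^sub>R (x - c))) = (\<lambda>h. 0 :: real)" by (rule has_derivative_unique)
  from fun_cong[OF this, of 1] show ?thesis by simp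
qed

lemma sum_Basis_linear:
  fixes f :: "'a::euclidean_space \<Rightarrow> real"
  assumes "linear f" shows "(\<Sum>i\<in>Basis. (y \<bullet> i) * f i) = f y"
proof -
  have "f y = f (\<Sum>i\<in>Basis. (y \<bullet> i) *\<^sub>R i)" by (simp add: euclidean_representation)
  also have "\<dots> = (\<Sum>i\<in>Basis. (y \<bullet> i) * f i)"
    by (simp add: linear_sum[OF assms] linear_scale[OF assms])
  finally show ?thesis by simp
qed

context shell
begin

lemma rho_has_derivative:
  assumes "x \<noteq> c" shows "(\<rho> has_derivative (\<lambda>v. (x - c) \<bullet> v / \<rho> x)) (at x)"
proof -
  have "(\<rho> has_derivative (\<lambda>v. v \<bullet> sgn (x - c))) (at x)"
    by (rule has_derivative_compose[where g = norm and f = "\<lambda>x. x - c", of "\<lambda>v. v", unfolded o_def])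
      (use assms in \<open>auto intro!: derivative_eq_intros has_derivative_norm\<close>)
  then show ?thesis by (simp add: sgn_div_norm inner_commute divide_inverse mult.commute)
qed

text \<open>\<open>J\<close> is where the radial factor is differentiable and may omit the
  interface; \<open>q'\<close> is taken to be 0 off \<open>J\<close> so that the product rule holds
  at every point other than \<open>c\<close>.\<close>

lemma test_fun_shell:
  fixes u :: "'a \<Rightarrow> real"
  assumes J: "open J" "J \<subseteq> {0<..}" and T: "compact T" "T \<subseteq> J" "T \<subseteq> {a<..<b}"
    and q: "\<And>t. t \<in> J \<Longrightarrow> (q has_real_derivative q' t) (at t)" "continuous_on J q'"
    and zero: "\<And>t. t \<notin> T \<Longrightarrow> q t = 0" "\<And>t. t \<notin> J \<Longrightarrow> q' t = 0"
    and u: "\<And>x. x \<noteq> c \<Longrightarrow> (u has_derivative Du x) (at x)" "\<And>v. continuous_on (- {c}) (\<lambda>x. Du x v)"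
  shows "test_fun \<Omega> (\<lambda>x. q (\<rho> x) * u x)"
    and "x \<noteq> c \<Longrightarrow> frechet_derivative (\<lambda>x. q (\<rho> x) * u x) (at x) v =
      q' (\<rho> x) * ((x - c) \<bullet> v / \<rho> x) * u x + q (\<rho> x) * Du x v"
proof -
  define D where "D x v = q' (\<rho> x) * ((x - c) \<bullet> v / \<rho> x) * u x + q (\<rho> x) * Du x v" for x v
  let ?V = "{x. \<rho> x \<in> J}"
  have Vc: "?V \<subseteq> - {c}" using J by auto
  have DV: "((\<lambda>x. q (\<rho> x) * u x) has_derivative D x) (at x)" if x: "x \<in> ?V" for x
  proof -
    have xc: "x \<noteq> c" using x Vc by auto
    have "((\<lambda>x. q (\<rho> x)) has_derivative (\<lambda>v. q' (\<rho> x) * ((x - c) \<bullet> v / \<rho> x))) (at x)"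
      by (rule has_derivative_compose[OF rho_has_derivative[OF xc]])
        (use q(1)[of "\<rho> x"] x in \<open>simp add: has_field_derivative_def\<close>)
    from has_derivative_mult[OF this u(1)[OF xc]] show ?thesis
      by (rule has_derivative_eq_rhs) (simp add: D_def[abs_def] fun_eq_iff algebra_simps)
  qed
  have qc: "continuous_on J q"
    using q(1) by (auto intro!: continuous_at_imp_continuous_on DERIV_isCont)
  have "isCont u x" if "x \<in> ?V" for x
    by (rule has_derivative_continuous[OF u(1)]) (use that Vc in auto)
  then have uc: "continuous_on ?V u" by (auto intro!: continuous_at_imp_continuous_on)
  have "continuous_on ?V (\<lambda>x. D x v)" for v
    unfolding D_def
    by (intro continuous_intros continuous_on_compose2[OF q(2)] continuous_on_compose2[OF qc] uc
        continuous_on_subset[OF u(2) Vc]) (use J in auto)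
  then show "test_fun \<Omega> (\<lambda>x. q (\<rho> x) * u x)"
    by (intro test_funI[of ?V "{x. \<rho> x \<in> T}" _ _ D] open_shell compact_shell J T)
      (use T DV zero in \<open>auto simp: Omega_iff\<close>)
  show "frechet_derivative (\<lambda>x. q (\<rho> x) * u x) (at x) v = q' (\<rho> x) * ((x - c) \<bullet> v / \<rho> x) * u x + q (\<rho> x) * Du x v"
    if xc: "x \<noteq> c"
  proof (cases "x \<in> ?V")
    case True
    show ?thesis unfolding D_def[symmetric] using fun_cong[OF frechet_derivative_at[OF DV[OF True]]] by (rule sym)
  next
    case False
    then have xT: "x \<in> - {x. \<rho> x \<in> T}" using T by auto
    have "((\<lambda>x. q (\<rho> x) * u x) has_derivative (\<lambda>v. 0)) (at x)"
      by (rule has_derivative_transform_within_open[OF has_derivative_const[of 0] _ xT])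
        (use zero in \<open>auto intro!: open_Compl compact_imp_closed compact_shell T\<close>)
    from frechet_derivative_at[OF this] have "frechet_derivative (\<lambda>x. q (\<rho> x) * u x) (at x) v = 0" by metis
    then show ?thesis using False zero(1)[of "\<rho> x"] zero(2)[of "\<rho> x"] xT by simp
  qed
qed

lemma set_integral_cong_Omega:
  fixes f g :: "'a \<Rightarrow> real"
  assumes "\<And>x. x \<in> \<Omega> \<Longrightarrow> f x = g x"
  shows "(LINT x:\<Omega>|lebesgue. f x) = (LINT x:\<Omega>|lebesgue. g x)"
  unfolding set_lebesgue_integral_def
  using assms by (intro Bochner_Integration.integral_cong refl) (simp add: indicator_def)

lemma set_integral_sum_finite:
  fixes f :: "'i \<Rightarrow> 'a \<Rightarrow> real"
  assumes "\<And>i. i \<in> S \<Longrightarrow> set_integrable lebesgue \<Omega> (f i)"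
  shows "(LINT x:\<Omega>|lebesgue. (\<Sum>i\<in>S. f i x)) = (\<Sum>i\<in>S. LINT x:\<Omega>|lebesgue. f i x)"
  using assms unfolding set_lebesgue_integral_def set_integrable_def scaleR_sum_right
  by (rule Bochner_Integration.integral_sum)

section \<open>Weak identities for continuously differentiable radial factors\<close>

text \<open>The divergence theorem for the vector field with components \<open>\<phi> i\<close>,
  assembled from the scalar definition of the weak gradient.\<close>

lemma weak_divergence:
  assumes H: "H1_on \<Omega> \<psi> H" and t: "\<And>i. i \<in> Basis \<Longrightarrow> test_fun \<Omega> (\<phi> i)"
  shows "(LINT x:\<Omega>|lebesgue. \<psi> x * (\<Sum>i\<in>Basis. frechet_derivative (\<phi> i) (at x) i)) =
    - (LINT x:\<Omega>|lebesgue. (\<Sum>i\<in>Basis. (H x \<bullet> i) * \<phi> i x))"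
proof -
  have w: "set_integrable lebesgue \<Omega> (\<lambda>x. \<psi> x * frechet_derivative (\<phi> i) (at x) i)"
      "set_integrable lebesgue \<Omega> (\<lambda>x. (H x \<bullet> i) * \<phi> i x)"
      "(LINT x:\<Omega>|lebesgue. \<psi> x * frechet_derivative (\<phi> i) (at x) i)
        = - (LINT x:\<Omega>|lebesgue. (H x \<bullet> i) * \<phi> i x)" if "i \<in> Basis" for i
    using H t[OF that] that unfolding H1_on_def weak_grad_def by blast+
  have 1: "(LINT x:\<Omega>|lebesgue. (\<Sum>i\<in>Basis. \<psi> x * frechet_derivative (\<phi> i) (at x) i)) =
     (\<Sum>i\<in>Basis. LINT x:\<Omega>|lebesgue. \<psi> x * frechet_derivative (\<phi> i) (at x) i)"
    by (rule set_integral_sum_finite[OF w(1)])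
  have 2: "(LINT x:\<Omega>|lebesgue. (\<Sum>i\<in>Basis. (H x \<bullet> i) * \<phi> i x)) =
     (\<Sum>i\<in>Basis. LINT x:\<Omega>|lebesgue. (H x \<bullet> i) * \<phi> i x)"
    by (rule set_integral_sum_finite[OF w(2)])
  show ?thesis unfolding sum_distrib_left 1 2 by (simp add: w(3) sum_negf)
qed

text \<open>Tested with the field q(\<rho>) grad Y. The derivative of \<open>q\<close> drops out
  since grad Y is tangential, and the divergence is -\<Lambda> q Y / \<rho>^2.\<close>

lemma weak_tangential_C1:
  assumes H: "H1_on \<Omega> \<psi> H" and lb: "has_lb c Y DY D2Y (\<lambda>x. - \<Lambda> * Y x)"
    and J: "open J" "J \<subseteq> {0<..}" and T: "compact T" "T \<subseteq> J" "T \<subseteq> {a<..<b}"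
    and q: "\<And>t. t \<in> J \<Longrightarrow> (q has_real_derivative q' t) (at t)" "continuous_on J q'"
    and zero: "\<And>t. t \<notin> T \<Longrightarrow> q t = 0"
  shows "(LINT x:\<Omega>|lebesgue. q (\<rho> x) * (\<Lambda> / (\<rho> x)\<^sup>2 * Y x * \<psi> x)) =
    (LINT x:\<Omega>|lebesgue. q (\<rho> x) * (\<Sum>i\<in>Basis. DY x i * (H x \<bullet> i)))"
proof -
  \<comment> \<open>This is \<open>q'\<close> set to 0 off \<open>J\<close>, as
    \<open>test_fun_shell\<close> wants it, not a second derivative.\<close>
  define q'' where "q'' t = (if t \<in> J then q' t else 0)" for t
  have q'': "\<And>t. t \<in> J \<Longrightarrow> (q has_real_derivative q'' t) (at t)" "continuous_on J q''" "\<And>t. t \<notin> J \<Longrightarrow> q'' t = 0"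
    using q by (auto simp: q''_def cong: continuous_on_cong)
  have u: "\<And>x. x \<noteq> c \<Longrightarrow> ((\<lambda>y. DY y i) has_derivative D2Y x i) (at x)" "\<And>v. continuous_on (- {c}) (\<lambda>x. D2Y x i v)" for i
    using lb by (auto simp: has_lb_def)
  have tf1: "test_fun \<Omega> (\<lambda>x. q (\<rho> x) * DY x i)" for i
    by (rule test_fun_shell(1)[OF J T q''(1,2) zero q''(3) u])
  have tf2: "frechet_derivative (\<lambda>x. q (\<rho> x) * DY x i) (at x) v =
      q'' (\<rho> x) * ((x - c) \<bullet> v / \<rho> x) * DY x i + q (\<rho> x) * D2Y x i v" if "x \<noteq> c" for i x v
    by (rule test_fun_shell(2)[OF J T q''(1,2) zero q''(3) u that])
  have "(\<Sum>i\<in>Basis. frechet_derivative (\<lambda>x. q (\<rho> x) * DY x i) (at x) i) = - (q (\<rho> x) * (\<Lambda> / (\<rho> x)\<^sup>2 * Y x))"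
    if xc: "x \<noteq> c" for x
  proof -
    have lin: "linear (DY x)" using lb xc by (auto simp: has_lb_def intro: has_derivative_linear)
    have "(\<Sum>i\<in>Basis. frechet_derivative (\<lambda>x. q (\<rho> x) * DY x i) (at x) i)
       = (\<Sum>i\<in>Basis. q'' (\<rho> x) / \<rho> x * (((x - c) \<bullet> i) * DY x i) + q (\<rho> x) * D2Y x i i)"
      by (intro sum.cong refl) (simp add: tf2[OF xc])
    also have "\<dots> = q'' (\<rho> x) / \<rho> x * (\<Sum>i\<in>Basis. ((x - c) \<bullet> i) * DY x i) + q (\<rho> x) * (\<Sum>i\<in>Basis. D2Y x i i)"
      by (simp only: sum.distrib sum_distrib_left)
    also have "(\<Sum>i\<in>Basis. ((x - c) \<bullet> i) * DY x i) = 0"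
      using sum_Basis_linear[OF lin, of "x - c"] has_lb_radial[OF lb xc] by simp
    also have "(\<Sum>i\<in>Basis. D2Y x i i) = - \<Lambda> * Y x / (\<rho> x)\<^sup>2" using lb xc by (simp add: has_lb_def)
    finally show ?thesis by simp
  qed
  note div = this
  have "(LINT x:\<Omega>|lebesgue. q (\<rho> x) * (\<Lambda> / (\<rho> x)\<^sup>2 * Y x * \<psi> x))
     = - (LINT x:\<Omega>|lebesgue. \<psi> x * (\<Sum>i\<in>Basis. frechet_derivative (\<lambda>x. q (\<rho> x) * DY x i) (at x) i))"
  proof -
    have "(LINT x:\<Omega>|lebesgue. q (\<rho> x) * (\<Lambda> / (\<rho> x)\<^sup>2 * Y x * \<psi> x))
     = (LINT x:\<Omega>|lebesgue. - (\<psi> x * (\<Sum>i\<in>Basis. frechet_derivative (\<lambda>x. q (\<rho> x) * DY x i) (at x) i)))"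
    proof (rule set_integral_cong_Omega)
      fix x assume "x \<in> \<Omega>"
      then have "x \<noteq> c" using center_notin by blast
      from div[OF this] show "q (\<rho> x) * (\<Lambda> / (\<rho> x)\<^sup>2 * Y x * \<psi> x) = - (\<psi> x * (\<Sum>i\<in>Basis. frechet_derivative (\<lambda>x. q (\<rho> x) * DY x i) (at x) i))"
        by simp
    qed
    then show ?thesis by (simp add: set_lebesgue_integral_def)
  qed
  also have "\<dots> = (LINT x:\<Omega>|lebesgue. (\<Sum>i\<in>Basis. (H x \<bullet> i) * (q (\<rho> x) * DY x i)))"
    using weak_divergence[OF H, of "\<lambda>i x. q (\<rho> x) * DY x i"] tf1 by simp
  also have "\<dots> = (LINT x:\<Omega>|lebesgue. q (\<rho> x) * (\<Sum>i\<in>Basis. DY x i * (H x \<bullet> i)))"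
    by (simp add: sum_distrib_left mult_ac)
  finally show ?thesis .
qed

text \<open>Tested with the field w(\<rho>) Y (x - c) / \<rho>^n. Since (x - c) / \<rho>^n is
  divergence free and \<open>Y\<close> has radial derivative 0, only the derivative of
  \<open>w\<close> contributes.\<close>

lemma weak_radial_C1:
  assumes H: "H1_on \<Omega> \<psi> H" and lb: "has_lb c Y DY D2Y (\<lambda>x. - \<Lambda> * Y x)"
    and J: "open J" "J \<subseteq> {0<..}" and T: "compact T" "T \<subseteq> J" "T \<subseteq> {a<..<b}"
    and w: "\<And>t. t \<in> J \<Longrightarrow> (w has_real_derivative v t) (at t)" "continuous_on J v"
    and zero: "\<And>t. t \<notin> T \<Longrightarrow> w t = 0" "\<And>t. t \<notin> J \<Longrightarrow> v t = 0"
  shows "(LINT x:\<Omega>|lebesgue. v (\<rho> x) * (\<rho> x * Y x / \<rho> x ^ DIM('a) * \<psi> x)) =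
    - (LINT x:\<Omega>|lebesgue. w (\<rho> x) * (Y x / \<rho> x ^ DIM('a) * ((x - c) \<bullet> H x)))"
proof -
  let ?N = "DIM('a)"
  define u where "u i x = Y x * ((x - c) \<bullet> i) / \<rho> x ^ ?N" for i x
  define Du where "Du i x v = (DY x v * ((x - c) \<bullet> i) + Y x * (v \<bullet> i)) / \<rho> x ^ ?N
     - real ?N * (Y x * ((x - c) \<bullet> i)) * ((x - c) \<bullet> v) / \<rho> x ^ (?N + 2)" for i x v
  have u1: "(u i has_derivative Du i x) (at x)" if xc: "x \<noteq> c" for i x
  proof -
    have "((\<lambda>y. c + y) has_derivative (\<lambda>v. v)) (at (x - c))" by (auto intro!: derivative_eq_intros)
    moreover have "(Y has_derivative DY x) (at (c + (x - c)))" using lb xc by (simp add: has_lb_def)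
    ultimately have "((\<lambda>y. Y (c + y)) has_derivative DY x) (at (x - c))" by (rule has_derivative_compose)
    then have "((\<lambda>y. Y (c + y) * (y \<bullet> i)) has_derivative (\<lambda>v. DY x v * ((x - c) \<bullet> i) + Y x * (v \<bullet> i))) (at (x - c))"
      by (auto intro!: derivative_eq_intros)
    from has_derivative_over_norm_power[OF this xc, of ?N] show ?thesis
      by (simp add: u_def[abs_def] Du_def[abs_def])
  qed
  have u2: "continuous_on (- {c}) (\<lambda>x. Du i x v)" for i v
    unfolding Du_def by (intro continuous_intros has_lb_continuous[OF lb]) auto
  have tf1: "test_fun \<Omega> (\<lambda>x. w (\<rho> x) * u i x)" for i
    by (rule test_fun_shell(1)[OF J T w zero u1 u2])
  have tf2: "frechet_derivative (\<lambda>x. w (\<rho> x) * u i x) (at x) y =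
      v (\<rho> x) * ((x - c) \<bullet> y / \<rho> x) * u i x + w (\<rho> x) * Du i x y" if "x \<noteq> c" for i x y
    by (rule test_fun_shell(2)[OF J T w zero u1 u2 that])
  have div: "(\<Sum>i\<in>Basis. frechet_derivative (\<lambda>x. w (\<rho> x) * u i x) (at x) i) = v (\<rho> x) * (\<rho> x * Y x / \<rho> x ^ ?N)"
    if xc: "x \<noteq> c" for x
  proof -
    have lin: "linear (DY x)" using lb xc by (auto simp: has_lb_def intro: has_derivative_linear)
    have s1: "(\<Sum>i\<in>Basis. ((x - c) \<bullet> i) * ((x - c) \<bullet> i)) = (\<rho> x)\<^sup>2"
      by (simp add: power2_norm_eq_inner euclidean_inner[of "x - c" "x - c"])
    have s2: "(\<Sum>i\<in>Basis. ((x - c) \<bullet> i) * DY x i) = 0"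
      using sum_Basis_linear[OF lin, of "x - c"] has_lb_radial[OF lb xc] by simp
    have s3: "(\<Sum>i\<in>(Basis :: 'a set). i \<bullet> i) = real ?N" by (simp add: inner_Basis)
    have "(\<Sum>i\<in>Basis. frechet_derivative (\<lambda>x. w (\<rho> x) * u i x) (at x) i)
      = (\<Sum>i\<in>Basis. v (\<rho> x) * Y x / (\<rho> x * \<rho> x ^ ?N) * (((x - c) \<bullet> i) * ((x - c) \<bullet> i))
          + w (\<rho> x) / \<rho> x ^ ?N * (((x - c) \<bullet> i) * DY x i) + w (\<rho> x) * Y x / \<rho> x ^ ?N * (i \<bullet> i)
          - w (\<rho> x) * real ?N * Y x / \<rho> x ^ (?N + 2) * (((x - c) \<bullet> i) * ((x - c) \<bullet> i)))"
    proof (intro sum.cong refl)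
      fix i :: 'a assume "i \<in> Basis"
      have id: "v * (s / R) * (y * s / P) + w * ((d * s + y * e) / P - n * (y * s) * s / Q)
        = v * y / (R * P) * (s * s) + w / P * (s * d) + w * y / P * e - w * n * y / Q * (s * s)" for v s R y P w d e n Q :: real
        by (simp add: algebra_simps add_divide_distrib)
      show "frechet_derivative (\<lambda>x. w (\<rho> x) * u i x) (at x) i = v (\<rho> x) * Y x / (\<rho> x * \<rho> x ^ ?N) * (((x - c) \<bullet> i) * ((x - c) \<bullet> i))
          + w (\<rho> x) / \<rho> x ^ ?N * (((x - c) \<bullet> i) * DY x i) + w (\<rho> x) * Y x / \<rho> x ^ ?N * (i \<bullet> i)
          - w (\<rho> x) * real ?N * Y x / \<rho> x ^ (?N + 2) * (((x - c) \<bullet> i) * ((x - c) \<bullet> i))"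
        unfolding tf2[OF xc] unfolding u_def Du_def by (rule id)
    qed
    also have "\<dots> = v (\<rho> x) * Y x / (\<rho> x * \<rho> x ^ ?N) * (\<rho> x)\<^sup>2 + w (\<rho> x) / \<rho> x ^ ?N * 0 + w (\<rho> x) * Y x / \<rho> x ^ ?N * real ?N
        - w (\<rho> x) * real ?N * Y x / \<rho> x ^ (?N + 2) * (\<rho> x)\<^sup>2"
      by (simp only: sum.distrib sum_subtractf sum_distrib_left[symmetric] s1 s2 s3)
    also have "\<dots> = v (\<rho> x) * (\<rho> x * Y x / \<rho> x ^ ?N)"
      using xc by (simp add: power_add power2_eq_square)
    finally show ?thesis .
  qed
  have "(LINT x:\<Omega>|lebesgue. v (\<rho> x) * (\<rho> x * Y x / \<rho> x ^ ?N * \<psi> x))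
     = (LINT x:\<Omega>|lebesgue. \<psi> x * (\<Sum>i\<in>Basis. frechet_derivative (\<lambda>x. w (\<rho> x) * u i x) (at x) i))"
  proof (rule set_integral_cong_Omega)
    fix x assume "x \<in> \<Omega>"
    then have "x \<noteq> c" using center_notin by blast
    from div[OF this] show "v (\<rho> x) * (\<rho> x * Y x / \<rho> x ^ ?N * \<psi> x) = \<psi> x * (\<Sum>i\<in>Basis. frechet_derivative (\<lambda>x. w (\<rho> x) * u i x) (at x) i)"
      by simp
  qed
  also have "\<dots> = - (LINT x:\<Omega>|lebesgue. (\<Sum>i\<in>Basis. (H x \<bullet> i) * (w (\<rho> x) * u i x)))"
    using weak_divergence[OF H, of "\<lambda>i x. w (\<rho> x) * u i x"] tf1 by simp
  also have "(\<lambda>x. \<Sum>i\<in>Basis. (H x \<bullet> i) * (w (\<rho> x) * u i x)) = (\<lambda>x. w (\<rho> x) * (Y x / \<rho> x ^ ?N * ((x - c) \<bullet> H x)))"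
  proof
    fix x
    have e: "(x - c) \<bullet> H x = (\<Sum>i\<in>Basis. ((x - c) \<bullet> i) * (H x \<bullet> i))" by (rule euclidean_inner)
    show "(\<Sum>i\<in>Basis. (H x \<bullet> i) * (w (\<rho> x) * u i x)) = w (\<rho> x) * (Y x / \<rho> x ^ ?N * ((x - c) \<bullet> H x))"
      unfolding u_def e sum_distrib_left by (intro sum.cong refl) simp
  qed
  finally show ?thesis .
qed

end

section \<open>Cut-offs, and radial factors that are not differentiable at the interface\<close>

text \<open>Test functions only have to be continuously differentiable, so the square of the
  positive part is smooth enough to build cut-offs from.\<close>

lemma has_derivative_square_pos_part:
  "((\<lambda>u::real. (max 0 u)\<^sup>2) has_real_derivative 2 * max 0 u) (at u)"
proof (cases u "0 :: real" rule: linorder_cases)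
  case less
  have "((\<lambda>u::real. 0) has_real_derivative 0) (at u)" by simp
  then have "((\<lambda>u::real. (max 0 u)\<^sup>2) has_real_derivative 0) (at u)"
    by (rule has_field_derivative_transform_within_open[of _ _ _ "{..<0}"]) (use less in auto)
  then show ?thesis using less by simp
next
  case greater
  have "((\<lambda>u::real. u\<^sup>2) has_real_derivative 2 * u) (at u)" by (auto intro!: derivative_eq_intros)
  then have "((\<lambda>u::real. (max 0 u)\<^sup>2) has_real_derivative 2 * u) (at u)"
    by (rule has_field_derivative_transform_within_open[of _ _ _ "{0<..}"]) (use greater in auto)
  then show ?thesis using greater by simp
next
  case equal
  have "(\<lambda>h::real. (max 0 h)\<^sup>2 / h) \<midarrow>0\<rightarrow> 0"
  proof (rule Lim_null_comparison)
    have "norm ((max 0 h)\<^sup>2 / h) \<le> \<bar>h\<bar>" for h :: real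
      by (cases "h \<le> 0") (auto simp: power2_eq_square)
    then show "\<forall>\<^sub>F h in at 0. norm ((max 0 h)\<^sup>2 / h) \<le> \<bar>h :: real\<bar>" by simp
    show "(\<lambda>h. \<bar>h :: real\<bar>) \<midarrow>0\<rightarrow> 0" by (rule tendsto_rabs_zero) (rule tendsto_ident_at)
  qed
  then show ?thesis using equal by (simp add: has_field_derivative_iff)
qed

context radial_interval
begin

abbreviation "J0 \<equiv> {a<..<b} - {r}"

text \<open>Since \<open>cutd\<close> is negative outside \<open>[a, b]\<close> and vanishes at \<open>a\<close>, \<open>r\<close> and \<open>b\<close>, the functions
  \<open>cut k\<close> are \<open>C\<^sup>1\<close> on the whole line, supported away from \<open>a\<close>, \<open>r\<close>, \<open>b\<close>, and tend to \<open>1\<close> elsewhere.\<close>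

definition cutd :: "real \<Rightarrow> real" where "cutd t = (t - a) * (b - t) * (t - r)\<^sup>2"

definition cut :: "nat \<Rightarrow> real \<Rightarrow> real" where
  "cut k t = (max 0 (k * cutd t - 1))\<^sup>2 / (1 + (max 0 (k * cutd t - 1))\<^sup>2)"

definition cut' :: "nat \<Rightarrow> real \<Rightarrow> real" where
  "cut' k t = 2 * max 0 (k * cutd t - 1) * (k * ((b - t) * (t - r)\<^sup>2 - (t - a) * (t - r)\<^sup>2 + 2 * (t - a) * (b - t) * (t - r)))
     / (1 + (max 0 (k * cutd t - 1))\<^sup>2)\<^sup>2"

definition cutsupp :: "nat \<Rightarrow> real set" where "cutsupp k = {t \<in> {a..b}. 1 \<le> k * cutd t}"

lemma open_J0: "open J0" by (intro open_Diff) auto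

lemma cut_denominator: "1 + (max 0 (k * cutd t - 1))\<^sup>2 > 0"
  by (rule add_pos_nonneg) auto

lemma cut_bounds: "0 \<le> cut k t" "cut k t \<le> 1"
  using cut_denominator[of k t] by (auto simp: cut_def divide_le_eq_1)

lemma cut_derivative: "(cut k has_real_derivative cut' k t) (at t)"
proof -
  let ?S = "\<lambda>t. (max 0 (k * cutd t - 1))\<^sup>2"
  define s' where "s' = 2 * max 0 (k * cutd t - 1) * (k * ((b - t) * (t - r)\<^sup>2 - (t - a) * (t - r)\<^sup>2 + 2 * (t - a) * (b - t) * (t - r)))"
  have d: "((\<lambda>t. k * cutd t - 1) has_real_derivative (k * ((b - t) * (t - r)\<^sup>2 - (t - a) * (t - r)\<^sup>2 + 2 * (t - a) * (b - t) * (t - r)))) (at t)"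
    unfolding cutd_def by (rule derivative_eq_intros refl)+ (simp add: algebra_simps)
  have 1: "(?S has_real_derivative s') (at t)"
    using DERIV_chain2[OF has_derivative_square_pos_part d] by (simp add: s'_def)
  have "((\<lambda>t. ?S t / (1 + ?S t)) has_real_derivative (s' * (1 + ?S t) - ?S t * s') / ((1 + ?S t) * (1 + ?S t))) (at t)"
  proof (rule DERIV_divide[OF 1])
    show "((\<lambda>t. 1 + ?S t) has_real_derivative s') (at t)" using DERIV_add[OF DERIV_const 1, of 1] by simp
  qed (use cut_denominator[of k t] in simp)
  moreover have "(s' * (1 + ?S t) - ?S t * s') / ((1 + ?S t) * (1 + ?S t)) = cut' k t"
    by (simp add: cut'_def s'_def power2_eq_square algebra_simps)
  ultimately show ?thesis by (simp add: cut_def[abs_def])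
qed

lemma continuous_cut': "continuous_on S (cut' k)"
  unfolding cut'_def[abs_def] cutd_def
  using cut_denominator[unfolded cutd_def] by (intro continuous_intros) (metis less_irrefl power_not_zero)

lemma continuous_cut: "continuous_on S (cut k)"
  using cut_derivative by (auto intro!: continuous_at_imp_continuous_on DERIV_isCont)

lemma cutsupp_compact: "compact (cutsupp k)"
proof -
  have "closed (cutsupp k)"
    unfolding cutsupp_def cutd_def Collect_conj_eq Collect_mem_eq
    by (intro closed_Int closed_Collect_le continuous_intros closed_atLeastAtMost)
  moreover have "bounded (cutsupp k)" by (rule bounded_subset[of "{a..b}"]) (auto simp: cutsupp_def)
  ultimately show ?thesis by (simp add: compact_eq_bounded_closed)
qed

lemma cutsupp_subset: "cutsupp k \<subseteq> J0"
proof
  fix t assume t: "t \<in> cutsupp k"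
  then have "cutd t \<noteq> 0" by (auto simp: cutsupp_def)
  then have "t \<noteq> a" "t \<noteq> b" "t \<noteq> r" by (auto simp: cutd_def)
  moreover have "a \<le> t" "t \<le> b" using t by (auto simp: cutsupp_def)
  ultimately show "t \<in> J0" by auto
qed

lemma cut_zero: "t \<notin> cutsupp k \<Longrightarrow> cut k t = 0"
proof -
  assume t: "t \<notin> cutsupp k"
  have "k * cutd t \<le> 1"
  proof (cases "t \<in> {a..b}")
    case True
    then show ?thesis using t by (auto simp: cutsupp_def)
  next
    case False
    then have "(t - a) * (b - t) \<le> 0" using ab by (auto simp: mult_le_0_iff)
    then have "cutd t \<le> 0" by (simp add: cutd_def mult_nonpos_nonneg)
    then have "k * cutd t \<le> 0" by (simp add: mult_nonneg_nonpos)
    then show ?thesis by simp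
  qed
  then show ?thesis by (simp add: cut_def)
qed

lemma cut_mult_le:
  assumes "\<And>t. t \<in> {a<..<b} \<Longrightarrow> \<bar>v t\<bar> \<le> B" shows "\<bar>cut k t * v t\<bar> \<le> B"
proof (cases "t \<in> {a<..<b}")
  case True
  have "cut k t * \<bar>v t\<bar> \<le> 1 * B" using cut_bounds[of k t] assms[OF True] by (intro mult_mono) auto
  then show ?thesis using cut_bounds[of k t] by (simp add: abs_mult)
next
  case False
  then have "t \<notin> cutsupp k" using cutsupp_subset by blast
  then show ?thesis using cut_zero[of t k] assms[OF rab] by simp
qed

lemma cut_tendsto:
  assumes t: "t \<in> J0" shows "(\<lambda>k. cut k t) \<longlonglongrightarrow> 1"
proof -
  have d: "cutd t > 0" using t by (auto simp: cutd_def)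
  have 1: "filterlim (\<lambda>k. real k * cutd t - 1) at_top sequentially"
    using d by real_asymp
  have "((\<lambda>u::real. (max 0 u)\<^sup>2 / (1 + (max 0 u)\<^sup>2)) \<longlongrightarrow> 1) at_top"
  proof (rule Lim_transform_eventually)
    show "((\<lambda>u::real. u\<^sup>2 / (1 + u\<^sup>2)) \<longlongrightarrow> 1) at_top" by real_asymp
    show "\<forall>\<^sub>F u::real in at_top. u\<^sup>2 / (1 + u\<^sup>2) = (max 0 u)\<^sup>2 / (1 + (max 0 u)\<^sup>2)"
      using eventually_ge_at_top[of 0] by eventually_elim simp
  qed
  from filterlim_compose[OF this 1] show ?thesis by (simp add: cut_def)
qed

text \<open>Off a compact subset of \<open>J0\<close> the product is 0, which suppresses
  discontinuities of \<open>v\<close> at \<open>a\<close>, \<open>r\<close> and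
  \<open>b\<close>.\<close>

lemma cut_mult_continuous:
  assumes "continuous_on J0 v" shows "continuous_on S (\<lambda>t. cut k t * v t)"
proof -
  have "continuous_on (J0 \<union> - cutsupp k) (\<lambda>t. cut k t * v t)"
  proof (rule continuous_on_open_Un)
    show "open J0" by (rule open_J0)
    show "open (- cutsupp k)" using cutsupp_compact[of k] by (simp add: compact_imp_closed open_Compl)
    show "continuous_on J0 (\<lambda>t. cut k t * v t)" by (intro continuous_intros continuous_cut assms)
    show "continuous_on (- cutsupp k) (\<lambda>t. cut k t * v t)"
      using continuous_on_const[of "- cutsupp k" "0::real"] by (rule continuous_on_eq) (simp add: cut_zero)
  qed
  moreover have "J0 \<union> - cutsupp k = UNIV" using cutsupp_subset by auto
  ultimately show ?thesis using continuous_on_subset by fastforce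
qed

lemma cut_integral_tendsto:
  assumes v: "continuous_on J0 v" "\<And>t. t \<in> {a<..<b} \<Longrightarrow> \<bar>v t\<bar> \<le> B" and t: "t \<in> {a..b}"
  shows "(\<lambda>k. integral {a..t} (\<lambda>s. cut k s * v s)) \<longlonglongrightarrow> integral {a..t} v"
proof -
  \<comment> \<open>At \<open>a\<close>, \<open>r\<close> and \<open>b\<close> the limit of the
    products is 0 and not \<open>v\<close>; on the interval of integration \<open>v0\<close> differs
    from \<open>v\<close> at most there.\<close>
  define v0 where "v0 s = (if s \<in> J0 then v s else 0)" for s
  have B: "B \<ge> 0" using v(2)[OF rab] by linarith
  have "(\<lambda>k. integral {a..t} (\<lambda>s. cut k s * v s)) \<longlonglongrightarrow> integral {a..t} v0"
  proof (rule dominated_convergence(2)[where h = "\<lambda>_. B"])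
    show "(\<lambda>s. cut k s * v s) integrable_on {a..t}" for k
      by (intro integrable_continuous_real cut_mult_continuous v)
    show "(\<lambda>_. B) integrable_on {a..t}" by (rule integrable_const_ivl)
    show "norm (cut k s * v s) \<le> B" for k s using cut_mult_le[of v B k s] v(2) by simp
    show "(\<lambda>k. cut k s * v s) \<longlonglongrightarrow> v0 s" for s
    proof (cases "s \<in> J0")
      case True
      then show ?thesis using tendsto_mult[OF cut_tendsto[OF True] tendsto_const[of "v s"]] by (simp add: v0_def)
    next
      case False
      then have "cut k s = 0" for k using cut_zero[of s k] cutsupp_subset by blast
      moreover have "v0 s = 0" unfolding v0_def using False by (rule if_not_P)
      ultimately show ?thesis by simp
    qed
  qed
  also have "integral {a..t} v0 = integral {a..t} v"
    by (rule integral_spike[of "{a, b, r}"]) (use t in \<open>auto simp: v0_def\<close>)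
  finally show ?thesis .
qed

text \<open>Supplies the bump that corrects the mean value in \<open>weak_radial\<close>.\<close>

lemma cut_integral_pos: "\<exists>k. 0 < integral {a..b} (cut k)"
proof -
  have "(\<lambda>k. integral {a..b} (\<lambda>s. cut k s * 1)) \<longlonglongrightarrow> integral {a..b} (\<lambda>_. 1)"
    by (rule cut_integral_tendsto[where B = 1]) (use ab in auto)
  moreover have "integral {a..b} (\<lambda>_. 1 :: real) = b - a" using ab by simp
  ultimately have "(\<lambda>k. integral {a..b} (cut k)) \<longlonglongrightarrow> b - a" by simp
  then have "eventually (\<lambda>k. 0 < integral {a..b} (cut k)) sequentially"
    by (rule order_tendstoD(1)) (use ab in simp)
  then show ?thesis using eventually_happens trivial_limit_sequentially by blast
qed

end

context shell
begin

lemma set_integrable_off_center_mult: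
  fixes u g :: "'a \<Rightarrow> real"
  assumes "continuous_on (- {c}) u" "set_integrable lebesgue \<Omega> g"
  shows "set_integrable lebesgue \<Omega> (\<lambda>x. u x * g x)"
proof -
  obtain B where "\<And>x. x \<in> \<Omega> \<Longrightarrow> \<bar>u x\<bar> \<le> B" using bounded_on_Omega[OF assms(1)] by blast
  then show ?thesis using set_integrable_mult_bounded[OF assms(2) measurable_continuous_off_center[OF assms(1)]] by blast
qed

lemma set_integrable_sum_Basis:
  fixes f :: "'a \<Rightarrow> 'a \<Rightarrow> real"
  assumes "\<And>i. i \<in> Basis \<Longrightarrow> set_integrable lebesgue \<Omega> (f i)"
  shows "set_integrable lebesgue \<Omega> (\<lambda>x. \<Sum>i\<in>Basis. f i x)"
  using assms unfolding set_integrable_def scaleR_sum_right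
  by (rule Bochner_Integration.integrable_sum)

lemma H1_set_integrable:
  assumes "H1_on \<Omega> \<psi> H"
  shows "set_integrable lebesgue \<Omega> \<psi>" "i \<in> Basis \<Longrightarrow> set_integrable lebesgue \<Omega> (\<lambda>x. H x \<bullet> i)"
  using assms by (auto simp: H1_on_def intro!: L2_set_integrable)

lemma H1_integrable_products:
  assumes H: "H1_on \<Omega> \<psi> H" and lb: "has_lb c Y DY D2Y K"
  shows "set_integrable lebesgue \<Omega> (\<lambda>x. \<Lambda> / (\<rho> x)\<^sup>2 * Y x * \<psi> x)"
    and "set_integrable lebesgue \<Omega> (\<lambda>x. \<Sum>i\<in>Basis. DY x i * (H x \<bullet> i))"
    and "set_integrable lebesgue \<Omega> (\<lambda>x. \<rho> x * Y x / \<rho> x ^ DIM('a) * \<psi> x)"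
    and "set_integrable lebesgue \<Omega> (\<lambda>x. Y x / \<rho> x ^ DIM('a) * ((x - c) \<bullet> H x))"
proof -
  note cY = has_lb_continuous[OF lb]
  show "set_integrable lebesgue \<Omega> (\<lambda>x. \<Lambda> / (\<rho> x)\<^sup>2 * Y x * \<psi> x)"
    "set_integrable lebesgue \<Omega> (\<lambda>x. \<rho> x * Y x / \<rho> x ^ DIM('a) * \<psi> x)"
    by (intro set_integrable_off_center_mult H1_set_integrable(1)[OF H] continuous_intros cY; auto)+
  show "set_integrable lebesgue \<Omega> (\<lambda>x. \<Sum>i\<in>Basis. DY x i * (H x \<bullet> i))"
    by (intro set_integrable_sum_Basis set_integrable_off_center_mult H1_set_integrable(2)[OF H] cY)
  have "set_integrable lebesgue \<Omega> (\<lambda>x. \<Sum>i\<in>Basis. (Y x / \<rho> x ^ DIM('a) * ((x - c) \<bullet> i)) * (H x \<bullet> i))"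
    by (intro set_integrable_sum_Basis set_integrable_off_center_mult H1_set_integrable(2)[OF H] continuous_intros cY) auto
  moreover have "(\<Sum>i\<in>Basis. (Y x / \<rho> x ^ DIM('a) * ((x - c) \<bullet> i)) * (H x \<bullet> i)) = Y x / \<rho> x ^ DIM('a) * ((x - c) \<bullet> H x)" for x
    by (subst (2) euclidean_inner) (simp only: sum_distrib_left mult.assoc)
  ultimately show "set_integrable lebesgue \<Omega> (\<lambda>x. Y x / \<rho> x ^ DIM('a) * ((x - c) \<bullet> H x))" by simp
qed

text \<open>\<open>q'\<close> does not occur in the identity, so \<open>q\<close> can be multiplied
  by \<open>cut k\<close> directly and the limit needs only the bound on \<open>q\<close>. This
  admits \<sigma> p, which jumps at \<open>r\<close>.\<close>

lemma weak_tangential: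
  assumes H: "H1_on \<Omega> \<psi> H" and lb: "has_lb c Y DY D2Y (\<lambda>x. - \<Lambda> * Y x)"
    and q: "\<And>t. t \<in> J0 \<Longrightarrow> (q has_real_derivative q' t) (at t)" "continuous_on J0 q'"
    and B: "\<And>t. t \<in> {a<..<b} \<Longrightarrow> \<bar>q t\<bar> \<le> B"
  shows "(LINT x:\<Omega>|lebesgue. q (\<rho> x) * (\<Lambda> / (\<rho> x)\<^sup>2 * Y x * \<psi> x)) =
    (LINT x:\<Omega>|lebesgue. q (\<rho> x) * (\<Sum>i\<in>Basis. DY x i * (H x \<bullet> i)))"
proof -
  have qc: "continuous_on J0 q" by (rule DERIV_continuous_on) (rule has_field_derivative_at_within[OF q(1)])
  have b: "\<bar>cut k t * q t\<bar> \<le> B" for k t using cut_mult_le[of q B] B by blast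
  have l: "(\<lambda>k. cut k t * q t) \<longlonglongrightarrow> q t" if "t \<in> J0" for t
    using tendsto_mult[OF cut_tendsto[OF that] tendsto_const[of "q t"]] by simp
  have J: "J0 \<subseteq> {0<..}" using a0 by auto
  have T: "cutsupp k \<subseteq> {a<..<b}" for k using cutsupp_subset[of k] by auto
  have eq: "(LINT x:\<Omega>|lebesgue. (cut k (\<rho> x) * q (\<rho> x)) * (\<Lambda> / (\<rho> x)\<^sup>2 * Y x * \<psi> x)) =
    (LINT x:\<Omega>|lebesgue. (cut k (\<rho> x) * q (\<rho> x)) * (\<Sum>i\<in>Basis. DY x i * (H x \<bullet> i)))" for k
  proof (rule weak_tangential_C1[OF H lb open_J0 J cutsupp_compact cutsupp_subset T])
    show "((\<lambda>t. cut k t * q t) has_real_derivative cut' k t * q t + cut k t * q' t) (at t)" if "t \<in> J0" for t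
      using DERIV_mult[OF cut_derivative q(1)[OF that]] by (simp add: algebra_simps)
    show "continuous_on J0 (\<lambda>t. cut' k t * q t + cut k t * q' t)"
      by (intro continuous_intros continuous_cut continuous_cut' qc q)
    show "cut k t * q t = 0" if "t \<notin> cutsupp k" for t using cut_zero[OF that] by simp
  qed
  have qk: "continuous_on J0 (\<lambda>t. cut k t * q t)" for k by (intro continuous_intros continuous_cut qc)
  have "(\<lambda>k. LINT x:\<Omega>|lebesgue. (cut k (\<rho> x) * q (\<rho> x)) * (\<Lambda> / (\<rho> x)\<^sup>2 * Y x * \<psi> x)) \<longlonglongrightarrow>
      (LINT x:\<Omega>|lebesgue. q (\<rho> x) * (\<Lambda> / (\<rho> x)\<^sup>2 * Y x * \<psi> x))"
    by (rule radial_limit[OF qk b qc l H1_integrable_products(1)[OF H lb]])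
  moreover have "(\<lambda>k. LINT x:\<Omega>|lebesgue. (cut k (\<rho> x) * q (\<rho> x)) * (\<Sum>i\<in>Basis. DY x i * (H x \<bullet> i))) \<longlonglongrightarrow>
      (LINT x:\<Omega>|lebesgue. q (\<rho> x) * (\<Sum>i\<in>Basis. DY x i * (H x \<bullet> i)))"
    by (rule radial_limit[OF qk b qc l H1_integrable_products(2)[OF H lb]])
  ultimately show ?thesis unfolding eq by (rule LIMSEQ_unique)
qed

text \<open>The cut-off is applied to \<open>v = w'\<close> rather than to \<open>w\<close>, whose product with \<open>cut k\<close> would have a large
  derivative near \<open>r\<close>; subtracting a multiple of a fixed bump restores \<open>\<integral> v = 0\<close>.\<close>

lemma weak_radial:
  assumes H: "H1_on \<Omega> \<psi> H" and lb: "has_lb c Y DY D2Y (\<lambda>x. - \<Lambda> * Y x)"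
    and w: "\<And>t. t \<in> J0 \<Longrightarrow> (w has_real_derivative v t) (at t)" "continuous_on {a..b} w" "w a = 0" "w b = 0"
    and v: "continuous_on J0 v" and B: "\<And>t. t \<in> {a<..<b} \<Longrightarrow> \<bar>v t\<bar> \<le> B"
  shows "(LINT x:\<Omega>|lebesgue. v (\<rho> x) * (\<rho> x * Y x / \<rho> x ^ DIM('a) * \<psi> x)) =
    - (LINT x:\<Omega>|lebesgue. w (\<rho> x) * (Y x / \<rho> x ^ DIM('a) * ((x - c) \<bullet> H x)))"
proof -
  obtain k0 where k0: "0 < integral {a..b} (cut k0)" using cut_integral_pos by blast
  define I where "I = integral {a..b} (cut k0)"
  have I: "I > 0" using k0 by (simp add: I_def)
  have B0: "B \<ge> 0" using B[OF rab] by linarith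
  \<comment> \<open>This factor gives \<open>vk k\<close> mean zero, so that \<open>wk k\<close>
    vanishes at both ends; it tends to 0 because \<open>v\<close> has integral
    \<open>w b - w a\<close>, which is 0.\<close>
  define C where "C k = integral {a..b} (\<lambda>s. cut k s * v s) / I" for k
  define vk where "vk k t = cut k t * v t - C k * cut k0 t" for k t
  define wk where "wk k t = integral {a..t} (vk k)" for k t
  define B2 where "B2 = B + B * (b - a) / I"
  have B2: "B2 \<ge> 0" using B0 I ab by (auto simp: B2_def)
  have FT: "(v has_integral w t) {a..t}" if t: "t \<in> {a..b}" for t
  proof -
    have "(v has_integral (w t - w a)) {a..t}"
    proof (rule fundamental_theorem_of_calculus_interior_strong[of "{r}"])
      show "continuous_on {a..t} w" using t by (intro continuous_on_subset[OF w(2)]) auto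
    qed (use t w(1) in \<open>auto simp: has_real_derivative_iff_has_vector_derivative\<close>)
    then show ?thesis using w(3) by simp
  qed
  have cb: "\<bar>cut k t * v t\<bar> \<le> B" for k t using cut_mult_le[of v B] B by blast
  have Cb: "\<bar>C k\<bar> \<le> B * (b - a) / I" for k
  proof -
    have "norm (integral {a..b} (\<lambda>s. cut k s * v s)) \<le> B * (b - a)"
      by (rule integral_bound) (use ab cb in \<open>auto intro!: cut_mult_continuous v\<close>)
    then show ?thesis using I by (simp add: C_def abs_mult divide_right_mono)
  qed
  have Cl: "C \<longlonglongrightarrow> 0"
  proof -
    have "(\<lambda>k. integral {a..b} (\<lambda>s. cut k s * v s) / I) \<longlonglongrightarrow> integral {a..b} v / I"
      by (intro tendsto_divide tendsto_const cut_integral_tendsto[OF v B]) (use ab I in auto)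
    moreover have "integral {a..b} v = 0" using FT[of b] ab w(4) by (simp add: integral_unique)
    ultimately show ?thesis by (simp add: C_def[abs_def])
  qed
  have vkc: "continuous_on S (vk k)" for S k
    unfolding vk_def[abs_def] by (intro continuous_intros cut_mult_continuous continuous_cut v)
  have vkb: "\<bar>vk k t\<bar> \<le> B2" for k t
  proof -
    have "\<bar>C k * cut k0 t\<bar> \<le> B * (b - a) / I * 1"
      unfolding abs_mult using Cb[of k] cut_bounds[of k0 t] by (intro mult_mono) auto
    then show ?thesis using cb[of k t] abs_triangle_ineq4[of "cut k t * v t" "C k * cut k0 t"]
      unfolding vk_def B2_def by linarith
  qed
  have vki: "vk k integrable_on {s..t}" for k s t by (intro integrable_continuous_real vkc)
  have wkb: "wk k b = 0" for k
  proof -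
    have "wk k b = integral {a..b} (\<lambda>s. cut k s * v s) - integral {a..b} (\<lambda>s. C k * cut k0 s)"
      unfolding wk_def vk_def[abs_def]
      by (intro integral_diff integrable_continuous_real cut_mult_continuous continuous_on_mult continuous_on_const continuous_cut v)
    then show ?thesis using I by (simp add: C_def I_def[symmetric])
  qed
  have wkB: "\<bar>wk k t\<bar> \<le> B2 * (b - a)" if "t \<in> {a<..<b}" for k t
  proof -
    have "norm (wk k t) \<le> B2 * (t - a)" unfolding wk_def
      by (rule integral_bound) (use that vkb vkc in auto)
    also have "\<dots> \<le> B2 * (b - a)" using that B2 by (intro mult_left_mono) auto
    finally show ?thesis by simp
  qed
  have wkl: "(\<lambda>k. wk k t) \<longlonglongrightarrow> w t" if t: "t \<in> {a<..<b}" for t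
  proof -
    have "(\<lambda>k. integral {a..t} (\<lambda>s. cut k s * v s) - C k * integral {a..t} (cut k0)) \<longlonglongrightarrow> integral {a..t} v - 0 * integral {a..t} (cut k0)"
      by (intro tendsto_diff tendsto_mult tendsto_const Cl cut_integral_tendsto[OF v B]) (use t in auto)
    moreover have "integral {a..t} (\<lambda>s. cut k s * v s) - C k * integral {a..t} (cut k0) = wk k t" for k
      unfolding wk_def vk_def[abs_def]
      by (subst integral_diff) (auto intro!: integrable_continuous_real cut_mult_continuous continuous_on_mult continuous_on_const continuous_cut v)
    moreover have "integral {a..t} v = w t" using FT[of t] t by (simp add: integral_unique)
    ultimately show ?thesis by simp
  qed
  have eq: "(LINT x:\<Omega>|lebesgue. vk k (\<rho> x) * (\<rho> x * Y x / \<rho> x ^ DIM('a) * \<psi> x)) =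
    - (LINT x:\<Omega>|lebesgue. wk k (\<rho> x) * (Y x / \<rho> x ^ DIM('a) * ((x - c) \<bullet> H x)))" for k
  proof -
    \<comment> \<open>\<open>r\<close> is inserted to make the set nonempty, so that it has a least
      and a greatest element; between them lies the support of \<open>wk k\<close>.\<close>
    define S where "S = insert r (cutsupp k \<union> cutsupp k0)"
    have S: "compact S" "S \<noteq> {}" "S \<subseteq> {a<..<b}"
      using cutsupp_subset[of k] cutsupp_subset[of k0] rab
      by (auto simp: S_def intro!: compact_insert compact_Un cutsupp_compact)
    obtain \<alpha> where \<alpha>: "\<alpha> \<in> S" "\<And>t. t \<in> S \<Longrightarrow> \<alpha> \<le> t" using compact_attains_inf[OF S(1,2)] by blast
    obtain \<beta> where \<beta>: "\<beta> \<in> S" "\<And>t. t \<in> S \<Longrightarrow> t \<le> \<beta>" using compact_attains_sup[OF S(1,2)] by blast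
    have \<alpha>\<beta>: "a < \<alpha>" "\<beta> < b" using subsetD[OF S(3) \<alpha>(1)] subsetD[OF S(3) \<beta>(1)] by auto
    have vk0: "vk k t = 0" if "t \<notin> S" for t using that by (simp add: vk_def S_def cut_zero)
    have z1: "wk k t = 0" if t: "t < \<alpha>" for t
    proof -
      have "integral {a..t} (vk k) = integral {a..t} (\<lambda>_. 0)"
      proof (rule integral_cong)
        fix s assume "s \<in> {a..t}"
        then have "s \<notin> S" using \<alpha>(2)[of s] t by force
        then show "vk k s = 0" by (rule vk0)
      qed
      then show ?thesis by (simp add: wk_def)
    qed
    have z2: "wk k t = wk k \<beta>" if "t \<ge> \<beta>" for t
    proof -
      have "integral {a..\<beta>} (vk k) + integral {\<beta>..t} (vk k) = integral {a..t} (vk k)"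
        using S \<beta> that by (intro Henstock_Kurzweil_Integration.integral_combine vki) auto
      moreover have "integral {\<beta>..t} (vk k) = integral {\<beta>..t} (\<lambda>_. 0)"
        by (rule integral_spike[of "{\<beta>}"]) (use \<beta>(2) in \<open>force intro!: vk0\<close>)+
      ultimately show ?thesis by (simp add: wk_def)
    qed
    have z3: "wk k t = 0" if "t > \<beta>" for t
      using z2[of t] z2[of b] that wkb[of k] S \<beta>(1) by force
    show ?thesis
    proof (rule weak_radial_C1[OF H lb, of "{a<..<b}" "{\<alpha>..\<beta>}"])
      show "{a<..<b} \<subseteq> {0<..}" using a0 by auto
      show "{\<alpha>..\<beta>} \<subseteq> {a<..<b}" "{\<alpha>..\<beta>} \<subseteq> {a<..<b}" using \<alpha>\<beta> by auto
      show "(wk k has_real_derivative vk k t) (at t)" if "t \<in> {a<..<b}" for t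
        unfolding wk_def[abs_def]
        by (rule integral_has_real_derivative_at[OF vki that]) (use vkc[of UNIV k] in \<open>simp add: continuous_on_eq_continuous_at\<close>)
      show "wk k t = 0" if "t \<notin> {\<alpha>..\<beta>}" for t using that z1 z3 by force
      show "vk k t = 0" if "t \<notin> {a<..<b}" for t using that S(3) by (intro vk0) blast
    qed (auto intro: vkc)
  qed
  have vkl: "(\<lambda>k. vk k t) \<longlonglongrightarrow> v t" if "t \<in> J0" for t
  proof -
    have "(\<lambda>k. cut k t * v t - C k * cut k0 t) \<longlonglongrightarrow> 1 * v t - 0 * cut k0 t"
      by (intro tendsto_intros cut_tendsto that Cl)
    then show ?thesis by (simp add: vk_def)
  qed
  have wkc: "continuous_on J0 (wk k)" for k
  proof -
    have "continuous_on {a..b} (wk k)" unfolding wk_def by (intro indefinite_integral_continuous_1 vki)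
    then show ?thesis by (rule continuous_on_subset) auto
  qed
  have wc: "continuous_on J0 w" by (rule continuous_on_subset[OF w(2)]) auto
  have L1: "(\<lambda>k. LINT x:\<Omega>|lebesgue. vk k (\<rho> x) * (\<rho> x * Y x / \<rho> x ^ DIM('a) * \<psi> x)) \<longlonglongrightarrow>
     (LINT x:\<Omega>|lebesgue. v (\<rho> x) * (\<rho> x * Y x / \<rho> x ^ DIM('a) * \<psi> x))"
    by (rule radial_limit[OF vkc vkb v vkl H1_integrable_products(3)[OF H lb]])
  have L2: "(\<lambda>k. LINT x:\<Omega>|lebesgue. wk k (\<rho> x) * (Y x / \<rho> x ^ DIM('a) * ((x - c) \<bullet> H x))) \<longlonglongrightarrow>
     (LINT x:\<Omega>|lebesgue. w (\<rho> x) * (Y x / \<rho> x ^ DIM('a) * ((x - c) \<bullet> H x)))"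
    by (rule radial_limit[OF wkc wkB wc wkl H1_integrable_products(4)[OF H lb]]) auto
  show ?thesis using L1 tendsto_minus[OF L2] unfolding eq by (rule LIMSEQ_unique)
qed

end

context shell
begin

text \<open>Here \<open>p (\<rho> x) Y x\<close> has gradient \<open>radial_grad\<close> off the interface, where
  \<open>p' = w / (\<sigma> t\<^sup>n\<^sup>-\<^sup>1)\<close>.\<close>

definition radial_grad :: "(real \<Rightarrow> real) \<Rightarrow> (real \<Rightarrow> real) \<Rightarrow> ('a \<Rightarrow> real) \<Rightarrow> ('a \<Rightarrow> 'a \<Rightarrow> real) \<Rightarrow> 'a \<Rightarrow> 'a" where
  "radial_grad p w Y DY x = (w (\<rho> x) / (\<sigma> (\<rho> x) * \<rho> x ^ (DIM('a) - 1)) * (Y x / \<rho> x)) *\<^sub>R (x - c)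
     + p (\<rho> x) *\<^sub>R (\<Sum>i\<in>Basis. DY x i *\<^sub>R i)"

lemma continuous_on_Icc_bound:
  assumes "continuous_on {a..b} (f :: real \<Rightarrow> real)"
  obtains B where "B \<ge> 0" "\<And>t. t \<in> {a..b} \<Longrightarrow> \<bar>f t\<bar> \<le> B"
proof -
  have "bounded (f ` {a..b})" by (intro compact_imp_bounded compact_continuous_image assms) auto
  then obtain B where "\<forall>y\<in>f ` {a..b}. norm y \<le> B" unfolding bounded_iff by blast
  then show ?thesis using that[of "max 0 B"] by (simp add: le_max_iff_disj)
qed

lemma isCont_J0_phase_coef: "t \<in> J0 \<Longrightarrow> isCont \<sigma> t" by (intro isCont_phase_coef) auto

lemma continuous_on_J0_phase_coef: "continuous_on J0 \<sigma>"
  by (intro continuous_at_imp_continuous_on ballI isCont_J0_phase_coef)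

lemma set_integrable_radial_mult:
  fixes g :: "'a \<Rightarrow> real" and Q :: "real \<Rightarrow> real"
  assumes "continuous_on J0 Q" "\<And>t. t \<in> {a<..<b} \<Longrightarrow> \<bar>Q t\<bar> \<le> B" "set_integrable lebesgue \<Omega> g"
  shows "set_integrable lebesgue \<Omega> (\<lambda>x. Q (\<rho> x) * g x)"
  by (rule set_integrable_mult_bounded[OF assms(3) measurable_radial[OF assms(1)]])
    (use assms(2) in \<open>auto simp: Omega_iff\<close>)

text \<open>\<sigma> grad (p Y) splits into a radial field with coefficient \<open>w\<close> and a
  tangential one with coefficient \<sigma> p. The first needs \<open>w\<close> continuous and zero
  at the ends, the second tolerates the jump. Adding the two weak identities leaves \<Lambda>
  \<sigma> p / t^2 - w' / t^(n-1), where w' is the derivative of \<open>w\<close>; by the equation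
  this is \<open>h\<close>.\<close>

lemma green_identity:
  assumes H: "H1_on \<Omega> \<psi> H" and lb: "has_lb c Y DY D2Y (\<lambda>x. - \<Lambda> * Y x)"
    and sol: "radial_sol \<Lambda> h p w" "w a = 0" "w b = 0" and h: "continuous_on {a..b} h"
  shows "(LINT x:\<Omega>|lebesgue. \<sigma> (\<rho> x) * (radial_grad p w Y DY x \<bullet> H x)) = (LINT x:\<Omega>|lebesgue. h (\<rho> x) * (Y x * \<psi> x))"
proof -
  let ?N = "DIM('a)"
  define v where "v t = t ^ (?N - 1) * (\<Lambda> * \<sigma> t / t\<^sup>2 * p t - h t)" for t
  have sub: "J0 \<subseteq> {a..b}" by auto
  have pc: "continuous_on {a..b} p" and wc: "continuous_on {a..b} w" using sol by (auto simp: radial_sol_def)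
  have pJ: "continuous_on J0 p" and wJ: "continuous_on J0 w" and hJ: "continuous_on J0 h"
    using continuous_on_subset[OF pc sub] continuous_on_subset[OF wc sub] continuous_on_subset[OF h sub] by auto
  have nz: "t \<noteq> 0" if "t \<in> J0" for t using that a0 by auto
  obtain Bp where Bp: "Bp \<ge> 0" "\<And>t. t \<in> {a..b} \<Longrightarrow> \<bar>p t\<bar> \<le> Bp" using continuous_on_Icc_bound[OF pc] by blast
  obtain Bh where Bh: "Bh \<ge> 0" "\<And>t. t \<in> {a..b} \<Longrightarrow> \<bar>h t\<bar> \<le> Bh" using continuous_on_Icc_bound[OF h] by blast
  have qB: "\<bar>\<sigma> t * p t\<bar> \<le> (sm + sp) * Bp" if "t \<in> {a<..<b}" for t
    unfolding abs_mult using that Bp phase_coef_le[of t] phase_coef_pos[of t] by (intro mult_mono) auto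
  have q': "((\<lambda>t. \<sigma> t * p t) has_real_derivative w t / t ^ (?N - 1)) (at t)" if t: "t \<in> J0" for t
  proof -
    define S where "S = (if t > r then {r<..} else {..<r})"
    have S: "open S" "t \<in> S" "\<And>s. s \<in> S \<Longrightarrow> \<sigma> s = \<sigma> t" using t by (auto simp: S_def phase_coef_def)
    have "((\<lambda>s. \<sigma> t * p s) has_real_derivative \<sigma> t * (w t / (\<sigma> t * t ^ (?N - 1)))) (at t)"
      using sol t by (intro DERIV_cmult) (auto simp: radial_sol_def)
    then have "((\<lambda>s. \<sigma> s * p s) has_real_derivative \<sigma> t * (w t / (\<sigma> t * t ^ (?N - 1)))) (at t)"
      by (rule has_field_derivative_transform_within_open[OF _ S(1,2)]) (simp add: S(3))
    moreover have "\<sigma> t * (w t / (\<sigma> t * t ^ (?N - 1))) = w t / t ^ (?N - 1)"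
      using phase_coef_pos[of t] by simp
    ultimately show ?thesis by simp
  qed
  have q'c: "continuous_on J0 (\<lambda>t. w t / t ^ (?N - 1))" by (intro continuous_intros wJ) (use nz in auto)
  have tang: "(LINT x:\<Omega>|lebesgue. (\<sigma> (\<rho> x) * p (\<rho> x)) * (\<Lambda> / (\<rho> x)\<^sup>2 * Y x * \<psi> x)) =
    (LINT x:\<Omega>|lebesgue. (\<sigma> (\<rho> x) * p (\<rho> x)) * (\<Sum>i\<in>Basis. DY x i * (H x \<bullet> i)))"
    by (rule weak_tangential[OF H lb q' q'c qB])
  have vc: "continuous_on J0 v" unfolding v_def[abs_def]
    by (intro continuous_intros continuous_on_J0_phase_coef pJ hJ) (use nz in auto)
  define Bv where "Bv = b ^ (?N - 1) * (\<bar>\<Lambda>\<bar> * (sm + sp) / a\<^sup>2 * Bp + Bh)"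
  have vB: "\<bar>v t\<bar> \<le> Bv" if t: "t \<in> {a<..<b}" for t
  proof -
    have "\<bar>\<Lambda> * \<sigma> t / t\<^sup>2\<bar> = \<bar>\<Lambda>\<bar> * \<sigma> t / t\<^sup>2" using phase_coef_pos[of t] by (simp add: abs_mult)
    also have "\<dots> \<le> \<bar>\<Lambda>\<bar> * (sm + sp) / a\<^sup>2"
      using t a0 phase_coef_le phase_coef_pos sm0 sp0 by (intro frac_le mult_left_mono power_mono) auto
    finally have "\<bar>\<Lambda> * \<sigma> t / t\<^sup>2 * p t\<bar> \<le> \<bar>\<Lambda>\<bar> * (sm + sp) / a\<^sup>2 * Bp"
      unfolding abs_mult[of _ "p t"] using Bp t sm0 sp0 by (intro mult_mono) auto
    then have "\<bar>\<Lambda> * \<sigma> t / t\<^sup>2 * p t - h t\<bar> \<le> \<bar>\<Lambda>\<bar> * (sm + sp) / a\<^sup>2 * Bp + Bh"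
      using Bh(2)[of t] t abs_triangle_ineq4[of "\<Lambda> * \<sigma> t / t\<^sup>2 * p t" "h t"] by auto
    then show ?thesis unfolding v_def Bv_def abs_mult[of "t ^ _"]
      using t a0 by (intro mult_mono) (auto simp: power_mono)
  qed
  have rad: "(LINT x:\<Omega>|lebesgue. v (\<rho> x) * (\<rho> x * Y x / \<rho> x ^ ?N * \<psi> x)) =
    - (LINT x:\<Omega>|lebesgue. w (\<rho> x) * (Y x / \<rho> x ^ ?N * ((x - c) \<bullet> H x)))"
    by (rule weak_radial[OF H lb _ wc sol(2,3) vc vB]) (use sol in \<open>auto simp: radial_sol_def v_def\<close>)
  obtain Bw where Bw: "Bw \<ge> 0" "\<And>t. t \<in> {a..b} \<Longrightarrow> \<bar>w t\<bar> \<le> Bw" using continuous_on_Icc_bound[OF wc] by blast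
  have qJ: "continuous_on J0 (\<lambda>t. \<sigma> t * p t)" by (intro continuous_intros continuous_on_J0_phase_coef pJ)
  have wB: "\<bar>w t\<bar> \<le> Bw" if "t \<in> {a<..<b}" for t using Bw(2)[of t] that by auto
  note prods = H1_integrable_products[OF H lb]
  note i1 = set_integrable_radial_mult[OF qJ qB prods(1)[of \<Lambda>]] and i2 = set_integrable_radial_mult[OF qJ qB prods(2)]
    and i3 = set_integrable_radial_mult[OF vc vB prods(3)] and i4 = set_integrable_radial_mult[OF wJ wB prods(4)]
  have I1: "set_integrable lebesgue \<Omega> (\<lambda>x. (\<sigma> (\<rho> x) * p (\<rho> x)) * (\<Lambda> / (\<rho> x)\<^sup>2 * Y x * \<psi> x))" by (rule i1)
  have I2: "set_integrable lebesgue \<Omega> (\<lambda>x. (\<sigma> (\<rho> x) * p (\<rho> x)) * (\<Sum>i\<in>Basis. DY x i * (H x \<bullet> i)))" by (rule i2)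
  have I3: "set_integrable lebesgue \<Omega> (\<lambda>x. v (\<rho> x) * (\<rho> x * Y x / \<rho> x ^ ?N * \<psi> x))" by (rule i3)
  have I4: "set_integrable lebesgue \<Omega> (\<lambda>x. w (\<rho> x) * (Y x / \<rho> x ^ ?N * ((x - c) \<bullet> H x)))" by (rule i4)
  have Npow: "\<rho> x ^ ?N = \<rho> x ^ (?N - 1) * \<rho> x" for x
    using power_Suc2[of "\<rho> x" "?N - 1"] DIM_positive[where 'a = 'a] by simp
  have "(LINT x:\<Omega>|lebesgue. \<sigma> (\<rho> x) * (radial_grad p w Y DY x \<bullet> H x)) =
    (LINT x:\<Omega>|lebesgue. w (\<rho> x) * (Y x / \<rho> x ^ ?N * ((x - c) \<bullet> H x)) + (\<sigma> (\<rho> x) * p (\<rho> x)) * (\<Sum>i\<in>Basis. DY x i * (H x \<bullet> i)))"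
  proof (rule set_integral_cong_Omega)
    fix x assume x: "x \<in> \<Omega>"
    have "(\<Sum>i\<in>Basis. DY x i *\<^sub>R i) \<bullet> H x = (\<Sum>i\<in>Basis. DY x i * (H x \<bullet> i))"
      by (simp add: inner_sum_left inner_commute[of "H x"])
    then have "\<sigma> (\<rho> x) * (radial_grad p w Y DY x \<bullet> H x)
      = \<sigma> (\<rho> x) * (w (\<rho> x) / (\<sigma> (\<rho> x) * \<rho> x ^ (?N - 1)) * (Y x / \<rho> x)) * ((x - c) \<bullet> H x)
        + (\<sigma> (\<rho> x) * p (\<rho> x)) * (\<Sum>i\<in>Basis. DY x i * (H x \<bullet> i))"
      unfolding radial_grad_def inner_add_left inner_scaleR_left by (simp only: distrib_left mult.assoc)
    also have "\<sigma> (\<rho> x) * (w (\<rho> x) / (\<sigma> (\<rho> x) * \<rho> x ^ (?N - 1)) * (Y x / \<rho> x)) = w (\<rho> x) * (Y x / \<rho> x ^ ?N)"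
      using phase_coef_pos[of "\<rho> x"] unfolding Npow by simp
    finally show "\<sigma> (\<rho> x) * (radial_grad p w Y DY x \<bullet> H x) = w (\<rho> x) * (Y x / \<rho> x ^ ?N * ((x - c) \<bullet> H x))
        + (\<sigma> (\<rho> x) * p (\<rho> x)) * (\<Sum>i\<in>Basis. DY x i * (H x \<bullet> i))" by (simp only: mult.assoc)
  qed
  also have "\<dots> = (LINT x:\<Omega>|lebesgue. w (\<rho> x) * (Y x / \<rho> x ^ ?N * ((x - c) \<bullet> H x)))
     + (LINT x:\<Omega>|lebesgue. (\<sigma> (\<rho> x) * p (\<rho> x)) * (\<Sum>i\<in>Basis. DY x i * (H x \<bullet> i)))"
    by (rule set_integral_add(2)[OF I4 I2])
  also have "\<dots> = (LINT x:\<Omega>|lebesgue. (\<sigma> (\<rho> x) * p (\<rho> x)) * (\<Lambda> / (\<rho> x)\<^sup>2 * Y x * \<psi> x))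
     - (LINT x:\<Omega>|lebesgue. v (\<rho> x) * (\<rho> x * Y x / \<rho> x ^ ?N * \<psi> x))"
    using tang rad by simp
  also have "\<dots> = (LINT x:\<Omega>|lebesgue. (\<sigma> (\<rho> x) * p (\<rho> x)) * (\<Lambda> / (\<rho> x)\<^sup>2 * Y x * \<psi> x)
      - v (\<rho> x) * (\<rho> x * Y x / \<rho> x ^ ?N * \<psi> x))"
    by (rule set_integral_diff(2)[OF I1 I3, symmetric])
  also have "\<dots> = (LINT x:\<Omega>|lebesgue. h (\<rho> x) * (Y x * \<psi> x))"
  proof (rule set_integral_cong_Omega)
    fix x assume x: "x \<in> \<Omega>"
    have pos: "\<rho> x > 0" by (rule rho_pos[OF x])
    have "v (\<rho> x) * (\<rho> x * Y x / \<rho> x ^ ?N * \<psi> x) = (\<Lambda> * \<sigma> (\<rho> x) / (\<rho> x)\<^sup>2 * p (\<rho> x) - h (\<rho> x)) * (Y x * \<psi> x)"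
      unfolding v_def Npow using pos by simp
    then show "(\<sigma> (\<rho> x) * p (\<rho> x)) * (\<Lambda> / (\<rho> x)\<^sup>2 * Y x * \<psi> x) - v (\<rho> x) * (\<rho> x * Y x / \<rho> x ^ ?N * \<psi> x) = h (\<rho> x) * (Y x * \<psi> x)"
      by (simp add: algebra_simps)
  qed
  finally show ?thesis .
qed

end

section \<open>Membership of the products p Y in the Sobolev space\<close>

lemma integral_translation_lborel:
  fixes u :: "'a::euclidean_space \<Rightarrow> real"
  assumes "u \<in> borel_measurable borel"
  shows "integral\<^sup>L lborel (\<lambda>x. u (v + x)) = integral\<^sup>L lborel u"
proof -
  have "integral\<^sup>L (distr lborel borel ((+) v)) u = integral\<^sup>L lborel (\<lambda>x. u (v + x))"
    by (rule integral_distr) (use assms in auto)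
  then show ?thesis by (simp add: lborel_distr_plus)
qed

text \<open>Translation invariance makes every difference quotient integrate to \<open>0\<close>.\<close>

lemma integral_directional_derivative_zero:
  fixes u g :: "'a::euclidean_space \<Rightarrow> real" and v :: 'a
  assumes lip: "\<And>x y. \<bar>u x - u y\<bar> \<le> L * norm (x - y)" and supp: "\<And>x. R < norm x \<Longrightarrow> u x = 0"
    and g: "g \<in> borel_measurable lebesgue"
    and d: "AE x in lebesgue. ((\<lambda>t. u (x + t *\<^sub>R v)) has_real_derivative g x) (at 0)"
  shows "integral\<^sup>L lebesgue g = 0"
proof -
  define q where "q k x = (u (x + inverse (real (Suc k)) *\<^sub>R v) - u x) / inverse (real (Suc k))" for k x
  have L: "L \<ge> 0"
  proof -
    obtain i :: 'a where "i \<in> Basis" using nonempty_Basis by blast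
    then show ?thesis using lip[of i 0] abs_ge_zero[of "u i - u 0"] by simp
  qed
  have cu: "continuous_on UNIV u"
    by (rule lipschitz_on_continuous_on[of L]) (use lip L in \<open>auto simp: lipschitz_on_def dist_real_def dist_norm\<close>)
  have mu: "u \<in> borel_measurable borel" by (rule borel_measurable_continuous_onI[OF cu])
  have mq: "q k \<in> borel_measurable borel" for k
    unfolding q_def by (intro borel_measurable_continuous_onI continuous_intros continuous_on_compose2[OF cu]) auto
  have iu: "integrable lborel (\<lambda>x. u (x + w))" for w
  proof -
    have "integrable lborel (\<lambda>x. indicat_real (cball 0 (R + norm w)) x *\<^sub>R u (x + w))"
      by (rule borel_integrable_compact) (auto intro!: continuous_intros continuous_on_compose2[OF cu])
    moreover have "(\<lambda>x. indicat_real (cball 0 (R + norm w)) x *\<^sub>R u (x + w)) = (\<lambda>x. u (x + w))"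
    proof (rule ext, goal_cases)
      case (1 x)
      show ?case
      proof (cases "x \<in> cball 0 (R + norm w)")
      case False
      then have "R < norm (x + w)" using norm_diff_ineq[of x w] by simp
      then show ?thesis using supp by simp
      qed simp
    qed
    ultimately show ?thesis by (simp only:)
  qed
  have q0: "integral\<^sup>L lebesgue (q k) = 0" for k
  proof -
    have "integral\<^sup>L lebesgue (q k) = integral\<^sup>L lborel (q k)"
      by (rule integral_completion) (use mq in simp)
    also have "\<dots> = (integral\<^sup>L lborel (\<lambda>x. u (x + inverse (real (Suc k)) *\<^sub>R v)) - integral\<^sup>L lborel u) / inverse (real (Suc k))"
      unfolding q_def using iu[of "inverse (real (Suc k)) *\<^sub>R v"] iu[of 0] by simp
    also have "integral\<^sup>L lborel (\<lambda>x. u (x + inverse (real (Suc k)) *\<^sub>R v)) = integral\<^sup>L lborel u"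
      using integral_translation_lborel[OF mu, of "inverse (real (Suc k)) *\<^sub>R v"] by (simp add: add.commute)
    finally show ?thesis by simp
  qed
  \<comment> \<open>The step lengths are at most 1, so all quotients live in one ball, enlarged by
    the length of \<open>v\<close>, and are bounded by the Lipschitz constant.\<close>
  define W where "W x = L * norm v * indicat_real (cball 0 (R + norm v)) x" for x :: 'a
  have "(\<lambda>k. integral\<^sup>L lebesgue (q k)) \<longlonglongrightarrow> integral\<^sup>L lebesgue g"
  proof (rule integral_dominated_convergence[where w = W])
    show "g \<in> borel_measurable lebesgue" by (rule g)
    show "q k \<in> borel_measurable lebesgue" for k using mq[of k] by (simp add: measurable_completion)
    have "integrable lebesgue (indicat_real (cball (0::'a) (R + norm v)))"
      using lmeasurable_cball[of "0::'a" "R + norm v"] unfolding lmeasurable_iff_integrable .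
    then show "integrable lebesgue W" unfolding W_def by (rule integrable_mult_right)
    show "AE x in lebesgue. (\<lambda>k. q k x) \<longlonglongrightarrow> g x"
      using d
    proof eventually_elim
      case (elim x)
      then have "((\<lambda>h. (u (x + h *\<^sub>R v) - u x) / h) \<longlongrightarrow> g x) (at 0)" by (simp add: has_field_derivative_iff)
      moreover have "filterlim (\<lambda>k. inverse (real (Suc k))) (at 0) sequentially"
        using LIMSEQ_inverse_real_of_nat by (auto simp: filterlim_at)
      ultimately show ?case unfolding q_def by (rule filterlim_compose)
    qed
    fix k
    show "AE x in lebesgue. norm (q k x) \<le> W x"
    proof (rule AE_I2)
      fix x :: 'a
      let ?h = "inverse (real (Suc k))"
      have h: "0 < ?h" "?h \<le> 1" by (auto simp: inverse_le_1_iff)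
      have "\<bar>u (x + ?h *\<^sub>R v) - u x\<bar> \<le> L * norm (?h *\<^sub>R v)" using lip[of "x + ?h *\<^sub>R v" x] by simp
      also have "norm (?h *\<^sub>R v) = norm v * ?h" using h by simp
      finally have 1: "norm (q k x) \<le> L * norm v"
        unfolding q_def using h by (simp only: real_norm_def abs_divide abs_of_pos pos_divide_le_eq mult.assoc)
      show "norm (q k x) \<le> W x"
      proof (cases "x \<in> cball 0 (R + norm v)")
        case True
        then show ?thesis using 1 by (simp add: W_def)
      next
        case False
        have "norm (?h *\<^sub>R v) \<le> 1 * norm v" unfolding norm_scaleR using h by (intro mult_right_mono) auto
        moreover have "R + norm v < norm x" using False by simp
        ultimately have "R < norm (x + ?h *\<^sub>R v)" "R < norm x"
          using norm_diff_ineq[of x "?h *\<^sub>R v"] norm_ge_zero[of v] by linarith+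
        then show ?thesis using supp L by (simp add: q_def W_def indicator_def)
      qed
    qed
  qed
  then show ?thesis using q0 by (simp add: LIMSEQ_const_iff)
qed

lemma test_fun_lipschitz:
  fixes \<phi> :: "'a::euclidean_space \<Rightarrow> real"
  assumes "test_fun U \<phi>"
  obtains L B where "L \<ge> 0" "\<And>x y. \<bar>\<phi> x - \<phi> y\<bar> \<le> L * norm (x - y)" "\<And>x. \<bar>\<phi> x\<bar> \<le> B"
proof -
  define K where "K = closure {x. \<phi> x \<noteq> 0}"
  have K: "compact K" using assms by (simp add: test_fun_def K_def)
  have zero: "\<phi> x = 0" if "x \<notin> K" for x using that closure_subset[of "{x. \<phi> x \<noteq> 0}"] by (auto simp: K_def)
  define D where "D x = frechet_derivative \<phi> (at x)" for x
  have D: "(\<phi> has_derivative D x) (at x)" "continuous_on UNIV (\<lambda>x. D x v)" for x v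
    using test_fun_derivative[OF assms] by (auto simp: D_def)
  have D0: "D x v = 0" if "x \<notin> K" for x v
  proof -
    have "(\<phi> has_derivative (\<lambda>v. 0)) (at x)"
      by (rule has_derivative_transform_within_open[OF has_derivative_const[of 0], of "- K"])
        (use that K zero in \<open>auto intro!: open_Compl compact_imp_closed\<close>)
    then show ?thesis using has_derivative_unique[OF D(1)] by metis
  qed
  have "\<forall>v. \<exists>B. \<forall>x. \<bar>D x v\<bar> \<le> B"
  proof
    fix v
    have "bounded ((\<lambda>x. D x v) ` K)"
      by (intro compact_imp_bounded compact_continuous_image K continuous_on_subset[OF D(2)]) auto
    then obtain B where B: "\<forall>y\<in>(\<lambda>x. D x v) ` K. norm y \<le> B" unfolding bounded_iff by blast
    have "\<bar>D x v\<bar> \<le> max 0 B" for x using B D0[of x v] by (cases "x \<in> K") (auto simp: le_max_iff_disj)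
    then show "\<exists>B. \<forall>x. \<bar>D x v\<bar> \<le> B" by blast
  qed
  then obtain Bd where Bd: "\<And>v x. \<bar>D x v\<bar> \<le> Bd v" by metis
  have Bd0: "Bd v \<ge> 0" for v using Bd[of undefined v] by linarith
  define L where "L = (\<Sum>i\<in>(Basis :: 'a set). Bd i)"
  have L0: "L \<ge> 0" unfolding L_def by (intro sum_nonneg Bd0)
  have on: "onorm (D x) \<le> L" for x
  proof (rule onorm_bound[OF L0])
    fix v
    have "\<bar>D x v\<bar> = \<bar>\<Sum>i\<in>Basis. (v \<bullet> i) * D x i\<bar>"
      using sum_Basis_linear[OF has_derivative_linear[OF D(1)], of v] by simp
    also have "\<dots> \<le> (\<Sum>i\<in>Basis. \<bar>(v \<bullet> i) * D x i\<bar>)" by (rule sum_abs)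
    also have "\<dots> \<le> (\<Sum>i\<in>Basis. norm v * Bd i)"
      unfolding abs_mult by (intro sum_mono mult_mono Basis_le_norm Bd) auto
    finally show "norm (D x v) \<le> L * norm v"
      unfolding L_def sum_distrib_left[symmetric] by (simp add: mult.commute)
  qed
  have lip: "\<bar>\<phi> x - \<phi> y\<bar> \<le> L * norm (x - y)" for x y
    using differentiable_bound[of UNIV \<phi> D L x y] D(1) on by auto
  have "continuous_on K \<phi>"
    using D(1) by (intro continuous_at_imp_continuous_on ballI) (blast intro: has_derivative_continuous)
  then have "bounded (\<phi> ` K)" by (intro compact_imp_bounded compact_continuous_image K)
  then obtain B where B: "\<forall>y\<in>\<phi> ` K. norm y \<le> B" unfolding bounded_iff by blast
  have "\<bar>\<phi> x\<bar> \<le> max 0 B" for x using B zero[of x] by (cases "x \<in> K") (auto simp: le_max_iff_disj)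
  then show ?thesis using that L0 lip by blast
qed

lemma DERIV_along_line:
  assumes "(u has_derivative D) (at (x :: 'a::real_normed_vector))"
  shows "((\<lambda>t. u (x + t *\<^sub>R v)) has_real_derivative D v) (at 0)"
proof -
  have "((\<lambda>t. x + t *\<^sub>R v) has_derivative (\<lambda>t. t *\<^sub>R v)) (at (0::real))"
    by (auto intro!: derivative_eq_intros)
  from has_derivative_compose[OF this, of u D] have "((\<lambda>t. u (x + t *\<^sub>R v)) has_derivative (\<lambda>t. D (t *\<^sub>R v))) (at 0)"
    using assms by simp
  then show ?thesis
    using linear_scale[OF has_derivative_linear[OF assms]] by (simp add: has_field_derivative_def mult_commute_abs)
qed

context shell
begin

text \<open>The slope may jump at \<open>r\<close> but stays bounded, so \<open>p\<close> is
  Lipschitz through the interface; this is what the translation argument requires.\<close>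

lemma radial_sol_slope_bound:
  assumes sol: "radial_sol \<Lambda> h p w"
  obtains C where "C \<ge> 0" "\<And>t. t \<in> {a..b} \<Longrightarrow> \<bar>w t / (\<sigma> t * t ^ (DIM('a) - 1))\<bar> \<le> C"
    "\<And>s t. s \<in> {a..b} \<Longrightarrow> t \<in> {a..b} \<Longrightarrow> \<bar>p s - p t\<bar> \<le> C * \<bar>s - t\<bar>"
proof -
  let ?N = "DIM('a)"
  have wc: "continuous_on {a..b} w" and pc: "continuous_on {a..b} p" using sol by (auto simp: radial_sol_def)
  obtain Bw where Bw: "Bw \<ge> 0" "\<And>t. t \<in> {a..b} \<Longrightarrow> \<bar>w t\<bar> \<le> Bw" using continuous_on_Icc_bound[OF wc] by blast
  define C where "C = Bw / (min sm sp * a ^ (?N - 1))"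
  have den: "0 < min sm sp * a ^ (?N - 1)" using a0 sm0 sp0 by auto
  then have C0: "C \<ge> 0" using Bw by (simp add: C_def)
  have slope: "\<bar>w t / (\<sigma> t * t ^ (?N - 1))\<bar> \<le> C" if t: "t \<in> {a..b}" for t
  proof -
    have "min sm sp * a ^ (?N - 1) \<le> \<sigma> t * t ^ (?N - 1)"
      using t a0 sm0 sp0 phase_coef_pos[of t] by (intro mult_mono power_mono phase_coef_ge) auto
    moreover have "0 < \<sigma> t * t ^ (?N - 1)" using t a0 phase_coef_pos[of t] by auto
    ultimately have "\<bar>w t\<bar> / (\<sigma> t * t ^ (?N - 1)) \<le> C"
      unfolding C_def using Bw t den by (intro frac_le) auto
    then show ?thesis using \<open>0 < \<sigma> t * t ^ (?N - 1)\<close> by simp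
  qed
  have le: "\<bar>p t - p s\<bar> \<le> C * \<bar>t - s\<bar>" if st: "s \<in> {a..b}" "t \<in> {a..b}" "s \<le> t" for s t
  proof -
    have "((\<lambda>t. w t / (\<sigma> t * t ^ (?N - 1))) has_integral (p t - p s)) {s..t}"
    proof (rule fundamental_theorem_of_calculus_interior_strong[of "{r}"])
      show "continuous_on {s..t} p" using st by (intro continuous_on_subset[OF pc]) auto
    qed (use sol st in \<open>auto simp: radial_sol_def has_real_derivative_iff_has_vector_derivative\<close>)
    from has_integral_Icc_bound[OF this C0] slope st have "norm (p t - p s) \<le> C * measure lborel {s..t}" by force
    then show ?thesis using st by simp
  qed
  have "\<bar>p s - p t\<bar> \<le> C * \<bar>s - t\<bar>" if "s \<in> {a..b}" "t \<in> {a..b}" for s t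
    using le[of s t] le[of t s] that by (cases "s \<le> t") (auto simp: abs_minus_commute)
  then show ?thesis using that C0 slope by blast
qed

text \<open>p(\<rho>) \<phi> is Lipschitz with compact support and obeys the product rule off the
  interface. Its directional derivative therefore integrates to 0, which is the integration by
  parts.\<close>

lemma radial_weak_gradient:
  assumes sol: "radial_sol \<Lambda> h p w" and \<phi>: "test_fun \<Omega> \<phi>"
  shows "(LINT x:\<Omega>|lebesgue. p (\<rho> x) * frechet_derivative \<phi> (at x) v) =
    - (LINT x:\<Omega>|lebesgue. w (\<rho> x) / (\<sigma> (\<rho> x) * \<rho> x ^ (DIM('a) - 1)) * ((x - c) \<bullet> v / \<rho> x * \<phi> x))"
    (is "?L = - ?R")
    and "set_integrable lebesgue \<Omega> (\<lambda>x. p (\<rho> x) * frechet_derivative \<phi> (at x) v)"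
    and "set_integrable lebesgue \<Omega> (\<lambda>x. w (\<rho> x) / (\<sigma> (\<rho> x) * \<rho> x ^ (DIM('a) - 1)) * ((x - c) \<bullet> v / \<rho> x * \<phi> x))"
proof -
  let ?N = "DIM('a)"
  define s where "s t = w t / (\<sigma> t * t ^ (?N - 1))" for t
  define D where "D x = frechet_derivative \<phi> (at x)" for x
  have D: "(\<phi> has_derivative D x) (at x)" "continuous_on UNIV (\<lambda>x. D x v)" for x v
    using test_fun_derivative[OF \<phi>] by (auto simp: D_def)
  define K where "K = closure {x. \<phi> x \<noteq> 0}"
  have K: "compact K" "K \<subseteq> \<Omega>" using \<phi> by (auto simp: test_fun_def K_def)
  have zero: "\<phi> x = 0" if "x \<notin> K" for x using that closure_subset[of "{x. \<phi> x \<noteq> 0}"] by (auto simp: K_def)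
  have wc: "continuous_on {a..b} w" and pc: "continuous_on {a..b} p" using sol by (auto simp: radial_sol_def)
  have sub: "J0 \<subseteq> {a..b}" by auto
  have pJ: "continuous_on J0 p" and wJ: "continuous_on J0 w"
    using continuous_on_subset[OF pc sub] continuous_on_subset[OF wc sub] by auto
  have nz: "\<sigma> t * t ^ (?N - 1) \<noteq> 0" if "t \<in> J0" for t using that a0 phase_coef_pos[of t] by auto
  have sJ: "continuous_on J0 s" unfolding s_def[abs_def]
    by (intro continuous_intros wJ continuous_on_J0_phase_coef) (use nz in auto)
  obtain C where C: "C \<ge> 0" "\<And>t. t \<in> {a..b} \<Longrightarrow> \<bar>s t\<bar> \<le> C"
    "\<And>s t. s \<in> {a..b} \<Longrightarrow> t \<in> {a..b} \<Longrightarrow> \<bar>p s - p t\<bar> \<le> C * \<bar>s - t\<bar>"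
    using radial_sol_slope_bound[OF sol] unfolding s_def by blast
  obtain Bp where Bp: "Bp \<ge> 0" "\<And>t. t \<in> {a..b} \<Longrightarrow> \<bar>p t\<bar> \<le> Bp" using continuous_on_Icc_bound[OF pc] by blast
  have c\<phi>: "continuous_on S \<phi>" for S
    using D(1) by (intro continuous_at_imp_continuous_on ballI) (blast intro: has_derivative_continuous)
  have "set_integrable lebesgue \<Omega> (\<lambda>x. ((x - c) \<bullet> v / \<rho> x * \<phi> x) * 1)"
    by (intro set_integrable_off_center_mult set_integrable_const continuous_intros c\<phi>) auto
  then have i2: "set_integrable lebesgue \<Omega> (\<lambda>x. (x - c) \<bullet> v / \<rho> x * \<phi> x)" by (simp only: mult_1_right)
  have I2: "set_integrable lebesgue \<Omega> (\<lambda>x. s (\<rho> x) * ((x - c) \<bullet> v / \<rho> x * \<phi> x))"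
    by (rule set_integrable_radial_mult[OF sJ _ i2, of C]) (use C(2) in auto)
  have "set_integrable lebesgue \<Omega> (\<lambda>x. D x v * 1)"
    by (intro set_integrable_off_center_mult set_integrable_const continuous_on_subset[OF D(2)]) auto
  then have i1: "set_integrable lebesgue \<Omega> (\<lambda>x. D x v)" by (simp only: mult_1_right)
  have I1: "set_integrable lebesgue \<Omega> (\<lambda>x. p (\<rho> x) * D x v)"
    by (rule set_integrable_radial_mult[OF pJ _ i1, of Bp]) (use Bp(2) in auto)
  show "set_integrable lebesgue \<Omega> (\<lambda>x. p (\<rho> x) * frechet_derivative \<phi> (at x) v)"
    "set_integrable lebesgue \<Omega> (\<lambda>x. w (\<rho> x) / (\<sigma> (\<rho> x) * \<rho> x ^ (DIM('a) - 1)) * ((x - c) \<bullet> v / \<rho> x * \<phi> x))"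
    using I1 I2 by (auto simp: D_def s_def)
  \<comment> \<open>\<open>p\<close> is controlled on \<open>{a..b}\<close> only. Clamping the
    radius gives a Lipschitz function on the whole space and changes nothing in the shell, outside
    of which \<phi> vanishes.\<close>
  define cl where "cl t = max a (min b t)" for t
  have cl: "cl t \<in> {a..b}" for t using ab by (auto simp: cl_def)
  have cllip: "\<bar>cl x - cl y\<bar> \<le> \<bar>x - y\<bar>" for x y by (auto simp: cl_def)
  define u where "u x = p (cl (\<rho> x)) * \<phi> x" for x
  define g where "g x = indicat_real \<Omega> x *\<^sub>R (s (\<rho> x) * ((x - c) \<bullet> v / \<rho> x * \<phi> x) + p (\<rho> x) * D x v)" for x
  obtain L B where LB: "L \<ge> 0" "\<And>x y. \<bar>\<phi> x - \<phi> y\<bar> \<le> L * norm (x - y)" "\<And>x. \<bar>\<phi> x\<bar> \<le> B"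
    using test_fun_lipschitz[OF \<phi>] by blast
  have gi: "integrable lebesgue g"
    using set_integral_add(1)[OF I2 I1] by (simp add: g_def[abs_def] set_integrable_def)
  have "integral\<^sup>L lebesgue g = 0"
  proof (rule integral_directional_derivative_zero[where u = u and v = v and L = "Bp * L + C * B" and R = "norm c + b"])
    show "g \<in> borel_measurable lebesgue" using gi by auto
    fix x y
    have "\<bar>p (cl (\<rho> x)) - p (cl (\<rho> y))\<bar> \<le> C * \<bar>cl (\<rho> x) - cl (\<rho> y)\<bar>" by (rule C(3)) (rule cl)+
    also have "\<dots> \<le> C * norm (x - y)"
    proof (rule mult_left_mono[OF _ C(1)])
      have "\<bar>\<rho> x - \<rho> y\<bar> \<le> norm ((x - c) - (y - c))" by (rule norm_triangle_ineq3)
      then show "\<bar>cl (\<rho> x) - cl (\<rho> y)\<bar> \<le> norm (x - y)" using cllip[of "\<rho> x" "\<rho> y"] by simp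
    qed
    finally have "\<bar>(p (cl (\<rho> x)) - p (cl (\<rho> y))) * \<phi> y\<bar> \<le> C * norm (x - y) * B"
      unfolding abs_mult using LB(3)[of y] C(1) by (intro mult_mono) auto
    moreover have "\<bar>p (cl (\<rho> x)) * (\<phi> x - \<phi> y)\<bar> \<le> Bp * (L * norm (x - y))"
      unfolding abs_mult using Bp(2)[OF cl] LB(2)[of x y] Bp(1) by (intro mult_mono) auto
    moreover have "u x - u y = p (cl (\<rho> x)) * (\<phi> x - \<phi> y) + (p (cl (\<rho> x)) - p (cl (\<rho> y))) * \<phi> y"
      by (simp add: u_def algebra_simps)
    moreover have "Bp * (L * norm (x - y)) + C * norm (x - y) * B = (Bp * L + C * B) * norm (x - y)"
      by (simp add: algebra_simps)
    ultimately show "\<bar>u x - u y\<bar> \<le> (Bp * L + C * B) * norm (x - y)"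
      using abs_triangle_ineq[of "p (cl (\<rho> x)) * (\<phi> x - \<phi> y)" "(p (cl (\<rho> x)) - p (cl (\<rho> y))) * \<phi> y"] by linarith
  next
    fix x :: 'a assume "norm c + b < norm x"
    then have "\<rho> x > b" using norm_triangle_ineq2[of x c] by linarith
    then have "x \<notin> \<Omega>" by (simp add: Omega_iff)
    then show "u x = 0" using zero[of x] K by (auto simp: u_def)
  next
    have d: "((\<lambda>t. u (x + t *\<^sub>R v)) has_real_derivative g x) (at 0)" if x: "x \<notin> sphere c r" for x
    proof (cases "x \<in> \<Omega>")
      case True
      then have t: "\<rho> x \<in> J0" using x unfolding mem_shell_iff by (auto simp: Omega_iff)
      have xc: "x \<noteq> c" using True center_notin by blast
      have "(p has_real_derivative s (\<rho> x)) (at (\<rho> x))" using sol t by (simp add: radial_sol_def s_def)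
      then have "((\<lambda>t. p (cl t)) has_real_derivative s (\<rho> x)) (at (\<rho> x))"
        by (rule has_field_derivative_transform_within_open[of _ _ _ "{a<..<b}"]) (use t in \<open>auto simp: cl_def\<close>)
      then have "((\<lambda>x. p (cl (\<rho> x))) has_derivative (\<lambda>v. s (\<rho> x) * ((x - c) \<bullet> v / \<rho> x))) (at x)"
        using has_derivative_compose[OF rho_has_derivative[OF xc]] unfolding has_field_derivative_def by blast
      from has_derivative_mult[OF this D(1)]
      have "(u has_derivative (\<lambda>v. p (cl (\<rho> x)) * D x v + s (\<rho> x) * ((x - c) \<bullet> v / \<rho> x) * \<phi> x)) (at x)"
        by (simp add: u_def[abs_def])
      from DERIV_along_line[OF this, of v] show ?thesis
        using True t by (simp add: g_def cl_def mult.assoc add.commute)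
    next
      case False
      have "(u has_derivative (\<lambda>v. 0)) (at x)"
        by (rule has_derivative_transform_within_open[OF has_derivative_const[of 0], of "- K"])
          (use False K zero in \<open>auto intro!: open_Compl compact_imp_closed simp: u_def\<close>)
      from DERIV_along_line[OF this, of v] show ?thesis using False by (simp add: g_def)
    qed
    have "sphere c r \<in> null_sets lebesgue" using negligible_sphere negligible_iff_null_sets by blast
    then show "AE x in lebesgue. ((\<lambda>t. u (x + t *\<^sub>R v)) has_real_derivative g x) (at 0)"
      by (rule AE_I') (use d in blast)
  qed
  then have "(LINT x:\<Omega>|lebesgue. s (\<rho> x) * ((x - c) \<bullet> v / \<rho> x * \<phi> x) + p (\<rho> x) * D x v) = 0"
    by (simp add: g_def[abs_def] set_lebesgue_integral_def)
  then show "?L = - ?R"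
    using set_integral_add(2)[OF I2 I1] by (simp add: D_def s_def)
qed

lemma L2_on_bounded:
  assumes "set_borel_measurable lebesgue \<Omega> f" "\<And>x. x \<in> \<Omega> \<Longrightarrow> \<bar>f x :: real\<bar> \<le> B"
  shows "L2_on \<Omega> f"
  unfolding L2_on_def
proof
  have "set_integrable lebesgue \<Omega> (\<lambda>x. f x * 1)"
    by (rule set_integrable_mult_bounded[OF set_integrable_const assms])
  then have "set_integrable lebesgue \<Omega> (\<lambda>x. f x * (f x * 1))"
    by (rule set_integrable_mult_bounded[OF _ assms])
  then show "set_integrable lebesgue \<Omega> (\<lambda>x. (f x)\<^sup>2)" by (simp add: power2_eq_square)
qed (rule assms(1))

lemma measurable_radial_mult:
  assumes "continuous_on J0 Q" "continuous_on (- {c}) u"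
  shows "set_borel_measurable lebesgue \<Omega> (\<lambda>x. Q (\<rho> x) * u x :: real)"
proof -
  have "(\<lambda>x. (indicat_real \<Omega> x *\<^sub>R Q (\<rho> x)) * (indicat_real \<Omega> x *\<^sub>R u x)) \<in> borel_measurable lebesgue"
    using measurable_radial[OF assms(1)] measurable_continuous_off_center[OF assms(2)]
    by (intro borel_measurable_times) (auto simp: set_borel_measurable_def)
  also have "(\<lambda>x. (indicat_real \<Omega> x *\<^sub>R Q (\<rho> x)) * (indicat_real \<Omega> x *\<^sub>R u x)) = (\<lambda>x. indicat_real \<Omega> x *\<^sub>R (Q (\<rho> x) * u x))"
    by (auto simp: indicator_def)
  finally show ?thesis by (simp add: set_borel_measurable_def)
qed

lemma test_fun_mult_off_center:
  assumes \<phi>: "test_fun \<Omega> \<phi>" and u: "\<And>x. x \<noteq> c \<Longrightarrow> (u has_derivative Du x) (at x)" "\<And>v. continuous_on (- {c}) (\<lambda>x. Du x v)"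
  shows "test_fun \<Omega> (\<lambda>x. u x * \<phi> x)"
    and "x \<noteq> c \<Longrightarrow> frechet_derivative (\<lambda>x. u x * \<phi> x) (at x) v = u x * frechet_derivative \<phi> (at x) v + Du x v * \<phi> x"
proof -
  define K where "K = closure {x. \<phi> x \<noteq> 0}"
  have K: "compact K" "K \<subseteq> \<Omega>" using \<phi> by (auto simp: test_fun_def K_def)
  have zero: "\<phi> x = 0" if "x \<notin> K" for x using that closure_subset[of "{x. \<phi> x \<noteq> 0}"] by (auto simp: K_def)
  note D = test_fun_derivative[OF \<phi>]
  have d: "((\<lambda>x. u x * \<phi> x) has_derivative (\<lambda>v. u x * frechet_derivative \<phi> (at x) v + Du x v * \<phi> x)) (at x)" if "x \<noteq> c" for x
    by (rule has_derivative_mult[OF u(1)[OF that] D(1)])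
  have cu: "continuous_on (- {c}) u"
    using u(1) by (intro continuous_at_imp_continuous_on ballI) (blast intro: has_derivative_continuous)
  have c\<phi>: "continuous_on S \<phi>" for S
    using D(1) by (intro continuous_at_imp_continuous_on ballI) (blast intro: has_derivative_continuous)
  have "continuous_on (- {c}) (\<lambda>x. u x * frechet_derivative \<phi> (at x) v + Du x v * \<phi> x)" for v
    by (intro continuous_intros cu c\<phi> u(2) continuous_on_subset[OF D(2)]) auto
  then show "test_fun \<Omega> (\<lambda>x. u x * \<phi> x)"
    using K center_notin zero d
    by (intro test_funI[of "- {c}" K _ _ "\<lambda>x v. u x * frechet_derivative \<phi> (at x) v + Du x v * \<phi> x"]) auto
  show "frechet_derivative (\<lambda>x. u x * \<phi> x) (at x) v = u x * frechet_derivative \<phi> (at x) v + Du x v * \<phi> x" if "x \<noteq> c"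
    using fun_cong[OF frechet_derivative_at[OF d[OF that]], of v] by (rule sym)
qed

text \<open>\<open>Y\<close> is continuously differentiable off \<open>c\<close>, so Y \<phi> is
  again a test function; with it the formula for the radial factor alone yields the one for the
  product.\<close>

lemma H1_on_radial_mult:
  assumes sol: "radial_sol \<Lambda> h p w" and lb: "has_lb c Y DY D2Y K"
  shows "H1_on \<Omega> (\<lambda>x. p (\<rho> x) * Y x) (radial_grad p w Y DY)"
proof -
  let ?N = "DIM('a)"
  define s where "s t = w t / (\<sigma> t * t ^ (?N - 1))" for t
  have wc: "continuous_on {a..b} w" and pc: "continuous_on {a..b} p" using sol by (auto simp: radial_sol_def)
  have sub: "J0 \<subseteq> {a..b}" by auto
  have pJ: "continuous_on J0 p" and wJ: "continuous_on J0 w"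
    using continuous_on_subset[OF pc sub] continuous_on_subset[OF wc sub] by auto
  have nz: "\<sigma> t * t ^ (?N - 1) \<noteq> 0" if "t \<in> J0" for t using that a0 phase_coef_pos[of t] by auto
  have sJ: "continuous_on J0 s" unfolding s_def[abs_def]
    by (intro continuous_intros wJ continuous_on_J0_phase_coef) (use nz in auto)
  obtain C where C: "C \<ge> 0" "\<And>t. t \<in> {a..b} \<Longrightarrow> \<bar>s t\<bar> \<le> C"
    "\<And>s t. s \<in> {a..b} \<Longrightarrow> t \<in> {a..b} \<Longrightarrow> \<bar>p s - p t\<bar> \<le> C * \<bar>s - t\<bar>"
    using radial_sol_slope_bound[OF sol] unfolding s_def by blast
  obtain Bp where Bp: "Bp \<ge> 0" "\<And>t. t \<in> {a..b} \<Longrightarrow> \<bar>p t\<bar> \<le> Bp" using continuous_on_Icc_bound[OF pc] by blast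
  note cY = has_lb_continuous[OF lb]
  have Gi: "radial_grad p w Y DY x \<bullet> i = s (\<rho> x) * (Y x / \<rho> x * ((x - c) \<bullet> i)) + p (\<rho> x) * DY x i" if "i \<in> Basis" for x i
    using that by (simp add: radial_grad_def s_def inner_add_left inner_sum_left inner_Basis if_distrib cong: if_cong)
  have mult_bound: "\<exists>B. \<forall>x\<in>\<Omega>. \<bar>Q (\<rho> x) * u x\<bar> \<le> B" if Q: "\<And>t. t \<in> {a..b} \<Longrightarrow> \<bar>Q t\<bar> \<le> M" and M: "M \<ge> 0" and u: "continuous_on (- {c}) u"
    for Q :: "real \<Rightarrow> real" and M and u :: "'a \<Rightarrow> real"
  proof -
    obtain B where B: "\<And>x. x \<in> \<Omega> \<Longrightarrow> \<bar>u x\<bar> \<le> B" using bounded_on_Omega[OF u] by blast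
    have "\<bar>Q (\<rho> x) * u x\<bar> \<le> M * B" if "x \<in> \<Omega>" for x
      unfolding abs_mult using Q[of "\<rho> x"] B[OF that] that M by (intro mult_mono) (auto simp: Omega_iff)
    then show ?thesis by blast
  qed
  have cr: "continuous_on (- {c}) (\<lambda>x. Y x / \<rho> x * ((x - c) \<bullet> i))" for i by (intro continuous_intros cY) auto
  have L2\<Phi>: "L2_on \<Omega> (\<lambda>x. p (\<rho> x) * Y x)"
    using mult_bound[of p Bp Y] Bp cY(1) L2_on_bounded[OF measurable_radial_mult[OF pJ cY(1)]] by blast
  have L2G: "L2_on \<Omega> (\<lambda>x. radial_grad p w Y DY x \<bullet> i)" if i: "i \<in> Basis" for i
  proof -
    obtain B1 where B1: "\<forall>x\<in>\<Omega>. \<bar>s (\<rho> x) * (Y x / \<rho> x * ((x - c) \<bullet> i))\<bar> \<le> B1" using mult_bound[of s C, OF _ C(1) cr] C(2) by blast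
    obtain B2 where B2: "\<forall>x\<in>\<Omega>. \<bar>p (\<rho> x) * DY x i\<bar> \<le> B2" using mult_bound[of p Bp, OF _ Bp(1) cY(2)] Bp(2) by blast
    have "L2_on \<Omega> (\<lambda>x. s (\<rho> x) * (Y x / \<rho> x * ((x - c) \<bullet> i)) + p (\<rho> x) * DY x i)"
    proof (rule L2_on_bounded[where B = "B1 + B2"])
      show "set_borel_measurable lebesgue \<Omega> (\<lambda>x. s (\<rho> x) * (Y x / \<rho> x * ((x - c) \<bullet> i)) + p (\<rho> x) * DY x i)"
        using measurable_radial_mult[OF sJ cr, of i] measurable_radial_mult[OF pJ cY(2), of i]
        unfolding set_borel_measurable_def scaleR_add_right by (rule borel_measurable_add)
      show "\<bar>s (\<rho> x) * (Y x / \<rho> x * ((x - c) \<bullet> i)) + p (\<rho> x) * DY x i\<bar> \<le> B1 + B2" if "x \<in> \<Omega>" for x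
        using bspec[OF B1 that] bspec[OF B2 that] by linarith
    qed
    then show ?thesis using Gi[OF i] by simp
  qed
  have u: "\<And>x. x \<noteq> c \<Longrightarrow> (Y has_derivative DY x) (at x)" using lb by (simp add: has_lb_def)
  have "weak_grad \<Omega> (\<lambda>x. p (\<rho> x) * Y x) (radial_grad p w Y DY)"
    unfolding weak_grad_def
  proof (intro allI impI ballI)
    fix \<phi> and i :: 'a assume \<phi>: "test_fun \<Omega> \<phi>" and i: "i \<in> Basis"
    let ?d = "\<lambda>x. frechet_derivative \<phi> (at x) i"
    let ?d1 = "\<lambda>x. frechet_derivative (\<lambda>x. Y x * \<phi> x) (at x) i"
    have t1: "test_fun \<Omega> (\<lambda>x. Y x * \<phi> x)" by (rule test_fun_mult_off_center(1)[OF \<phi> u cY(2)])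
    have d1: "?d1 x = Y x * ?d x + DY x i * \<phi> x" if "x \<noteq> c" for x
      by (rule test_fun_mult_off_center(2)[OF \<phi> u cY(2) that])
    note R = radial_weak_gradient[OF sol t1, of i]
    have c\<phi>: "continuous_on S \<phi>" for S
      using test_fun_derivative(1)[OF \<phi>] by (intro continuous_at_imp_continuous_on ballI) (blast intro: has_derivative_continuous)
    have "set_integrable lebesgue \<Omega> (\<lambda>x. (DY x i * \<phi> x) * 1)"
      by (intro set_integrable_off_center_mult set_integrable_const continuous_intros c\<phi> cY)
    then have i3: "set_integrable lebesgue \<Omega> (\<lambda>x. DY x i * \<phi> x)" by (simp only: mult_1_right)
    have I3: "set_integrable lebesgue \<Omega> (\<lambda>x. p (\<rho> x) * (DY x i * \<phi> x))"
      by (rule set_integrable_radial_mult[OF pJ _ i3, of Bp]) (use Bp(2) in auto)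
    have e1: "p (\<rho> x) * Y x * ?d x = p (\<rho> x) * ?d1 x - p (\<rho> x) * (DY x i * \<phi> x)" if "x \<in> \<Omega>" for x
    proof -
      have "x \<noteq> c" using that center_notin by blast
      then show ?thesis by (simp add: d1 algebra_simps)
    qed
    have e2: "(radial_grad p w Y DY x \<bullet> i) * \<phi> x =
        w (\<rho> x) / (\<sigma> (\<rho> x) * \<rho> x ^ (?N - 1)) * ((x - c) \<bullet> i / \<rho> x * (Y x * \<phi> x)) + p (\<rho> x) * (DY x i * \<phi> x)" for x
      unfolding Gi[OF i] s_def by (simp add: algebra_simps)
    have "set_integrable lebesgue \<Omega> (\<lambda>x. p (\<rho> x) * ?d1 x - p (\<rho> x) * (DY x i * \<phi> x))"
      by (rule set_integral_diff(1)[OF R(2) I3])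
    then show "set_integrable lebesgue \<Omega> (\<lambda>x. p (\<rho> x) * Y x * ?d x) \<and>
      set_integrable lebesgue \<Omega> (\<lambda>x. (radial_grad p w Y DY x \<bullet> i) * \<phi> x) \<and>
      (LINT x:\<Omega>|lebesgue. p (\<rho> x) * Y x * ?d x) = - (LINT x:\<Omega>|lebesgue. (radial_grad p w Y DY x \<bullet> i) * \<phi> x)"
    proof (intro conjI)
      assume "set_integrable lebesgue \<Omega> (\<lambda>x. p (\<rho> x) * ?d1 x - p (\<rho> x) * (DY x i * \<phi> x))"
      also have "?this \<longleftrightarrow> set_integrable lebesgue \<Omega> (\<lambda>x. p (\<rho> x) * Y x * ?d x)"
        unfolding set_integrable_def using e1 by (intro Bochner_Integration.integrable_cong refl) (simp add: indicator_def)
      finally show "set_integrable lebesgue \<Omega> (\<lambda>x. p (\<rho> x) * Y x * ?d x)" .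
      show "set_integrable lebesgue \<Omega> (\<lambda>x. (radial_grad p w Y DY x \<bullet> i) * \<phi> x)"
        unfolding e2 by (rule set_integral_add(1)[OF R(3) I3])
      have "(LINT x:\<Omega>|lebesgue. p (\<rho> x) * Y x * ?d x) = (LINT x:\<Omega>|lebesgue. p (\<rho> x) * ?d1 x - p (\<rho> x) * (DY x i * \<phi> x))"
        by (rule set_integral_cong_Omega[OF e1])
      also have "\<dots> = (LINT x:\<Omega>|lebesgue. p (\<rho> x) * ?d1 x) - (LINT x:\<Omega>|lebesgue. p (\<rho> x) * (DY x i * \<phi> x))"
        by (rule set_integral_diff(2)[OF R(2) I3])
      also have "\<dots> = - ((LINT x:\<Omega>|lebesgue. w (\<rho> x) / (\<sigma> (\<rho> x) * \<rho> x ^ (?N - 1)) * ((x - c) \<bullet> i / \<rho> x * (Y x * \<phi> x)))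
          + (LINT x:\<Omega>|lebesgue. p (\<rho> x) * (DY x i * \<phi> x)))"
        using R(1) by simp
      also have "\<dots> = - (LINT x:\<Omega>|lebesgue. (radial_grad p w Y DY x \<bullet> i) * \<phi> x)"
        unfolding e2 set_integral_add(2)[OF R(3) I3] ..
      finally show "(LINT x:\<Omega>|lebesgue. p (\<rho> x) * Y x * ?d x) = - (LINT x:\<Omega>|lebesgue. (radial_grad p w Y DY x \<bullet> i) * \<phi> x)" .
    qed
  qed
  then show ?thesis unfolding H1_on_def using L2\<Phi> L2G by blast
qed

end

section \<open>Completeness and separation of variables\<close>

inductive polyfun :: "('a::euclidean_space \<Rightarrow> real) \<Rightarrow> bool" where
  hom: "hpoly m P \<Longrightarrow> polyfun P"
| add: "polyfun P \<Longrightarrow> polyfun Q \<Longrightarrow> polyfun (\<lambda>x. P x + Q x)"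

lemma polyfun_mult: "polyfun P \<Longrightarrow> polyfun Q \<Longrightarrow> polyfun (\<lambda>x. P x * Q x)"
proof (induction P rule: polyfun.induct)
  case (hom m P)
  from hom(2) show ?case
  proof (induction Q rule: polyfun.induct)
    case (hom k Q)
    then show ?case using hpoly_mult[OF \<open>hpoly m P\<close>] polyfun.hom by blast
  next
    case (add Q R)
    then show ?case using polyfun.add[OF add(3,4)] by (simp add: distrib_left)
  qed
next
  case (add P R)
  then show ?case using polyfun.add[OF add(3)[OF add(5)] add(4)[OF add(5)]] by (simp add: distrib_right)
qed

lemma polyfun_sum:
  assumes "\<And>i. i \<in> S \<Longrightarrow> polyfun (P i)" "finite S"
  shows "polyfun (\<lambda>x. \<Sum>i\<in>S. P i x)"
  using assms(2,1) by (induction S rule: finite_induct) (auto intro: polyfun.intros hpoly_zero[of 0])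

lemma hpoly_inner: "i \<in> Basis \<Longrightarrow> hpoly 1 (\<lambda>x::'a::euclidean_space. x \<bullet> i)"
  using hpoly.mult[OF hpoly.const[of 1], of i] by simp

text \<open>Recentring at \<open>c\<close> and grading by degree connect the polynomials of the
  Stone--Weierstrass theorem with \<open>hpoly_decomposition\<close>.\<close>

lemma real_polynomial_imp_polyfun:
  assumes "real_polynomial_function f"
  shows "polyfun (\<lambda>x. f (c + x :: 'a::euclidean_space))"
  using assms
proof (induction rule: real_polynomial_function.induct)
  case (linear f)
  then interpret f: bounded_linear f .
  have fx: "(\<Sum>i\<in>Basis. f i * (x \<bullet> i)) = f x" for x
    using sum_Basis_linear[OF f.linear_axioms, of x] by (simp add: mult.commute)
  have e: "f (c + x) = f c + (\<Sum>i\<in>Basis. f i * (x \<bullet> i))" for x unfolding fx by (rule f.add)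
  have "polyfun (\<lambda>x. \<Sum>i\<in>Basis. f i * (x \<bullet> i))"
    by (intro polyfun_sum polyfun.hom[OF hpoly_cmul[OF hpoly_inner]]) auto
  then show ?case unfolding e by (rule polyfun.add[OF polyfun.hom[OF hpoly.const]])
next
  case (const k)
  show ?case by (rule polyfun.hom[OF hpoly.const])
next
  case (add f g)
  then show ?case by (intro polyfun.add)
next
  case (mult f g)
  then show ?case by (intro polyfun_mult)
qed

lemma AE_zero_imp_zero:
  fixes f :: "'a::euclidean_space \<Rightarrow> real"
  assumes "open S" "continuous_on S f" "AE x in lebesgue. x \<in> S \<longrightarrow> f x = 0" "x \<in> S"
  shows "f x = 0"
proof (rule ccontr)
  assume "f x \<noteq> 0"
  define T where "T = {x \<in> S. f x \<in> - {0}}"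
  have "open T" unfolding T_def
    using continuous_open_preimage[OF assms(2,1), of "- {0}"] by (simp add: vimage_def Int_def open_Compl)
  moreover have "x \<in> T" using assms(4) \<open>f x \<noteq> 0\<close> by (simp add: T_def)
  moreover have "negligible T"
  proof -
    have "T \<in> sets lebesgue" using \<open>open T\<close> by (simp add: lmeasurable_open borel_open sets_completionI_sets)
    moreover have "T = {x \<in> space lebesgue. \<not> (x \<in> S \<longrightarrow> f x = 0)}" by (auto simp: T_def)
    ultimately show ?thesis using assms(3) AE_iff_null[of lebesgue "\<lambda>x. x \<in> S \<longrightarrow> f x = 0"]
      unfolding negligible_iff_null_sets by simp
  qed
  ultimately show False using open_not_negligible by blast
qed

context shell
begin

lemma continuous_harmonic0: "harmonic0 c \<Lambda> Y \<Longrightarrow> continuous_on (- {c}) Y"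
  using has_lb_continuous(1) unfolding harmonic0_def by blast

text \<open>Orthogonality passes from the products \<rho>^m Y to polynomials, by uniform
  approximation to continuous functions, and by dominated convergence to the sign of \<Phi>; hence
  the L^1 norm of \<Phi> is 0.\<close>

lemma complete_harmonic0:
  fixes \<Phi> :: "'a \<Rightarrow> real"
  assumes dim: "DIM('a) \<ge> 2" and \<Phi>: "set_integrable lebesgue \<Omega> \<Phi>"
    and ortho: "\<And>Y l m. harmonic0 c (lb_eigenvalue TYPE('a) l) Y \<Longrightarrow>
       (LINT x:\<Omega>|lebesgue. \<rho> x ^ m * (Y x * \<Phi> x)) = 0"
  shows "AE x in lebesgue. x \<in> \<Omega> \<longrightarrow> \<Phi> x = 0"
proof -
  have hp: "set_integrable lebesgue \<Omega> (\<lambda>x. P (x - c) * \<Phi> x) \<and> (LINT x:\<Omega>|lebesgue. P (x - c) * \<Phi> x) = 0"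
    if P: "hpoly m P" for m and P :: "'a \<Rightarrow> real"
  proof -
    obtain Y where Y: "\<And>l. harmonic0 c (lb_eigenvalue TYPE('a) l) (Y l)"
      "\<And>x. x \<noteq> c \<Longrightarrow> P (x - c) / norm (x - c) ^ m = (\<Sum>l\<le>m. Y l x)"
      using hpoly_decomposition[OF P dim, of c] by blast
    have e: "P (x - c) * \<Phi> x = (\<Sum>l\<le>m. \<rho> x ^ m * (Y l x * \<Phi> x))" if "x \<in> \<Omega>" for x
    proof -
      have "x \<noteq> c" using that center_notin by blast
      then have "P (x - c) = \<rho> x ^ m * (\<Sum>l\<le>m. Y l x)" using Y(2)[of x] by (simp add: field_simps)
      then show ?thesis by (simp add: sum_distrib_left sum_distrib_right mult.assoc)
    qed
    have i: "set_integrable lebesgue \<Omega> (\<lambda>x. \<rho> x ^ m * (Y l x * \<Phi> x))" for l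
      by (intro set_integrable_off_center_mult \<Phi> continuous_harmonic0[OF Y(1)] continuous_intros)
    have z: "(LINT x:\<Omega>|lebesgue. \<rho> x ^ m * (Y l x * \<Phi> x)) = 0" for l
      by (rule ortho[OF Y(1)])
    have "(LINT x:\<Omega>|lebesgue. P (x - c) * \<Phi> x) = (LINT x:\<Omega>|lebesgue. (\<Sum>l\<le>m. \<rho> x ^ m * (Y l x * \<Phi> x)))"
      by (rule set_integral_cong_Omega[OF e])
    also have "\<dots> = (\<Sum>l\<le>m. LINT x:\<Omega>|lebesgue. \<rho> x ^ m * (Y l x * \<Phi> x))"
      using i unfolding set_lebesgue_integral_def set_integrable_def scaleR_sum_right
      by (intro Bochner_Integration.integral_sum)
    also have "\<dots> = 0" using z by simp
    finally have 1: "(LINT x:\<Omega>|lebesgue. P (x - c) * \<Phi> x) = 0" .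
    have "continuous_on (- {c}) (\<lambda>x. P (x - c))"
      by (rule continuous_on_compose2[OF hpoly_continuous[OF P, of UNIV]]) (auto intro!: continuous_intros)
    then show ?thesis using 1 by (intro conjI set_integrable_off_center_mult \<Phi>)
  qed
  have pf: "set_integrable lebesgue \<Omega> (\<lambda>x. P (x - c) * \<Phi> x) \<and> (LINT x:\<Omega>|lebesgue. P (x - c) * \<Phi> x) = 0"
    if "polyfun P" for P :: "'a \<Rightarrow> real"
    using that
  proof (induction rule: polyfun.induct)
    case (hom m P)
    then show ?case by (rule hp)
  next
    case (add P Q)
    then show ?case using set_integral_add[of lebesgue \<Omega> "\<lambda>x. P (x - c) * \<Phi> x" "\<lambda>x. Q (x - c) * \<Phi> x"]
      by (simp add: distrib_right)
  qed
  have poly: "(LINT x:\<Omega>|lebesgue. g x * \<Phi> x) = 0" if "real_polynomial_function g" for g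
    using pf[OF real_polynomial_imp_polyfun[OF that, of c]] by simp
  define I where "I = (LINT x:\<Omega>|lebesgue. \<bar>\<Phi> x\<bar>)"
  have I0: "I \<ge> 0" unfolding I_def set_lebesgue_integral_def by (intro Bochner_Integration.integral_nonneg) simp
  have cont: "(LINT x:\<Omega>|lebesgue. g x * \<Phi> x) = 0" if g: "continuous_on UNIV g" for g :: "'a \<Rightarrow> real"
  proof -
    have gi: "set_integrable lebesgue \<Omega> (\<lambda>x. g x * \<Phi> x)"
      by (intro set_integrable_off_center_mult \<Phi> continuous_on_subset[OF g]) auto
    have "\<bar>LINT x:\<Omega>|lebesgue. g x * \<Phi> x\<bar> \<le> e * I" if e: "e > 0" for e
    proof -
      obtain f where f: "real_polynomial_function f" "\<And>x. x \<in> {x. \<rho> x \<in> {a..b}} \<Longrightarrow> \<bar>g x - f x\<bar> < e"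
        using Stone_Weierstrass_real_polynomial_function[OF compact_shell[of "{a..b}"] continuous_on_subset[OF g] e] by auto
      have cf: "continuous_on S f" for S using f(1) by (rule continuous_on_polymonial_function[OF real_polynomial_function_eq[THEN iffD1]])
      have fi: "set_integrable lebesgue \<Omega> (\<lambda>x. f x * \<Phi> x)"
        by (intro set_integrable_off_center_mult \<Phi> cf)
      have "(LINT x:\<Omega>|lebesgue. g x * \<Phi> x) = (LINT x:\<Omega>|lebesgue. g x * \<Phi> x - f x * \<Phi> x)"
        using set_integral_diff(2)[OF gi fi] poly[OF f(1)] by simp
      also have "\<bar>\<dots>\<bar> \<le> (LINT x:\<Omega>|lebesgue. e * \<bar>\<Phi> x\<bar>)"
        unfolding set_lebesgue_integral_def real_norm_def[symmetric]
      proof (rule Bochner_Integration.integral_norm_bound_integral)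
        show "integrable lebesgue (\<lambda>x. indicat_real \<Omega> x *\<^sub>R (g x * \<Phi> x - f x * \<Phi> x))"
          using set_integral_diff(1)[OF gi fi] by (simp add: set_integrable_def)
        have "set_integrable lebesgue \<Omega> (\<lambda>x. \<bar>\<Phi> x\<bar>)" by (rule set_integrable_abs[OF \<Phi>])
        then show "integrable lebesgue (\<lambda>x. indicat_real \<Omega> x *\<^sub>R (e * norm (\<Phi> x)))"
          using integrable_mult_right[of e lebesgue "\<lambda>x. indicat_real \<Omega> x *\<^sub>R \<bar>\<Phi> x\<bar>"]
          by (simp add: set_integrable_def mult.left_commute)
        fix x
        have "\<bar>g x - f x\<bar> * \<bar>\<Phi> x\<bar> \<le> e * \<bar>\<Phi> x\<bar>" if "x \<in> \<Omega>"
          using f(2)[of x] that Omega_subset_compact by (intro mult_right_mono) auto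
        then show "norm (indicat_real \<Omega> x *\<^sub>R (g x * \<Phi> x - f x * \<Phi> x)) \<le> indicat_real \<Omega> x *\<^sub>R (e * norm (\<Phi> x))"
          by (simp add: indicator_def abs_mult[symmetric] left_diff_distrib)
      qed
      also have "\<dots> = e * I" by (simp add: I_def)
      finally show ?thesis .
    qed
    then have le: "\<bar>LINT x:\<Omega>|lebesgue. g x * \<Phi> x\<bar> \<le> e * I" if "e > 0" for e using that by blast
    have "\<bar>LINT x:\<Omega>|lebesgue. g x * \<Phi> x\<bar> \<le> 0 + e" if "e > 0" for e
    proof -
      \<comment> \<open>Dividing by \<open>I + 1\<close> instead of \<open>I\<close> covers the case
        \<open>I = 0\<close>.\<close>
      have "\<bar>LINT x:\<Omega>|lebesgue. g x * \<Phi> x\<bar> \<le> e / (I + 1) * I" by (rule le) (use I0 that in simp)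
      also have "\<dots> \<le> e" using I0 that by (simp add: field_simps)
      finally show ?thesis by simp
    qed
    then have "\<bar>LINT x:\<Omega>|lebesgue. g x * \<Phi> x\<bar> \<le> 0" by (rule field_le_epsilon)
    then show ?thesis by simp
  qed
  define s where "s x = sgn (indicat_real \<Omega> x *\<^sub>R \<Phi> x)" for x
  have ms: "(\<lambda>x. indicat_real \<Omega> x *\<^sub>R \<Phi> x) \<in> borel_measurable lebesgue" using \<Phi> by (auto simp: set_integrable_def)
  have "s \<in> borel_measurable lebesgue" 
    unfolding s_def[abs_def] sgn_if using ms by measurable
  then have "s measurable_on UNIV" by (rule lebesgue_measurable_imp_measurable_on_real) simp
  then obtain N g where g: "negligible N" "\<And>n. continuous_on UNIV (g n)" "\<And>x. x \<notin> N \<Longrightarrow> (\<lambda>n. g n x) \<longlonglongrightarrow> s x"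
    unfolding measurable_on_def by auto
  \<comment> \<open>A measurable function is a limit of continuous ones off a negligible set;
    truncation to [-1, 1], which contains the values of \<open>s\<close>, provides domination by
    |\<Phi>|.\<close>
  define G where "G n x = max (-1) (min 1 (g n x))" for n :: nat and x
  have "(\<lambda>n. LINT x:\<Omega>|lebesgue. G n x * \<Phi> x) \<longlonglongrightarrow> (LINT x:\<Omega>|lebesgue. \<bar>\<Phi> x\<bar>)"
    unfolding set_lebesgue_integral_def
  proof (rule integral_dominated_convergence[where w = "\<lambda>x. indicat_real \<Omega> x *\<^sub>R \<bar>\<Phi> x\<bar>"])
    have "set_integrable lebesgue \<Omega> (\<lambda>x. \<bar>\<Phi> x\<bar>)" by (rule set_integrable_abs[OF \<Phi>])
    then show 1: "integrable lebesgue (\<lambda>x. indicat_real \<Omega> x *\<^sub>R \<bar>\<Phi> x\<bar>)" by (simp add: set_integrable_def)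
    from 1 show "(\<lambda>x. indicat_real \<Omega> x *\<^sub>R \<bar>\<Phi> x\<bar>) \<in> borel_measurable lebesgue" by (rule borel_measurable_integrable)
    show "(\<lambda>x. indicat_real \<Omega> x *\<^sub>R (G n x * \<Phi> x)) \<in> borel_measurable lebesgue" for n
    proof -
      have "set_integrable lebesgue \<Omega> (\<lambda>x. G n x * \<Phi> x)"
        unfolding G_def by (intro set_integrable_off_center_mult \<Phi> continuous_intros continuous_on_subset[OF g(2)]) auto
      then show ?thesis by (auto simp: set_integrable_def)
    qed
    have "N \<in> null_sets lebesgue" using g(1) negligible_iff_null_sets by blast
    moreover have "(\<lambda>n. indicat_real \<Omega> x *\<^sub>R (G n x * \<Phi> x)) \<longlonglongrightarrow> indicat_real \<Omega> x *\<^sub>R \<bar>\<Phi> x\<bar>" if "x \<notin> N" for x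
    proof (cases "x \<in> \<Omega>")
      case True
      have "(\<lambda>n. G n x * \<Phi> x) \<longlonglongrightarrow> max (-1) (min 1 (s x)) * \<Phi> x"
        unfolding G_def by (intro tendsto_intros g(3) that)
      moreover have "max (-1) (min 1 (s x)) * \<Phi> x = \<bar>\<Phi> x\<bar>" using True by (auto simp: s_def sgn_if)
      ultimately show ?thesis using True by simp
    qed simp
    ultimately show "AE x in lebesgue. (\<lambda>n. indicat_real \<Omega> x *\<^sub>R (G n x * \<Phi> x)) \<longlonglongrightarrow> indicat_real \<Omega> x *\<^sub>R \<bar>\<Phi> x\<bar>"
      by (intro AE_I'[of N]) auto
    fix n
    have "\<bar>G n x\<bar> * \<bar>\<Phi> x\<bar> \<le> 1 * \<bar>\<Phi> x\<bar>" for x by (intro mult_right_mono) (auto simp: G_def)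
    then show "AE x in lebesgue. norm (indicat_real \<Omega> x *\<^sub>R (G n x * \<Phi> x)) \<le> indicat_real \<Omega> x *\<^sub>R \<bar>\<Phi> x\<bar>"
      by (intro AE_I2) (simp add: indicator_def abs_mult)
  qed
  moreover have "(LINT x:\<Omega>|lebesgue. G n x * \<Phi> x) = 0" for n
    unfolding G_def by (intro cont continuous_intros g(2))
  ultimately have "(LINT x:\<Omega>|lebesgue. \<bar>\<Phi> x\<bar>) = 0" by (simp add: LIMSEQ_const_iff)
  moreover have "integrable lebesgue (\<lambda>x. indicat_real \<Omega> x *\<^sub>R \<bar>\<Phi> x\<bar>)"
    using set_integrable_abs[OF \<Phi>] by (simp add: set_integrable_def)
  ultimately have "AE x in lebesgue. indicat_real \<Omega> x *\<^sub>R \<bar>\<Phi> x\<bar> = 0"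
    unfolding set_lebesgue_integral_def by (subst (asm) integral_nonneg_eq_0_iff_AE) auto
  then show ?thesis by eventually_elim (auto simp: indicator_def)
qed

text \<open>Tested with \<Phi> itself. The bound matters because roots are compared only between 0
  and \<open>M\<close>.\<close>

lemma tp_efun_nonneg:
  assumes "tp_efun c r sm sp e lam \<Phi>" shows "0 \<le> lam"
proof (rule ccontr)
  assume neg: "\<not> 0 \<le> lam"
  obtain G where G: "H1_on \<Omega> \<Phi> G" "\<not> (AE x in lebesgue. x \<in> \<Omega> \<longrightarrow> \<Phi> x = 0)"
    "\<And>\<psi> H. H1_on \<Omega> \<psi> H \<Longrightarrow> (LINT x:\<Omega>|lebesgue. sigma_coef c r sm sp e x * (G x \<bullet> H x)) = lam * (LINT x:\<Omega>|lebesgue. \<Phi> x * \<psi> x)"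
    using assms unfolding tp_efun_def Let_def by blast
  have i: "integrable lebesgue (\<lambda>x. indicat_real \<Omega> x *\<^sub>R (\<Phi> x)\<^sup>2)"
    using G(1) by (simp add: H1_on_def L2_on_def set_integrable_def)
  have "(LINT x:\<Omega>|lebesgue. (\<Phi> x)\<^sup>2) \<noteq> 0"
  proof
    assume "(LINT x:\<Omega>|lebesgue. (\<Phi> x)\<^sup>2) = 0"
    then have "AE x in lebesgue. indicat_real \<Omega> x *\<^sub>R (\<Phi> x)\<^sup>2 = 0"
      unfolding set_lebesgue_integral_def using integral_nonneg_eq_0_iff_AE[OF i] by simp
    then have "AE x in lebesgue. x \<in> \<Omega> \<longrightarrow> \<Phi> x = 0" by eventually_elim (auto simp: indicator_def)
    then show False using G(2) by blast
  qed
  moreover have "(LINT x:\<Omega>|lebesgue. (\<Phi> x)\<^sup>2) \<ge> 0"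
    unfolding set_lebesgue_integral_def by (intro Bochner_Integration.integral_nonneg) simp
  ultimately have "lam * (LINT x:\<Omega>|lebesgue. (\<Phi> x)\<^sup>2) < 0" using neg by (simp add: mult_neg_pos)
  moreover have "(LINT x:\<Omega>|lebesgue. sigma_coef c r sm sp e x * (G x \<bullet> G x)) \<ge> 0"
    unfolding set_lebesgue_integral_def using sm0 sp0
    by (intro Bochner_Integration.integral_nonneg) (simp add: sigma_coef_def)
  ultimately show False using G(3)[OF G(1)] by (simp add: power2_eq_square)
qed

lemma sigma_coef_integral:
  "(LINT x:\<Omega>|lebesgue. sigma_coef c r sm sp e x * f x) = (LINT x:\<Omega>|lebesgue. \<sigma> (\<rho> x) * f x)"
  by (rule set_integral_cong_Omega) (simp add: sigma_coef_eq)

text \<open>Green's identity and the weak equation for \<Phi> evaluate the same energy integral; the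
  terms with \<open>lam\<close> cancel and the one with \<open>q\<close> is left.\<close>

lemma tp_efun_orthogonal:
  assumes tp: "tp_efun c r sm sp e lam \<Phi>" and Y: "harmonic0 c \<Lambda> Y"
    and sol: "radial_sol \<Lambda> (\<lambda>t. lam * p t + q t) p w" "w a = 0" "w b = 0" and q: "continuous_on {a..b} q"
  shows "(LINT x:\<Omega>|lebesgue. q (\<rho> x) * (Y x * \<Phi> x)) = 0"
proof -
  obtain G where G: "H1_on \<Omega> \<Phi> G"
    "\<And>\<psi> H. H1_on \<Omega> \<psi> H \<Longrightarrow> (LINT x:\<Omega>|lebesgue. sigma_coef c r sm sp e x * (G x \<bullet> H x)) = lam * (LINT x:\<Omega>|lebesgue. \<Phi> x * \<psi> x)"
    using tp unfolding tp_efun_def Let_def by blast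
  obtain DY D2Y where lb: "has_lb c Y DY D2Y (\<lambda>x. - \<Lambda> * Y x)" using Y by (auto simp: harmonic0_def)
  have pc: "continuous_on {a..b} p" using sol by (auto simp: radial_sol_def)
  have h: "continuous_on {a..b} (\<lambda>t. lam * p t + q t)" by (intro continuous_intros pc q)
  have H: "H1_on \<Omega> (\<lambda>x. p (\<rho> x) * Y x) (radial_grad p w Y DY)" by (rule H1_on_radial_mult[OF sol(1) lb])
  have "(LINT x:\<Omega>|lebesgue. (lam * p (\<rho> x) + q (\<rho> x)) * (Y x * \<Phi> x)) = lam * (LINT x:\<Omega>|lebesgue. \<Phi> x * (p (\<rho> x) * Y x))"
    using green_identity[OF G(1) lb sol h] G(2)[OF H] by (simp add: sigma_coef_integral inner_commute)
  moreover have "(LINT x:\<Omega>|lebesgue. (lam * p (\<rho> x) + q (\<rho> x)) * (Y x * \<Phi> x)) =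
     lam * (LINT x:\<Omega>|lebesgue. \<Phi> x * (p (\<rho> x) * Y x)) + (LINT x:\<Omega>|lebesgue. q (\<rho> x) * (Y x * \<Phi> x))"
  proof -
    have sub: "J0 \<subseteq> {a..b}" by auto
    have i: "set_integrable lebesgue \<Omega> (\<lambda>x. Y x * \<Phi> x)"
      by (intro set_integrable_off_center_mult has_lb_continuous(1)[OF lb] H1_set_integrable(1)[OF G(1)])
    have ii: "set_integrable lebesgue \<Omega> (\<lambda>x. f (\<rho> x) * (Y x * \<Phi> x))" if f: "continuous_on {a..b} f" for f :: "real \<Rightarrow> real"
    proof -
      obtain B where "B \<ge> 0" and B: "\<And>t. t \<in> {a..b} \<Longrightarrow> \<bar>f t\<bar> \<le> B" using continuous_on_Icc_bound[OF f] by blast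
      show ?thesis by (rule set_integrable_radial_mult[OF continuous_on_subset[OF f sub] _ i, of B]) (use B in auto)
    qed
    have "(LINT x:\<Omega>|lebesgue. (lam * p (\<rho> x) + q (\<rho> x)) * (Y x * \<Phi> x)) =
      (LINT x:\<Omega>|lebesgue. lam * p (\<rho> x) * (Y x * \<Phi> x) + q (\<rho> x) * (Y x * \<Phi> x))" by (simp add: distrib_right)
    also have "\<dots> = (LINT x:\<Omega>|lebesgue. lam * p (\<rho> x) * (Y x * \<Phi> x)) + (LINT x:\<Omega>|lebesgue. q (\<rho> x) * (Y x * \<Phi> x))"
      by (rule set_integral_add(2)[OF ii[OF continuous_on_mult_left[OF pc]] ii[OF q]])
    also have "(LINT x:\<Omega>|lebesgue. lam * p (\<rho> x) * (Y x * \<Phi> x)) = (LINT x:\<Omega>|lebesgue. lam * (\<Phi> x * (p (\<rho> x) * Y x)))"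
      by (simp add: mult_ac)
    finally show ?thesis by simp
  qed
  ultimately show ?thesis by simp
qed

text \<open>Green's identity without source is the weak equation. The product is not null: it is
  continuous and nonzero at \<open>x0\<close>, since \<open>p\<close> is positive at
  \<open>r\<close>.\<close>

lemma tp_efun_radial_mult:
  assumes sh: "shooting \<Lambda> lam p w" "w b = 0" and Y: "harmonic0 c \<Lambda> Y"
    and pos: "\<And>t. t \<in> {a..b} \<Longrightarrow> p t > 0" and x0: "x0 \<in> sphere c r" "Y x0 \<noteq> 0"
  shows "tp_efun c r sm sp e lam (\<lambda>x. p (\<rho> x) * Y x)"
proof -
  obtain DY D2Y where lb: "has_lb c Y DY D2Y (\<lambda>x. - \<Lambda> * Y x)" using Y by (auto simp: harmonic0_def)
  have sol: "radial_sol \<Lambda> (\<lambda>t. lam * p t) p w" "w a = 0" using sh by (auto simp: shooting_def)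
  have pc: "continuous_on {a..b} p" using sol by (auto simp: radial_sol_def)
  have "\<not> (AE x in lebesgue. x \<in> \<Omega> \<longrightarrow> p (\<rho> x) * Y x = 0)"
  proof
    assume "AE x in lebesgue. x \<in> \<Omega> \<longrightarrow> p (\<rho> x) * Y x = 0"
    moreover have "continuous_on \<Omega> (\<lambda>x. p (\<rho> x) * Y x)"
      by (intro continuous_intros continuous_on_compose2[OF pc] continuous_on_subset[OF has_lb_continuous(1)[OF lb]])
        (use center_notin in \<open>auto simp: Omega_iff\<close>)
    moreover have "x0 \<in> \<Omega>" using x0(1) rab unfolding mem_shell_iff by (simp add: Omega_iff)
    ultimately have "p (\<rho> x0) * Y x0 = 0" using AE_zero_imp_zero[OF open_Omega] by blast
    then show False using pos[of "\<rho> x0"] \<open>x0 \<in> \<Omega>\<close> x0 by (auto simp: Omega_iff)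
  qed
  moreover have "(LINT x:\<Omega>|lebesgue. sigma_coef c r sm sp e x * (radial_grad p w Y DY x \<bullet> H x)) =
      lam * (LINT x:\<Omega>|lebesgue. p (\<rho> x) * Y x * \<psi> x)" if H: "H1_on \<Omega> \<psi> H" for \<psi> H
  proof -
    have "(LINT x:\<Omega>|lebesgue. sigma_coef c r sm sp e x * (radial_grad p w Y DY x \<bullet> H x)) =
      (LINT x:\<Omega>|lebesgue. lam * p (\<rho> x) * (Y x * \<psi> x))"
      unfolding sigma_coef_integral by (rule green_identity[OF H lb sol sh(2)]) (intro continuous_intros pc)
    then show ?thesis by (simp add: mult.assoc)
  qed
  ultimately show ?thesis
    using H1_on_radial_mult[OF sol(1) lb] unfolding tp_efun_def Let_def by blast
qed

end

section \<open>The Laplace--Beltrami spectrum\<close>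

text \<open>Gaussian elimination: an unknown that occurs in the last equation is expressed by the
  others. Indexing the unknowns by a set \<open>J\<close> allows one to be dropped.\<close>

lemma underdetermined_system:
  fixes v :: "nat \<Rightarrow> 'j \<Rightarrow> real"
  assumes "finite J" "m < card J"
  shows "\<exists>\<alpha>. (\<exists>j\<in>J. \<alpha> j \<noteq> 0) \<and> (\<forall>i<m. (\<Sum>j\<in>J. \<alpha> j * v i j) = 0)"
  using assms
proof (induction m arbitrary: J v)
  case 0
  then have "J \<noteq> {}" by auto
  then show ?case by (intro exI[of _ "\<lambda>_. 1"]) auto
next
  case (Suc m)
  show ?case
  proof (cases "\<forall>j\<in>J. v m j = 0")
    case True
    obtain \<alpha> where \<alpha>: "\<exists>j\<in>J. \<alpha> j \<noteq> 0" "\<forall>i<m. (\<Sum>j\<in>J. \<alpha> j * v i j) = 0"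
      using Suc.IH[OF Suc.prems(1), of v] Suc.prems(2) by force
    then show ?thesis using True by (intro exI[of _ \<alpha>]) (auto simp: less_Suc_eq)
  next
    case False
    then obtain j0 where j0: "j0 \<in> J" "v m j0 \<noteq> 0" by blast
    define J' where "J' = J - {j0}"
    define v' where "v' i j = v i j - v i j0 / v m j0 * v m j" for i j
    have J': "finite J'" "m < card J'" using Suc.prems j0 by (auto simp: J'_def)
    obtain \<alpha> where \<alpha>: "\<exists>j\<in>J'. \<alpha> j \<noteq> 0" "\<And>i. i < m \<Longrightarrow> (\<Sum>j\<in>J'. \<alpha> j * v' i j) = 0"
      using Suc.IH[OF J', of v'] by blast
    define s where "s = (\<Sum>j\<in>J'. \<alpha> j * v m j)"
    define \<beta> where "\<beta> j = (if j = j0 then - s / v m j0 else \<alpha> j)" for j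
    have split: "(\<Sum>j\<in>J. \<beta> j * v i j) = - s / v m j0 * v i j0 + (\<Sum>j\<in>J'. \<alpha> j * v i j)" for i
    proof -
      have "(\<Sum>j\<in>J. \<beta> j * v i j) = \<beta> j0 * v i j0 + (\<Sum>j\<in>J'. \<beta> j * v i j)"
        unfolding J'_def by (rule sum.remove[OF Suc.prems(1) j0(1)])
      also have "(\<Sum>j\<in>J'. \<beta> j * v i j) = (\<Sum>j\<in>J'. \<alpha> j * v i j)"
        by (intro sum.cong) (auto simp: \<beta>_def J'_def)
      finally show ?thesis by (simp add: \<beta>_def)
    qed
    have "(\<Sum>j\<in>J. \<beta> j * v i j) = 0" if i: "i < Suc m" for i
    proof (cases "i = m")
      case True
      then show ?thesis unfolding split using j0 by (simp add: s_def)
    next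
      case False
      then have "(\<Sum>j\<in>J'. \<alpha> j * v' i j) = 0" using i \<alpha>(2) by simp
      moreover have "(\<Sum>j\<in>J'. \<alpha> j * v' i j) = (\<Sum>j\<in>J'. \<alpha> j * v i j) - v i j0 / v m j0 * s"
        unfolding v'_def s_def right_diff_distrib sum_subtractf sum_distrib_left
        by (simp add: mult.left_commute)
      ultimately show ?thesis unfolding split by (simp add: mult.commute)
    qed
    moreover have "\<exists>j\<in>J. \<beta> j \<noteq> 0" using \<alpha>(1) by (auto simp: \<beta>_def J'_def)
    ultimately show ?thesis by blast
  qed
qed

text \<open>The rank alternative for the vectors \<open>C y\<close> in R^k: they lie in a hyperplane
  or \<open>k\<close> of them are independent. \<open>E\<close> carries no linear structure; it will
  be the set of sphere eigenfunctions below a threshold.\<close>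

lemma annihilator_or_independent:
  fixes C :: "'y \<Rightarrow> nat \<Rightarrow> real"
  shows "(\<exists>\<alpha>. (\<exists>j<k. \<alpha> j \<noteq> 0) \<and> (\<forall>y\<in>E. (\<Sum>j<k. \<alpha> j * C y j) = 0)) \<or>
    (\<exists>y. (\<forall>i<k. y i \<in> E) \<and> (\<forall>\<beta>. (\<forall>j<k. (\<Sum>i<k. \<beta> i * C (y i) j) = 0) \<longrightarrow> (\<forall>i<k. \<beta> i = 0)))"
proof (rule disjCI)
  assume no: "\<not> (\<exists>y. (\<forall>i<k. y i \<in> E) \<and> (\<forall>\<beta>. (\<forall>j<k. (\<Sum>i<k. \<beta> i * C (y i) j) = 0) \<longrightarrow> (\<forall>i<k. \<beta> i = 0)))"
  show "\<exists>\<alpha>. (\<exists>j<k. \<alpha> j \<noteq> 0) \<and> (\<forall>y\<in>E. (\<Sum>j<k. \<alpha> j * C y j) = 0)"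
  proof (rule ccontr)
    assume no': "\<not> ?thesis"
    have "\<exists>y. (\<forall>i<m. y i \<in> E) \<and> (\<forall>\<beta>. (\<forall>j<k. (\<Sum>i<m. \<beta> i * C (y i) j) = 0) \<longrightarrow> (\<forall>i<m. \<beta> i = 0))" if "m \<le> k" for m
      using that
    proof (induction m)
      case (Suc m)
      then obtain y where y: "\<forall>i<m. y i \<in> E" "\<And>\<beta>. (\<forall>j<k. (\<Sum>i<m. \<beta> i * C (y i) j) = 0) \<Longrightarrow> (\<forall>i<m. \<beta> i = 0)"
        by auto
      \<comment> \<open>\<alpha> is normal to the vectors chosen so far, so a vector that it does
        not annihilate is independent of them.\<close>
      obtain \<alpha> where \<alpha>: "\<exists>j\<in>{..<k}. \<alpha> j \<noteq> 0" "\<And>i. i < m \<Longrightarrow> (\<Sum>j<k. \<alpha> j * C (y i) j) = 0"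
        using underdetermined_system[of "{..<k}" m "\<lambda>i j. C (y i) j"] Suc.prems by auto
      then obtain z where z: "z \<in> E" "(\<Sum>j<k. \<alpha> j * C z j) \<noteq> 0" using no' by blast
      define y' where "y' = y(m := z)"
      have "\<beta> i = 0" if \<beta>: "\<forall>j<k. (\<Sum>i<Suc m. \<beta> i * C (y' i) j) = 0" and i: "i < Suc m" for \<beta> i
      proof -
        have e: "(\<Sum>i<Suc m. \<beta> i * C (y' i) j) = (\<Sum>i<m. \<beta> i * C (y i) j) + \<beta> m * C z j" for j
          by (simp add: y'_def)
        have "0 = (\<Sum>j<k. \<alpha> j * ((\<Sum>i<m. \<beta> i * C (y i) j) + \<beta> m * C z j))"
          using \<beta> unfolding e by simp
        also have "\<dots> = (\<Sum>j<k. \<Sum>i<m. \<beta> i * (\<alpha> j * C (y i) j)) + \<beta> m * (\<Sum>j<k. \<alpha> j * C z j)"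
          by (simp add: distrib_left sum.distrib sum_distrib_left mult.left_commute)
        also have "(\<Sum>j<k. \<Sum>i<m. \<beta> i * (\<alpha> j * C (y i) j)) = (\<Sum>i<m. \<beta> i * (\<Sum>j<k. \<alpha> j * C (y i) j))"
          by (subst sum.swap) (simp add: sum_distrib_left)
        also have "\<dots> = 0" using \<alpha>(2) by simp
        finally have "\<beta> m = 0" using z(2) by simp
        moreover have "\<forall>i<m. \<beta> i = 0" using \<beta> \<open>\<beta> m = 0\<close> unfolding e by (intro y(2)) simp
        ultimately show ?thesis using i by (auto simp: less_Suc_eq)
      qed
      moreover have "\<forall>i<Suc m. y' i \<in> E" using y(1) z(1) by (auto simp: y'_def less_Suc_eq)
      ultimately show ?case by blast
    qed simp
    from this[of k] no show False by blast
  qed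
qed

lemma harmonic0_homogeneous:
  assumes "harmonic0 c \<Lambda> Y" "r > 0" "x \<noteq> c"
  shows "Y (c + (r / norm (x - c)) *\<^sub>R (x - c)) = Y x"
  using assms unfolding harmonic0_def has_lb_def by auto

lemma radial_projection_in_sphere:
  assumes "r > 0" "x \<noteq> (c :: 'a::real_normed_vector)"
  shows "c + (r / norm (x - c)) *\<^sub>R (x - c) \<in> sphere c r"
  using assms by (simp add: dist_norm)

text \<open>The real part of \<open>(x\<^sub>1 + i x\<^sub>2)\<^sup>m\<close> is a harmonic polynomial, so every
  \<open>m (m + n - 2)\<close> is an eigenvalue.\<close>

lemma harmonic0_exists:
  assumes dim: "DIM('a::euclidean_space) \<ge> 2"
  obtains Y e1 where "harmonic0 (c :: 'a) (lb_eigenvalue TYPE('a) m) Y" "e1 \<in> Basis" "\<And>t. t > 0 \<Longrightarrow> Y (c + t *\<^sub>R e1) = 1"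
proof -
  have "\<not> card (Basis :: 'a set) \<le> Suc 0" using dim by simp
  then obtain e1 e2 :: 'a where e: "e1 \<in> Basis" "e2 \<in> Basis" "e1 \<noteq> e2"
    using card_le_Suc0_iff_eq[of "Basis :: 'a set"] by auto
  define z where "z x = Complex (x \<bullet> e1) (x \<bullet> e2)" for x :: 'a
  have z_alt: "z x = of_real (x \<bullet> e1) + \<i> * of_real (x \<bullet> e2)" for x by (simp add: z_def complex_eq_iff)
  have zd: "(z has_derivative z) (at x)" for x
    unfolding z_alt[abs_def] by (auto intro!: derivative_eq_intros)
  have zc: "continuous_on UNIV z" unfolding z_alt[abs_def] by (intro continuous_intros)
  have zn: "((\<lambda>x. z x ^ n) has_derivative (\<lambda>v. of_nat n * z v * z x ^ (n - 1))) (at x)" for n x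
    by (rule has_derivative_eq_rhs, rule has_derivative_power[OF zd]) (simp add: mult_ac)
  define D where "D x v = Re (of_nat m * z v * z x ^ (m - 1))" for x v
  define E where "E v x u = Re (of_nat m * z v * (of_nat (m - 1) * z u * z x ^ (m - 2)))" for v x u
  have Dd: "((\<lambda>x. Re (z x ^ m)) has_derivative D x) (at x)" for x
    unfolding D_def[abs_def] by (rule bounded_linear.has_derivative[OF bounded_linear_Re zn])
  have Ed: "((\<lambda>x. D x v) has_derivative E v x) (at x)" for v x
    unfolding D_def[abs_def] E_def[abs_def]
    by (rule bounded_linear.has_derivative[OF bounded_linear_Re])
      (use has_derivative_mult_right[OF zn[of "m - 1" x], of "of_nat m * z v"] in \<open>simp add: numeral_2_eq_2\<close>)
  have Ec: "continuous_on UNIV (\<lambda>x. E v x u)" for v u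
    unfolding E_def by (intro continuous_intros zc)
  have hom: "Re (z (t *\<^sub>R x) ^ m) = t ^ m * Re (z x ^ m)" for t x
  proof -
    have "z (t *\<^sub>R x) = of_real t * z x" by (simp add: z_def complex_eq_iff)
    then have "z (t *\<^sub>R x) ^ m = of_real (t ^ m) * z x ^ m" by (simp add: power_mult_distrib)
    then show ?thesis by simp
  qed
  have euler: "D x x = m * Re (z x ^ m)" for x
  proof (cases m)
    case 0
    then show ?thesis by (simp add: D_def)
  next
    case (Suc n)
    have "of_nat m * z x * z x ^ (m - 1) = of_real (real m) * z x ^ m" by (simp add: Suc mult.assoc)
    then have "D x x = Re (of_real (real m) * z x ^ m)" unfolding D_def by (simp only:)
    also have "\<dots> = m * Re (z x ^ m)" by simp
    finally show ?thesis .
  qed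
  \<comment> \<open>The values of \<open>z\<close> are 1 at \<open>e1\<close>, the imaginary unit at
    \<open>e2\<close> and 0 at the other basis vectors; that their squares sum to 0 makes every
    power of \<open>z\<close> harmonic.\<close>
  have zz: "(\<Sum>i\<in>Basis. z i * z i) = 0"
  proof -
    have "z i * z i = (if i = e1 then 1 else 0) - (if i = e2 then 1 else 0)" if "i \<in> Basis" for i
      using e that by (auto simp: z_def complex_eq_iff inner_Basis)
    then show ?thesis using e by (simp add: sum_subtractf)
  qed
  have "(\<Sum>i\<in>Basis. E i x i) = 0" for x
  proof -
    have "(\<Sum>i\<in>Basis. E i x i) = Re (\<Sum>i\<in>Basis. (of_nat m * of_nat (m - 1) * z x ^ (m - 2)) * (z i * z i))"
      unfolding E_def Re_sum by (intro sum.cong refl arg_cong[where f = Re]) (simp add: mult_ac)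
    then show ?thesis unfolding sum_distrib_left[symmetric] zz by simp
  qed
  then have LP: "0 = (\<Sum>i\<in>Basis. E i x i)" for x by simp
  let ?Y = "\<lambda>x. Re (z (x - c) ^ m) / norm (x - c) ^ m"
  obtain DY D2Y where lb: "has_lb c ?Y DY D2Y (\<lambda>x. 0 / norm (x - c) ^ (m - 2) - m * (m + real DIM('a) - 2) * ?Y x)"
    using homogeneous_has_lb[where P = "\<lambda>x. Re (z x ^ m)" and LP = "\<lambda>x. 0" and c = c, OF Dd Ed Ec hom euler LP] by auto
  have "harmonic0 c (lb_eigenvalue TYPE('a) m) ?Y"
    unfolding harmonic0_def using has_lb_cong[OF lb, of "\<lambda>x. - lb_eigenvalue TYPE('a) m * ?Y x"] by auto
  moreover have "?Y (c + t *\<^sub>R e1) = 1" if "t > 0" for t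
  proof -
    have "z (t *\<^sub>R e1) = of_real t" using e by (simp add: z_def complex_eq_iff inner_Basis)
    then have "Re (z (t *\<^sub>R e1) ^ m) = t ^ m" by (simp add: Re_power_real)
    then show ?thesis using that e by simp
  qed
  ultimately show ?thesis using that e(1) by blast
qed

section \<open>Orthogonality of angular eigenfunctions and the spectrum of the sphere\<close>

context shell
begin

lemma H1_on_harmonic0:
  assumes "has_lb c Y DY D2Y K"
  shows "H1_on \<Omega> Y (radial_grad (\<lambda>_. 1) (\<lambda>_. 0) Y DY)"
proof -
  \<comment> \<open>The \<Lambda> of \<open>H1_on_radial_mult\<close> is not tied to
    \<open>Y\<close>, so the constant factor 1 with flux 0 and \<Lambda> = 0 may be used.\<close>
  have "radial_sol 0 (\<lambda>_. 0) (\<lambda>_. 1) (\<lambda>_. 0)" unfolding radial_sol_def by auto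
  from H1_on_radial_mult[OF this assms] show ?thesis by simp
qed

text \<open>With the radial weight \<rho>^(m+2), whose surplus \<rho>^2 cancels the denominator,
  \<open>weak_tangential\<close> expresses both \<Lambda> and \<Lambda>' times the integral by the
  same symmetric form in the two gradients.\<close>

lemma harmonic0_orthogonal:
  assumes Y: "harmonic0 c \<Lambda> Y" and Z: "harmonic0 c \<Lambda>' Z" and ne: "\<Lambda> \<noteq> \<Lambda>'"
  shows "(LINT x:\<Omega>|lebesgue. \<rho> x ^ m * (Y x * Z x)) = 0"
proof -
  obtain DY D2Y where lY: "has_lb c Y DY D2Y (\<lambda>x. - \<Lambda> * Y x)" using Y by (auto simp: harmonic0_def)
  obtain DZ D2Z where lZ: "has_lb c Z DZ D2Z (\<lambda>x. - \<Lambda>' * Z x)" using Z by (auto simp: harmonic0_def)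
  have grad: "radial_grad (\<lambda>_. 1) (\<lambda>_. 0) W DW x \<bullet> i = DW x i" if "i \<in> Basis" for W DW x i
    using that by (simp add: radial_grad_def inner_sum_left inner_Basis if_distrib cong: if_cong)
  let ?q = "\<lambda>t :: real. t ^ (m + 2)"
  have q: "(?q has_real_derivative real (m + 2) * t ^ (m + 1)) (at t)" for t
    using DERIV_pow[of "m + 2" t] by simp
  have qc: "continuous_on J0 (\<lambda>t :: real. real (m + 2) * t ^ (m + 1))" by (intro continuous_intros)
  have qB: "\<bar>?q t\<bar> \<le> b ^ (m + 2)" if "t \<in> {a<..<b}" for t
  proof -
    have "t ^ (m + 2) \<le> b ^ (m + 2)" "0 \<le> t ^ (m + 2)" using that a0 by (intro power_mono zero_le_power; simp)+
    then show ?thesis by (simp only: abs_of_nonneg)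
  qed
  have tang: "(LINT x:\<Omega>|lebesgue. ?q (\<rho> x) * (\<Lambda> / (\<rho> x)\<^sup>2 * Y x * Z x)) =
      (LINT x:\<Omega>|lebesgue. ?q (\<rho> x) * (\<Sum>i\<in>Basis. DY x i * DZ x i))"
    if lY: "has_lb c Y DY D2Y (\<lambda>x. - \<Lambda> * Y x)" and lZ: "has_lb c Z DZ D2Z (\<lambda>x. - \<Lambda>' * Z x)"
    for \<Lambda> \<Lambda>' Y DY D2Y Z DZ D2Z
    using weak_tangential[OF H1_on_harmonic0[OF lZ] lY q qc qB] grad by simp
  have e: "(LINT x:\<Omega>|lebesgue. ?q (\<rho> x) * (\<Lambda> / (\<rho> x)\<^sup>2 * Y x * Z x)) = \<Lambda> * (LINT x:\<Omega>|lebesgue. \<rho> x ^ m * (Y x * Z x))" for \<Lambda> Y Z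
  proof -
    have "(LINT x:\<Omega>|lebesgue. ?q (\<rho> x) * (\<Lambda> / (\<rho> x)\<^sup>2 * Y x * Z x)) = (LINT x:\<Omega>|lebesgue. \<Lambda> * (\<rho> x ^ m * (Y x * Z x)))"
    proof (rule set_integral_cong_Omega)
      fix x assume "x \<in> \<Omega>"
      then have "\<rho> x > 0" by (rule rho_pos)
      then show "?q (\<rho> x) * (\<Lambda> / (\<rho> x)\<^sup>2 * Y x * Z x) = \<Lambda> * (\<rho> x ^ m * (Y x * Z x))"
        by (simp add: power_add power2_eq_square)
    qed
    then show ?thesis by simp
  qed
  have "\<Lambda> * (LINT x:\<Omega>|lebesgue. \<rho> x ^ m * (Y x * Z x)) = \<Lambda>' * (LINT x:\<Omega>|lebesgue. \<rho> x ^ m * (Z x * Y x))"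
    using tang[OF lY lZ] tang[OF lZ lY] unfolding e by (simp add: mult.commute)
  then show ?thesis using ne by (simp add: mult.commute)
qed

lemma harmonic0_norm_zero:
  assumes Y: "harmonic0 c \<Lambda> Y" and z: "(LINT x:\<Omega>|lebesgue. Y x * Y x) = 0" and x: "x \<in> \<Omega>"
  shows "Y x = 0"
proof -
  note cY = continuous_harmonic0[OF Y]
  have "set_integrable lebesgue \<Omega> (\<lambda>x. Y x * (Y x * 1))"
    by (intro set_integrable_off_center_mult set_integrable_const cY)
  then have "integrable lebesgue (\<lambda>x. indicat_real \<Omega> x *\<^sub>R (Y x * Y x))" by (simp add: set_integrable_def)
  then have "AE x in lebesgue. indicat_real \<Omega> x *\<^sub>R (Y x * Y x) = 0"
    using z unfolding set_lebesgue_integral_def by (subst (asm) integral_nonneg_eq_0_iff_AE) auto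
  then have "AE x in lebesgue. x \<in> \<Omega> \<longrightarrow> Y x = 0" by eventually_elim (auto simp: indicator_def)
  moreover have "continuous_on \<Omega> Y" using cY center_notin by (elim continuous_on_subset) auto
  ultimately show ?thesis using AE_zero_imp_zero[OF open_Omega] x by blast
qed

text \<open>For any other \<Lambda> the function would be orthogonal to all the products \<rho>^m Y
  in \<open>complete_harmonic0\<close>, hence zero.\<close>

lemma harmonic0_spectrum:
  assumes dim: "DIM('a) \<ge> 2" and Y: "harmonic0 c \<Lambda> Y" and x: "x \<in> \<Omega>" "Y x \<noteq> 0"
  shows "\<exists>l. \<Lambda> = lb_eigenvalue TYPE('a) l"
proof (rule ccontr)
  assume no: "\<not> ?thesis"
  note cY = continuous_harmonic0[OF Y]
  have "set_integrable lebesgue \<Omega> (\<lambda>x. Y x * 1)"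
    by (intro set_integrable_off_center_mult set_integrable_const cY)
  then have i: "set_integrable lebesgue \<Omega> Y" by simp
  have "AE x in lebesgue. x \<in> \<Omega> \<longrightarrow> Y x = 0"
    by (rule complete_harmonic0[OF dim i]) (use no in \<open>intro harmonic0_orthogonal[OF _ Y], auto\<close>)
  moreover have "continuous_on \<Omega> Y" using cY center_notin by (elim continuous_on_subset) auto
  ultimately show False using AE_zero_imp_zero[OF open_Omega] x by blast
qed

text \<open>Integration against \<open>Y i\<close> isolates the coefficient
  \<open>\<alpha> i\<close>, the eigenvalues being distinct.\<close>

lemma harmonic0_independent:
  fixes k :: nat
  assumes Y: "\<And>m. m < k \<Longrightarrow> harmonic0 c (ev m) (Y m)" and ev: "inj_on ev {..<k}"
    and nz: "\<And>m. m < k \<Longrightarrow> \<exists>x\<in>\<Omega>. Y m x \<noteq> 0" and zero: "\<And>x. x \<in> \<Omega> \<Longrightarrow> (\<Sum>m<k. \<alpha> m * Y m x) = 0"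
    and i: "i < k"
  shows "\<alpha> i = 0"
proof -
  have int: "set_integrable lebesgue \<Omega> (\<lambda>x. Y m x * (Y i x * 1))" if "m < k" for m
    using that i by (intro set_integrable_off_center_mult set_integrable_const continuous_harmonic0[OF Y])
  have "0 = (LINT x:\<Omega>|lebesgue. 0 * Y i x)" by simp
  also have "\<dots> = (LINT x:\<Omega>|lebesgue. (\<Sum>m<k. \<alpha> m * (Y m x * Y i x)))"
    by (rule set_integral_cong_Omega) (use zero in \<open>simp add: sum_distrib_right[symmetric] mult.assoc[symmetric]\<close>)
  also have "\<dots> = (\<Sum>m<k. LINT x:\<Omega>|lebesgue. \<alpha> m * (Y m x * Y i x))"
    by (rule set_integral_sum_finite) (use int in auto)
  also have "\<dots> = (\<Sum>m<k. if m = i then \<alpha> i * (LINT x:\<Omega>|lebesgue. Y i x * Y i x) else 0)"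
  proof (intro sum.cong refl)
    fix m assume m: "m \<in> {..<k}"
    have "(LINT x:\<Omega>|lebesgue. Y m x * Y i x) = 0" if "m \<noteq> i"
      using harmonic0_orthogonal[OF Y[of m] Y[OF i], of 0] ev that m i by (auto simp: inj_on_def)
    then show "(LINT x:\<Omega>|lebesgue. \<alpha> m * (Y m x * Y i x)) = (if m = i then \<alpha> i * (LINT x:\<Omega>|lebesgue. Y i x * Y i x) else 0)"
      by simp
  qed
  also have "\<dots> = \<alpha> i * (LINT x:\<Omega>|lebesgue. Y i x * Y i x)" using i by simp
  finally have "\<alpha> i = 0 \<or> (LINT x:\<Omega>|lebesgue. Y i x * Y i x) = 0" by simp
  then show ?thesis using harmonic0_norm_zero[OF Y[OF i]] nz[OF i] by blast
qed

end

text \<open>The set under the infimum in \<open>LB_eig\<close>, named in order to show that it has a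
  least element.\<close>

definition LB_bounds :: "'a::euclidean_space \<Rightarrow> real \<Rightarrow> nat \<Rightarrow> real set" where
  "LB_bounds c r k = {\<mu>. \<exists>fs :: nat \<Rightarrow> 'a \<Rightarrow> real.
      (\<forall>j<k. \<exists>lam. lam \<le> \<mu> \<and> LB_efun c r lam (fs j)) \<and>
      (\<forall>\<alpha>::nat \<Rightarrow> real. (\<forall>x\<in>sphere c r. (\<Sum>j<k. \<alpha> j * fs j x) = 0) \<longrightarrow> (\<forall>j<k. \<alpha> j = 0))}"

lemma LB_efun_spectrum:
  fixes c :: "'a::euclidean_space"
  assumes dim: "DIM('a) \<ge> 2" and r: "r > 0" and f: "LB_efun c r lam f"
  shows "\<exists>l. lam = lb_eigenvalue TYPE('a) l / r\<^sup>2"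
proof -
  \<comment> \<open>An auxiliary shell without a jump: volume integrals over it replace surface
    integrals over the sphere.\<close>
  interpret shell c r "r/2" 1 1 using r by unfold_locales auto
  obtain x where x: "x \<in> sphere c r" "f x \<noteq> 0" using f by (auto simp: LB_efun_def)
  have n: "norm (x - c) = r" using x(1) unfolding mem_shell_iff .
  have "x \<in> Omega_eps c r (r/2)" using n r by (simp add: Omega_iff)
  moreover have "f (c + (r / norm (x - c)) *\<^sub>R (x - c)) \<noteq> 0" using x n r by simp
  ultimately obtain l where "lam * r\<^sup>2 = lb_eigenvalue TYPE('a) l"
    using harmonic0_spectrum[OF dim LB_efun_imp_harmonic0[OF f r]] by blast
  then show ?thesis using r by (intro exI[of _ l]) (simp add: field_simps)
qed

text \<open>One explicit eigenfunction of each degree below \<open>k\<close> is enough, as distinct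
  eigenvalues make them independent.\<close>

lemma LB_bounds_nonempty:
  fixes c :: "'a::euclidean_space"
  assumes dim: "DIM('a) \<ge> 2" and r: "r > 0"
  shows "LB_bounds c r k \<noteq> {}"
proof -
  interpret shell c r "r/2" 1 1 using r by unfold_locales auto
  let ?ev = "lb_eigenvalue TYPE('a)"
  have "\<forall>m. \<exists>Y. harmonic0 c (?ev m) Y \<and> (\<exists>e1\<in>Basis. \<forall>t>0. Y (c + t *\<^sub>R e1) = 1)"
    using harmonic0_exists[OF dim, of c] by metis
  then obtain Y where Y: "\<And>m. harmonic0 c (?ev m) (Y m)" "\<And>m. \<exists>e1\<in>Basis. \<forall>t>0. Y m (c + t *\<^sub>R e1) = 1"
    by metis
  have nz: "\<exists>x\<in>sphere c r. Y m x \<noteq> 0" for m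
  proof -
    obtain e1 where "e1 \<in> Basis" "\<forall>t>0. Y m (c + t *\<^sub>R e1) = 1" using Y(2) by blast
    then show ?thesis using r by (intro bexI[of _ "c + r *\<^sub>R e1"]) (auto simp: dist_norm)
  qed
  have sub: "sphere c r \<subseteq> Omega_eps c r (r/2)" using r by (auto simp: Omega_iff dist_norm norm_minus_commute)
  have "?ev k / r\<^sup>2 \<in> LB_bounds c r k"
    unfolding LB_bounds_def
  proof (intro CollectI exI[of _ Y] conjI allI impI)
    fix j assume j: "j < k"
    show "\<exists>lam. lam \<le> ?ev k / r\<^sup>2 \<and> LB_efun c r lam (Y j)"
      using harmonic0_imp_LB_efun[OF Y(1)[of j] r] nz[of j] strict_mono_lb_eigenvalue[OF dim j]
      by (intro exI[of _ "?ev j / r\<^sup>2"]) (auto intro!: divide_right_mono)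
  next
    fix \<alpha> :: "nat \<Rightarrow> real" and i
    assume z: "\<forall>x\<in>sphere c r. (\<Sum>j<k. \<alpha> j * Y j x) = 0" and i: "i < k"
    show "\<alpha> i = 0"
    proof (rule harmonic0_independent[where ev = ?ev and Y = Y and k = k])
      show "inj_on ?ev {..<k}"
        by (rule strict_mono_on_imp_inj_on) (auto simp: strict_mono_on_def intro: strict_mono_lb_eigenvalue[OF dim])
      show "\<exists>x\<in>Omega_eps c r (r/2). Y m x \<noteq> 0" for m using nz[of m] sub by blast
      fix x assume "x \<in> Omega_eps c r (r/2)"
      then have xc: "x \<noteq> c" using center_notin by blast
      have "(\<Sum>m<k. \<alpha> m * Y m x) = (\<Sum>m<k. \<alpha> m * Y m (c + (r / norm (x - c)) *\<^sub>R (x - c)))"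
        using harmonic0_homogeneous[OF Y(1) r xc] by simp
      also have "\<dots> = 0" using z radial_projection_in_sphere[OF r xc] by blast
      finally show "(\<Sum>m<k. \<alpha> m * Y m x) = 0" .
    qed (use Y(1) i in auto)
  qed
  then show ?thesis by blast
qed

text \<open>An admissible bound can be lowered to the largest eigenvalue occurring in its family,
  which belongs to a sequence increasing in \<open>l\<close>; so well-ordering of the naturals gives
  a minimum.\<close>

lemma LB_eig_attained:
  fixes c :: "'a::euclidean_space"
  assumes dim: "DIM('a) \<ge> 2" and r: "r > 0" and k: "k \<ge> 1"
  shows "LB_eig c r k \<in> LB_bounds c r k" "\<And>\<mu>. \<mu> \<in> LB_bounds c r k \<Longrightarrow> LB_eig c r k \<le> \<mu>"
    "\<exists>l. LB_eig c r k = lb_eigenvalue TYPE('a) l / r\<^sup>2"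
proof -
  let ?ev = "\<lambda>l. lb_eigenvalue TYPE('a) l / r\<^sup>2"
  have ex: "\<exists>l. ?ev l \<in> LB_bounds c r k \<and> ?ev l \<le> \<mu>" if \<mu>: "\<mu> \<in> LB_bounds c r k" for \<mu>
  proof -
    obtain fs where fs: "\<And>j. j < k \<Longrightarrow> \<exists>lam. lam \<le> \<mu> \<and> LB_efun c r lam (fs j)"
      "\<And>\<alpha>::nat \<Rightarrow> real. (\<forall>x\<in>sphere c r. (\<Sum>j<k. \<alpha> j * fs j x) = 0) \<Longrightarrow> (\<forall>j<k. \<alpha> j = 0)"
      using \<mu> unfolding LB_bounds_def by blast
    obtain lam where lam: "\<And>j. j < k \<Longrightarrow> lam j \<le> \<mu> \<and> LB_efun c r (lam j) (fs j)" using fs(1) by metis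
    define M where "M = Max (lam ` {..<k})"
    have "0 \<in> {..<k}" using k by simp
    then have fin: "finite (lam ` {..<k})" "lam ` {..<k} \<noteq> {}" by blast+
    have "M \<in> lam ` {..<k}" unfolding M_def by (rule Max_in[OF fin])
    then obtain j where j: "j < k" "M = lam j" by blast
    obtain l where l: "lam j = ?ev l" using LB_efun_spectrum[OF dim r] lam[OF j(1)] by blast
    have le: "lam i \<le> M" if "i < k" for i unfolding M_def using fin that by (intro Max_ge) auto
    have "M \<in> LB_bounds c r k" unfolding LB_bounds_def
      by (intro CollectI exI[of _ fs] conjI allI impI) (use lam le fs(2) in blast)+
    then show ?thesis using l j lam[OF j(1)] by (intro exI[of _ l]) auto
  qed
  define l0 where "l0 = (LEAST l. ?ev l \<in> LB_bounds c r k)"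
  obtain l1 where "?ev l1 \<in> LB_bounds c r k" using ex LB_bounds_nonempty[OF dim r, of c k] by blast
  then have l0: "?ev l0 \<in> LB_bounds c r k" unfolding l0_def by (rule LeastI)
  have min: "?ev l0 \<le> \<mu>" if \<mu>: "\<mu> \<in> LB_bounds c r k" for \<mu>
  proof -
    obtain l where l: "?ev l \<in> LB_bounds c r k" "?ev l \<le> \<mu>" using ex[OF \<mu>] by blast
    have "l0 \<le> l" unfolding l0_def by (rule Least_le) (rule l(1))
    then have "lb_eigenvalue TYPE('a) l0 \<le> lb_eigenvalue TYPE('a) l"
      using strict_mono_lb_eigenvalue[OF dim, of l0 l] by (cases "l0 = l") auto
    then have "?ev l0 \<le> ?ev l" by (intro divide_right_mono) auto
    then show ?thesis using l(2) by linarith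
  qed
  have "LB_eig c r k = Inf (LB_bounds c r k)" by (simp add: LB_eig_def LB_bounds_def)
  also have "\<dots> = ?ev l0" by (rule cInf_eq_minimum[OF l0 min])
  finally have "LB_eig c r k = ?ev l0" .
  then show "LB_eig c r k \<in> LB_bounds c r k" "\<And>\<mu>. \<mu> \<in> LB_bounds c r k \<Longrightarrow> LB_eig c r k \<le> \<mu>"
    "\<exists>l. LB_eig c r k = ?ev l" using l0 min by auto
qed

section \<open>Comparison of the spectra\<close>

definition tp_bounds :: "'a::euclidean_space \<Rightarrow> real \<Rightarrow> real \<Rightarrow> real \<Rightarrow> real \<Rightarrow> nat \<Rightarrow> real set" where
  "tp_bounds c r sm sp \<epsilon> k = {\<mu>. \<exists>\<Phi>s :: nat \<Rightarrow> 'a \<Rightarrow> real.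
      (\<forall>j<k. \<exists>lam. lam \<le> \<mu> \<and> tp_efun c r sm sp \<epsilon> lam (\<Phi>s j)) \<and>
      (\<forall>\<alpha>::nat \<Rightarrow> real. (AE x in lebesgue. x \<in> Omega_eps c r \<epsilon> \<longrightarrow> (\<Sum>j<k. \<alpha> j * \<Phi>s j x) = 0)
          \<longrightarrow> (\<forall>j<k. \<alpha> j = 0))}"

lemma lb_eigenvalue_nonneg:
  assumes "DIM('a::euclidean_space) \<ge> 2" shows "lb_eigenvalue TYPE('a) l \<ge> 0"
  using assms by (intro mult_nonneg_nonneg) auto

locale thin = shell c r e sm sp + thin_shell r e sm sp "DIM('a)" L M
  for c :: "'a::euclidean_space" and r e sm sp L M
begin

text \<open>Off the roots the radial Neumann problem is solvable for every \<open>q\<close>.\<close>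

lemma tp_efun_orthogonal_resolvent:
  assumes tp: "tp_efun c r sm sp e lam \<Phi>" and lam: "lam \<le> M" and Y: "harmonic0 c \<Lambda> Y" and \<Lambda>: "0 \<le> \<Lambda>"
    and nroot: "\<not> root \<Lambda> lam" and q: "continuous_on {a..b} q"
  shows "(LINT x:\<Omega>|lebesgue. q (\<rho> x) * (Y x * \<Phi> x)) = 0"
proof -
  obtain p1 w1 where sh: "shooting \<Lambda> lam p1 w1" using shooting_exists by blast
  have "w1 b \<noteq> 0" using nroot sh by (auto simp: root_def)
  then obtain p w where "radial_sol \<Lambda> (\<lambda>t. lam * p t + q t) p w" "w a = 0" "w b = 0"
    using radial_neumann_solvable[OF sh \<Lambda> tp_efun_nonneg[OF tp] lam q] by blast
  then show ?thesis by (rule tp_efun_orthogonal[OF tp Y _ _ _ q])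
qed

text \<open>At a root the functional \<open>q \<mapsto> \<integral> q(\<rho>) Y \<Phi>\<close> annihilates the range of the radial operator, which has
  codimension one; so it is determined by its value at \<open>q = 1\<close>, with a factor independent of \<open>\<Phi>\<close>.\<close>

lemma tp_efun_functional_at_root:
  assumes \<Lambda>: "0 \<le> \<Lambda>" and q: "continuous_on {a..b} q"
  obtains \<kappa> where "\<And>\<Phi> lam Y. tp_efun c r sm sp e lam \<Phi> \<Longrightarrow> lam \<le> M \<Longrightarrow> harmonic0 c \<Lambda> Y \<Longrightarrow>
     (LINT x:\<Omega>|lebesgue. q (\<rho> x) * (Y x * \<Phi> x)) = \<kappa> * (LINT x:\<Omega>|lebesgue. Y x * \<Phi> x)"
proof (cases "\<exists>lam. root \<Lambda> lam \<and> 0 \<le> lam \<and> lam \<le> M")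
  case False
  have "(LINT x:\<Omega>|lebesgue. q (\<rho> x) * (Y x * \<Phi> x)) = 0 * (LINT x:\<Omega>|lebesgue. Y x * \<Phi> x)"
    if "tp_efun c r sm sp e lam \<Phi>" "lam \<le> M" "harmonic0 c \<Lambda> Y" for \<Phi> lam Y
    using tp_efun_orthogonal_resolvent[OF that \<Lambda> _ q] False tp_efun_nonneg[OF that(1)] that(2) by auto
  then show ?thesis by (rule that)
next
  case True
  then obtain \<nu> where \<nu>: "root \<Lambda> \<nu>" "0 \<le> \<nu>" "\<nu> \<le> M" by blast
  obtain p1 w1 where sh: "shooting \<Lambda> \<nu> p1 w1" "w1 b = 0" using \<nu>(1) by (auto simp: root_def)
  have p1c: "continuous_on {a..b} p1" using sh by (auto simp: shooting_def radial_sol_def)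
  let ?N = "DIM('a)"
  have ic: "(\<lambda>t. t ^ (?N - 1) * (f t * p1 t)) integrable_on {a..b}" if "continuous_on {a..b} f" for f
    by (intro integrable_continuous_real continuous_intros that p1c)
  define I where "I = integral {a..b} (\<lambda>t. t ^ (?N - 1) * (1 * p1 t))"
  \<comment> \<open>The mean of \<open>q\<close> with respect to the weight t^(n-1) p1 is the
    constant for which q - \<kappa> meets the solvability condition.\<close>
  define \<kappa> where "\<kappa> = integral {a..b} (\<lambda>t. t ^ (?N - 1) * (q t * p1 t)) / I"
  have pos: "t ^ (?N - 1) * (1 * p1 t) > 0" if "t \<in> {a..b}" for t
    using shooting_pos[OF sh(1) \<Lambda> \<nu>(2,3) that] that a0 by auto
  have I: "I \<noteq> 0"
  proof
    assume "I = 0"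
    then have "((\<lambda>t. t ^ (?N - 1) * (1 * p1 t)) has_integral 0) (cbox a b)"
      using ic[of "\<lambda>_. 1"] by (simp add: I_def has_integral_iff)
    then have z0: "a ^ (?N - 1) * (1 * p1 a) = 0"
      by (rule has_integral_0_cbox_imp_0[rotated 2])
        (use pos ab in \<open>auto intro!: continuous_intros p1c less_imp_le\<close>)
    have "a \<in> {a..b}" using ab by auto
    from pos[OF this] z0 show False by linarith
  qed
  have i2: "(\<lambda>t. \<kappa> * (t ^ (?N - 1) * (1 * p1 t))) integrable_on {a..b}"
    by (intro integrable_continuous_real continuous_intros p1c)
  have q': "continuous_on {a..b} (\<lambda>t. q t - \<kappa>)" by (intro continuous_intros q)
  have "integral {a..b} (\<lambda>t. t ^ (?N - 1) * ((q t - \<kappa>) * p1 t)) =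
      integral {a..b} (\<lambda>t. t ^ (?N - 1) * (q t * p1 t) - \<kappa> * (t ^ (?N - 1) * (1 * p1 t)))"
    by (intro integral_cong) (simp add: algebra_simps)
  also have "\<dots> = integral {a..b} (\<lambda>t. t ^ (?N - 1) * (q t * p1 t)) - \<kappa> * I"
    unfolding I_def integral_diff[OF ic[OF q] i2] by simp
  also have "\<dots> = 0" using I by (simp add: \<kappa>_def)
  finally have z: "integral {a..b} (\<lambda>t. t ^ (?N - 1) * ((q t - \<kappa>) * p1 t)) = 0" .
  obtain p w where sol: "radial_sol \<Lambda> (\<lambda>t. \<nu> * p t + (q t - \<kappa>)) p w" "w a = 0" "w b = 0"
    using radial_neumann_solvable[OF sh(1) \<Lambda> \<nu>(2,3) q'] z by blast
  have "(LINT x:\<Omega>|lebesgue. q (\<rho> x) * (Y x * \<Phi> x)) = \<kappa> * (LINT x:\<Omega>|lebesgue. Y x * \<Phi> x)"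
    if tp: "tp_efun c r sm sp e lam \<Phi>" and lam: "lam \<le> M" and Y: "harmonic0 c \<Lambda> Y" for \<Phi> lam Y
  proof (cases "root \<Lambda> lam")
    case True
    have "lam = \<nu>" by (rule root_unique[OF True \<nu>(1) \<Lambda> tp_efun_nonneg[OF tp] lam \<nu>(2,3)])
    then have 0: "(LINT x:\<Omega>|lebesgue. (q (\<rho> x) - \<kappa>) * (Y x * \<Phi> x)) = 0"
      using tp_efun_orthogonal[OF tp Y, of p "\<lambda>t. q t - \<kappa>" w] sol q' by blast
    have "H1_on \<Omega> \<Phi> (SOME G. H1_on \<Omega> \<Phi> G)" using tp someI_ex[of "H1_on \<Omega> \<Phi>"] unfolding tp_efun_def Let_def by blast
    then have i: "set_integrable lebesgue \<Omega> (\<lambda>x. Y x * \<Phi> x)"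
      by (intro set_integrable_off_center_mult continuous_harmonic0[OF Y] H1_set_integrable(1))
    have iq: "set_integrable lebesgue \<Omega> (\<lambda>x. q (\<rho> x) * (Y x * \<Phi> x))"
    proof -
      have sub: "J0 \<subseteq> {a..b}" by auto
      obtain B where "B \<ge> 0" and B: "\<And>t. t \<in> {a..b} \<Longrightarrow> \<bar>q t\<bar> \<le> B" using continuous_on_Icc_bound[OF q] by blast
      show ?thesis by (rule set_integrable_radial_mult[OF continuous_on_subset[OF q sub] _ i, of B]) (use B in auto)
    qed
    have ik: "set_integrable lebesgue \<Omega> (\<lambda>x. \<kappa> * (Y x * \<Phi> x))" using i by simp
    have "(LINT x:\<Omega>|lebesgue. q (\<rho> x) * (Y x * \<Phi> x)) - (LINT x:\<Omega>|lebesgue. \<kappa> * (Y x * \<Phi> x)) = 0"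
      using 0 unfolding left_diff_distrib set_integral_diff(2)[OF iq ik] .
    then show ?thesis by simp
  next
    case False
    then show ?thesis
      using tp_efun_orthogonal_resolvent[OF tp lam Y \<Lambda> False q] tp_efun_orthogonal_resolvent[OF tp lam Y \<Lambda> False, of "\<lambda>_. 1"]
      by simp
  qed
  then show ?thesis by (rule that)
qed

text \<open>Each sphere eigenfunction is lifted by its own radial factor, and monotonicity of roots
  keeps the lifted eigenvalues at most \<nu>. On the interface the positive factors merely rescale
  coefficients, so independence is inherited from the sphere.\<close>

lemma tp_bounds_upper:
  assumes dim: "DIM('a) \<ge> 2" and \<mu>: "\<mu> \<in> LB_bounds c r k"
    and L: "\<mu> * r\<^sup>2 \<le> L" and M: "\<mu> * r\<^sup>2 * (sm + sp) < M * (r/2)\<^sup>2"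
    and \<nu>: "root (\<mu> * r\<^sup>2) \<nu>" "0 \<le> \<nu>" "\<nu> \<le> M"
  shows "\<nu> \<in> tp_bounds c r sm sp e k"
proof -
  obtain fs where fs: "\<And>j. j < k \<Longrightarrow> \<exists>lam. lam \<le> \<mu> \<and> LB_efun c r lam (fs j)"
    and ind: "\<And>\<alpha>::nat \<Rightarrow> real. (\<forall>x\<in>sphere c r. (\<Sum>j<k. \<alpha> j * fs j x) = 0) \<Longrightarrow> (\<forall>j<k. \<alpha> j = 0)"
    using \<mu> unfolding LB_bounds_def by blast
  define F where "F j x = fs j (c + (r / norm (x - c)) *\<^sub>R (x - c))" for j x
  have Fs: "F j x = fs j x" if "x \<in> sphere c r" for j x
    using that r0 unfolding mem_shell_iff by (simp add: F_def)
  have "\<forall>j. \<exists>p. j < k \<longrightarrow> continuous_on {a..b} p \<and> (\<forall>t\<in>{a..b}. p t > 0) \<and>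
     (\<exists>lam. lam \<le> \<nu> \<and> tp_efun c r sm sp e lam (\<lambda>x. p (\<rho> x) * F j x))"
  proof
    fix j
    show "\<exists>p. j < k \<longrightarrow> continuous_on {a..b} p \<and> (\<forall>t\<in>{a..b}. p t > 0) \<and>
     (\<exists>lam. lam \<le> \<nu> \<and> tp_efun c r sm sp e lam (\<lambda>x. p (\<rho> x) * F j x))"
    proof (cases "j < k")
      case True
      obtain lam where lam: "lam \<le> \<mu>" "LB_efun c r lam (fs j)" using fs[OF True] by blast
      obtain l where l: "lam = lb_eigenvalue TYPE('a) l / r\<^sup>2" using LB_efun_spectrum[OF dim r0 lam(2)] by blast
      define \<Lambda> where "\<Lambda> = lam * r\<^sup>2"
      have \<Lambda>0: "0 \<le> \<Lambda>" unfolding \<Lambda>_def l using lb_eigenvalue_nonneg[OF dim, of l] r0 by simp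
      have \<Lambda>le: "\<Lambda> \<le> \<mu> * r\<^sup>2" unfolding \<Lambda>_def using lam(1) by (intro mult_right_mono) auto
      have h: "harmonic0 c \<Lambda> (F j)" unfolding \<Lambda>_def F_def[abs_def] by (rule LB_efun_imp_harmonic0[OF lam(2) r0])
      have "\<Lambda> * (sm + sp) \<le> \<mu> * r\<^sup>2 * (sm + sp)" using \<Lambda>le sm0 sp0 by (intro mult_right_mono) auto
      then have "\<Lambda> * (sm + sp) < M * (r/2)\<^sup>2" "\<Lambda> \<le> L" using M L \<Lambda>le by linarith+
      then obtain \<nu>' where \<nu>': "0 \<le> \<nu>'" "\<nu>' \<le> M" "root \<Lambda> \<nu>'"
        using root_exists[OF \<Lambda>0] by blast
      have le: "\<nu>' \<le> \<nu>" by (rule root_mono[OF \<nu>'(3) \<nu>(1) \<Lambda>0 \<Lambda>le \<nu>'(1,2) \<nu>(2,3)])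
      obtain p w where sh: "shooting \<Lambda> \<nu>' p w" "w b = 0" using \<nu>'(3) by (auto simp: root_def)
      have pos: "p t > 0" if "t \<in> {a..b}" for t by (rule shooting_pos[OF sh(1) \<Lambda>0 \<nu>'(1,2) that])
      obtain x0 where x0: "x0 \<in> sphere c r" "fs j x0 \<noteq> 0" using lam(2) by (auto simp: LB_efun_def)
      have "tp_efun c r sm sp e \<nu>' (\<lambda>x. p (\<rho> x) * F j x)"
        by (rule tp_efun_radial_mult[OF sh h pos x0(1)]) (use x0 Fs in auto)
      moreover have "continuous_on {a..b} p" using sh by (auto simp: shooting_def radial_sol_def)
      ultimately show ?thesis using pos le by blast
    qed simp
  qed
  then obtain p where p: "\<And>j. j < k \<Longrightarrow> continuous_on {a..b} (p j)" "\<And>j t. j < k \<Longrightarrow> t \<in> {a..b} \<Longrightarrow> p j t > 0"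
    "\<And>j. j < k \<Longrightarrow> \<exists>lam. lam \<le> \<nu> \<and> tp_efun c r sm sp e lam (\<lambda>x. p j (\<rho> x) * F j x)"
    by metis
  have cF: "continuous_on \<Omega> (F j)" if j: "j < k" for j
  proof -
    obtain lam where "LB_efun c r lam (fs j)" using fs[OF j] by blast
    from continuous_harmonic0[OF LB_efun_imp_harmonic0[OF this r0]]
    show ?thesis unfolding F_def[abs_def] using center_notin by (elim continuous_on_subset) auto
  qed
  show ?thesis unfolding tp_bounds_def
  proof (intro CollectI exI[of _ "\<lambda>j x. p j (\<rho> x) * F j x"] conjI allI impI)
    show "\<exists>lam. lam \<le> \<nu> \<and> tp_efun c r sm sp e lam (\<lambda>x. p j (\<rho> x) * F j x)" if "j < k" for j
      by (rule p(3)[OF that])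
    fix \<alpha> :: "nat \<Rightarrow> real" and j
    assume z: "AE x in lebesgue. x \<in> \<Omega> \<longrightarrow> (\<Sum>j<k. \<alpha> j * (p j (\<rho> x) * F j x)) = 0" and j: "j < k"
    have cs: "continuous_on \<Omega> (\<lambda>x. \<Sum>j<k. \<alpha> j * (p j (\<rho> x) * F j x))"
    proof (intro continuous_on_sum continuous_on_mult continuous_on_const cF)
      fix j assume "j \<in> {..<k}"
      then show "continuous_on \<Omega> (\<lambda>x. p j (\<rho> x))"
        by (intro continuous_on_compose2[OF p(1)[of j]] continuous_intros) (auto simp: Omega_iff)
    qed auto
    have rI: "r \<in> {a..b}" using rab by auto
    have "(\<Sum>j<k. (\<alpha> j * p j r) * fs j x) = 0" if x: "x \<in> sphere c r" for x
    proof -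
      have \<rho>: "\<rho> x = r" using x unfolding mem_shell_iff .
      then have "x \<in> \<Omega>" using rab by (simp add: Omega_iff)
      from AE_zero_imp_zero[OF open_Omega cs z this] show ?thesis by (simp add: \<rho> Fs[OF x] mult.assoc)
    qed
    then have "\<alpha> j * p j r = 0" using ind[of "\<lambda>j. \<alpha> j * p j r"] j by blast
    then show "\<alpha> j = 0" using p(2)[OF j rI] by simp
  qed
qed

text \<open>Suppose \<beta> < \<nu>. By minimality of \<mu> there are no \<open>k\<close>
  independent sphere eigenfunctions below \<mu>, so a nontrivial combination of the \<open>k\<close>
  shell eigenfunctions pairs to zero with all of those. For \<Lambda> \<ge> \<mu> r^2 the pairings
  vanish anyway, since a root there is at least \<nu>. Completeness makes the combination 0, against
  independence.\<close>

lemma tp_bounds_lower: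
  assumes dim: "DIM('a) \<ge> 2" and k: "k \<ge> 1" and min: "\<And>\<mu>'. \<mu>' \<in> LB_bounds c r k \<Longrightarrow> \<mu> \<le> \<mu>'" and \<mu>0: "0 \<le> \<mu>"
    and \<nu>: "root (\<mu> * r\<^sup>2) \<nu>" "0 \<le> \<nu>" "\<nu> \<le> M" and \<beta>: "\<beta> \<in> tp_bounds c r sm sp e k"
  shows "\<nu> \<le> \<beta>"
proof (rule ccontr)
  assume less: "\<not> \<nu> \<le> \<beta>"
  obtain \<Phi> where \<Phi>: "\<And>j. j < k \<Longrightarrow> \<exists>lam. lam \<le> \<beta> \<and> tp_efun c r sm sp e lam (\<Phi> j)"
    and ind: "\<And>\<alpha>::nat \<Rightarrow> real. (AE x in lebesgue. x \<in> \<Omega> \<longrightarrow> (\<Sum>j<k. \<alpha> j * \<Phi> j x) = 0) \<Longrightarrow> (\<forall>j<k. \<alpha> j = 0)"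
    using \<beta> unfolding tp_bounds_def by blast
  obtain lam where lam: "\<And>j. j < k \<Longrightarrow> lam j \<le> \<beta>" and tp: "\<And>j. j < k \<Longrightarrow> tp_efun c r sm sp e (lam j) (\<Phi> j)"
    using \<Phi> by metis
  have lamM: "lam j \<le> M" if "j < k" for j using lam[OF that] less \<nu>(3) by linarith
  have \<Phi>i: "set_integrable lebesgue \<Omega> (\<Phi> j)" if j: "j < k" for j
  proof -
    obtain G where "H1_on \<Omega> (\<Phi> j) G" using tp[OF j] unfolding tp_efun_def Let_def by blast
    then show ?thesis by (rule H1_set_integrable)
  qed
  define ext where "ext f x = f (c + (r / norm (x - c)) *\<^sub>R (x - c))" for f :: "'a \<Rightarrow> real" and x
  define E where "E = {f. \<exists>lam<\<mu>. LB_efun c r lam f}"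
  define C where "C f j = (LINT x:\<Omega>|lebesgue. ext f x * \<Phi> j x)" for f j
  have extc: "continuous_on (- {c}) (ext f)" if "f \<in> E" for f
  proof -
    obtain lam where "LB_efun c r lam f" using \<open>f \<in> E\<close> unfolding E_def by blast
    from continuous_harmonic0[OF LB_efun_imp_harmonic0[OF this r0]] show ?thesis by (simp add: ext_def[abs_def])
  qed
  \<comment> \<open>Otherwise \<open>k\<close> of the vectors \<open>C y\<close> are independent,
    hence so are the functions \<open>y\<close> themselves; their largest eigenvalue would be an
    admissible bound below \<mu>.\<close>
  have "\<exists>\<alpha>. (\<exists>j<k. \<alpha> j \<noteq> 0) \<and> (\<forall>y\<in>E. (\<Sum>j<k. \<alpha> j * C y j) = 0)"
  proof (rule ccontr)
    assume "\<not> ?thesis"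
    then obtain y where y: "\<And>i. i < k \<Longrightarrow> y i \<in> E"
      "\<And>\<beta>. (\<forall>j<k. (\<Sum>i<k. \<beta> i * C (y i) j) = 0) \<Longrightarrow> (\<forall>i<k. \<beta> i = 0)"
      using annihilator_or_independent[of k E C] by blast
    obtain lam' where lam': "\<And>i. i < k \<Longrightarrow> lam' i < \<mu>" "\<And>i. i < k \<Longrightarrow> LB_efun c r (lam' i) (y i)"
      using y(1) unfolding E_def by simp metis
    define m where "m = Max (lam' ` {..<k})"
    have "0 \<in> {..<k}" using k by simp
    then have fin: "finite (lam' ` {..<k})" "lam' ` {..<k} \<noteq> {}" by blast+
    have le: "lam' i \<le> m" if "i < k" for i unfolding m_def using fin that by (intro Max_ge) auto
    have "m < \<mu>" unfolding m_def using fin lam'(1) by (subst Max_less_iff) auto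
    moreover have "m \<in> LB_bounds c r k"
      unfolding LB_bounds_def
    proof (intro CollectI exI[of _ y] conjI allI impI)
      show "\<exists>lam. lam \<le> m \<and> LB_efun c r lam (y j)" if "j < k" for j using le[OF that] lam'(2)[OF that] by blast
      fix \<beta> :: "nat \<Rightarrow> real" and i assume z: "\<forall>x\<in>sphere c r. (\<Sum>j<k. \<beta> j * y j x) = 0" and i: "i < k"
      have "(\<Sum>i<k. \<beta> i * C (y i) j) = 0" if j: "j < k" for j
      proof -
        have ii: "set_integrable lebesgue \<Omega> (\<lambda>x. \<beta> i * (ext (y i) x * \<Phi> j x))" if "i \<in> {..<k}" for i
          using set_integrable_off_center_mult[OF extc[OF y(1)[of i]] \<Phi>i[OF j]] that by simp
        have "(LINT x:\<Omega>|lebesgue. (\<Sum>i<k. \<beta> i * (ext (y i) x * \<Phi> j x))) = (\<Sum>i<k. LINT x:\<Omega>|lebesgue. \<beta> i * (ext (y i) x * \<Phi> j x))"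
          by (rule set_integral_sum_finite[OF ii])
        then have "(\<Sum>i<k. \<beta> i * C (y i) j) = (LINT x:\<Omega>|lebesgue. (\<Sum>i<k. \<beta> i * (ext (y i) x * \<Phi> j x)))"
          by (simp add: C_def)
        also have "\<dots> = (LINT x:\<Omega>|lebesgue. 0)"
        proof (rule set_integral_cong_Omega)
          fix x assume "x \<in> \<Omega>"
          then have "x \<noteq> c" using center_notin by blast
          then have "(\<Sum>i<k. \<beta> i * ext (y i) x) = 0"
            unfolding ext_def using z radial_projection_in_sphere[OF r0] by blast
          then have "(\<Sum>i<k. \<beta> i * ext (y i) x) * \<Phi> j x = 0" by simp
          then show "(\<Sum>i<k. \<beta> i * (ext (y i) x * \<Phi> j x)) = 0" by (simp add: sum_distrib_right mult.assoc)
        qed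
        finally show ?thesis by (simp add: set_lebesgue_integral_def)
      qed
      then show "\<beta> i = 0" using y(2) i by blast
    qed
    ultimately show False using min[of m] by linarith
  qed
  then obtain \<alpha> where \<alpha>: "\<exists>j<k. \<alpha> j \<noteq> 0" "\<And>y. y \<in> E \<Longrightarrow> (\<Sum>j<k. \<alpha> j * C y j) = 0" by blast
  have "AE x in lebesgue. x \<in> \<Omega> \<longrightarrow> (\<Sum>j<k. \<alpha> j * \<Phi> j x) = 0"
  proof (rule complete_harmonic0[OF dim])
    have "set_integrable lebesgue \<Omega> (\<lambda>x. \<alpha> j * \<Phi> j x)" if "j \<in> {..<k}" for j using \<Phi>i that by simp
    then show "set_integrable lebesgue \<Omega> (\<lambda>x. \<Sum>j<k. \<alpha> j * \<Phi> j x)"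
      unfolding set_integrable_def scaleR_sum_right by (rule Bochner_Integration.integrable_sum)
    fix Y l m assume Y: "harmonic0 c (lb_eigenvalue TYPE('a) l) Y"
    let ?\<Lambda> = "lb_eigenvalue TYPE('a) l"
    have \<Lambda>0: "0 \<le> ?\<Lambda>" by (rule lb_eigenvalue_nonneg[OF dim])
    have q: "continuous_on {a..b} (\<lambda>t. t ^ m)" by (intro continuous_intros)
    have i: "set_integrable lebesgue \<Omega> (\<lambda>x. \<alpha> j * (\<rho> x ^ m * (Y x * \<Phi> j x)))" if "j \<in> {..<k}" for j
    proof -
      have "set_integrable lebesgue \<Omega> (\<lambda>x. \<rho> x ^ m * (Y x * \<Phi> j x))"
        using that by (intro set_integrable_off_center_mult continuous_intros continuous_harmonic0[OF Y] \<Phi>i) auto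
      then show ?thesis by simp
    qed
    have "(LINT x:\<Omega>|lebesgue. \<rho> x ^ m * (Y x * (\<Sum>j<k. \<alpha> j * \<Phi> j x))) = (LINT x:\<Omega>|lebesgue. (\<Sum>j<k. \<alpha> j * (\<rho> x ^ m * (Y x * \<Phi> j x))))"
      by (intro set_integral_cong_Omega) (simp add: sum_distrib_left mult_ac)
    also have "\<dots> = (\<Sum>j<k. LINT x:\<Omega>|lebesgue. \<alpha> j * (\<rho> x ^ m * (Y x * \<Phi> j x)))"
      by (rule set_integral_sum_finite[OF i])
    also have "\<dots> = (\<Sum>j<k. \<alpha> j * (LINT x:\<Omega>|lebesgue. \<rho> x ^ m * (Y x * \<Phi> j x)))" by simp
    also have "\<dots> = 0"
    \<comment> \<open>Below the threshold the functional at the root reduces every weight \<rho>^m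
      to the pairings in \<open>C\<close>, which \<alpha> annihilates.\<close>
    proof (cases "?\<Lambda> < \<mu> * r\<^sup>2 \<and> (\<exists>x\<in>sphere c r. Y x \<noteq> 0)")
      case True
      then obtain x where x: "x \<in> sphere c r" "Y x \<noteq> 0" by blast
      have "?\<Lambda> / r\<^sup>2 < \<mu>" using True r0 by (simp add: pos_divide_less_eq)
      then have YE: "Y \<in> E" unfolding E_def using harmonic0_imp_LB_efun[OF Y r0 x] by blast
      obtain \<kappa> where \<kappa>: "\<And>\<Phi> lam Y. tp_efun c r sm sp e lam \<Phi> \<Longrightarrow> lam \<le> M \<Longrightarrow> harmonic0 c ?\<Lambda> Y \<Longrightarrow>
         (LINT x:\<Omega>|lebesgue. \<rho> x ^ m * (Y x * \<Phi> x)) = \<kappa> * (LINT x:\<Omega>|lebesgue. Y x * \<Phi> x)"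
        using tp_efun_functional_at_root[OF \<Lambda>0 q] by blast
      have "(LINT x:\<Omega>|lebesgue. Y x * \<Phi> j x) = C Y j" for j
        unfolding C_def
      proof (rule set_integral_cong_Omega)
        fix x assume "x \<in> \<Omega>"
        then have "x \<noteq> c" using center_notin by blast
        then show "Y x * \<Phi> j x = ext Y x * \<Phi> j x"
          unfolding ext_def using harmonic0_homogeneous[OF Y r0] by simp
      qed
      then have "(\<Sum>j<k. \<alpha> j * (LINT x:\<Omega>|lebesgue. \<rho> x ^ m * (Y x * \<Phi> j x))) = (\<Sum>j<k. \<kappa> * (\<alpha> j * C Y j))"
        by (intro sum.cong refl) (use \<kappa>[OF tp lamM Y] in simp)
      also have "\<dots> = 0" using \<alpha>(2)[OF YE] by (simp add: sum_distrib_left[symmetric])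
      finally show ?thesis .
    next
      case False
      have "(LINT x:\<Omega>|lebesgue. \<rho> x ^ m * (Y x * \<Phi> j x)) = 0" if j: "j < k" for j
      proof (cases "\<exists>x\<in>sphere c r. Y x \<noteq> 0")
        case True
        then have ge: "\<mu> * r\<^sup>2 \<le> ?\<Lambda>" using False by auto
        have "\<not> root ?\<Lambda> (lam j)"
        proof
          assume R: "root ?\<Lambda> (lam j)"
          have "\<nu> \<le> lam j"
            using root_mono[OF \<nu>(1) R _ ge \<nu>(2,3) tp_efun_nonneg[OF tp[OF j]] lamM[OF j]] \<mu>0 by simp
          then show False using lam[OF j] less by linarith
        qed
        then show ?thesis using tp_efun_orthogonal_resolvent[OF tp[OF j] lamM[OF j] Y \<Lambda>0 _ q] by blast
      next
        case no: False
        have "(LINT x:\<Omega>|lebesgue. \<rho> x ^ m * (Y x * \<Phi> j x)) = (LINT x:\<Omega>|lebesgue. 0)"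
        proof (rule set_integral_cong_Omega)
          fix x assume "x \<in> \<Omega>"
          then have "x \<noteq> c" using center_notin by blast
          then have "Y x = 0" using harmonic0_homogeneous[OF Y r0] radial_projection_in_sphere[OF r0] no by metis
          then show "\<rho> x ^ m * (Y x * \<Phi> j x) = 0" by simp
        qed
        then show ?thesis by (simp add: set_lebesgue_integral_def)
      qed
      then show ?thesis by simp
    qed
    finally show "(LINT x:\<Omega>|lebesgue. \<rho> x ^ m * (Y x * (\<Sum>j<k. \<alpha> j * \<Phi> j x))) = 0" .
  qed
  then show False using ind[of \<alpha>] \<alpha>(1) by blast
qed

lemma tp_eig_eq_root:
  assumes dim: "DIM('a) \<ge> 2" and k: "k \<ge> 1"
    and L: "LB_eig c r k * r\<^sup>2 \<le> L" and M: "LB_eig c r k * r\<^sup>2 * (sm + sp) < M * (r/2)\<^sup>2"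
  obtains \<nu> where "root (LB_eig c r k * r\<^sup>2) \<nu>" "0 \<le> \<nu>" "\<nu> \<le> M" "tp_eig c r sm sp e k = \<nu>"
proof -
  note att = LB_eig_attained[OF dim r0 k, where c = c]
  have \<mu>0: "0 \<le> LB_eig c r k" using att(3) lb_eigenvalue_nonneg[OF dim] by auto
  obtain \<nu> where \<nu>: "0 \<le> \<nu>" "\<nu> \<le> M" "root (LB_eig c r k * r\<^sup>2) \<nu>"
    using root_exists[OF _ L M] \<mu>0 by auto
  have "tp_eig c r sm sp e k = Inf (tp_bounds c r sm sp e k)" by (simp add: tp_eig_def tp_bounds_def)
  also have "\<dots> = \<nu>"
    by (rule cInf_eq_minimum[OF tp_bounds_upper[OF dim att(1) L M \<nu>(3,1,2)] tp_bounds_lower[OF dim k att(2) \<mu>0 \<nu>(3,1,2)]])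
  finally show ?thesis using that \<nu> by blast
qed

end

section \<open>Asymptotics\<close>

text \<open>The mean value inequality, applied twice. Real exponents are used because n - 3 is
  negative for n = 2; the interval contains every shell with \<open>e \<le> r / 2\<close>.\<close>

lemma powr_second_order:
  fixes r \<alpha> :: real
  assumes r: "r > 0"
  obtains K where "K \<ge> 0" "\<And>s. s \<in> {r/2..3*r/2} \<Longrightarrow>
    \<bar>s powr \<alpha> - (r powr \<alpha> + \<alpha> * r powr (\<alpha> - 1) * (s - r))\<bar> \<le> K * (s - r)\<^sup>2"
proof -
  let ?I = "{r/2..3*r/2}"
  let ?f'' = "\<lambda>s. \<alpha> * ((\<alpha> - 1) * s powr (\<alpha> - 1 - 1))"
  have pos: "s > 0" if "s \<in> ?I" for s using that r by auto
  have "continuous_on ?I ?f''" by (intro continuous_intros) (use r in auto)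
  then have "bounded (?f'' ` ?I)" by (intro compact_imp_bounded compact_continuous_image) auto
  then obtain B where B: "\<forall>y\<in>?f'' ` ?I. norm y \<le> B" unfolding bounded_iff by blast
  have rI: "r \<in> ?I" using r by auto
  have B0: "B \<ge> 0" using B rI norm_ge_zero order_trans by (metis image_eqI)
  have d1: "((\<lambda>s. \<alpha> * s powr (\<alpha> - 1)) has_real_derivative ?f'' s) (at s within S)" if "s \<in> ?I" for s S
    by (rule has_field_derivative_at_within) (use pos[OF that] in \<open>auto intro!: derivative_eq_intros has_real_derivative_powr\<close>)
  have lip: "\<bar>\<alpha> * s powr (\<alpha> - 1) - \<alpha> * r powr (\<alpha> - 1)\<bar> \<le> B * \<bar>s - r\<bar>" if s: "s \<in> ?I" for s
    using field_differentiable_bound[OF convex_closed_interval d1 _ s rI, of B] B by (auto simp: box_real)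
  have "\<bar>s powr \<alpha> - (r powr \<alpha> + \<alpha> * r powr (\<alpha> - 1) * (s - r))\<bar> \<le> B * (s - r)\<^sup>2" if s: "s \<in> ?I" for s
  proof -
    let ?S = "closed_segment r s"
    have sub: "?S \<subseteq> ?I" using rI s closed_segment_subset[of r ?I s] by auto
    let ?g = "\<lambda>u. u powr \<alpha> - \<alpha> * r powr (\<alpha> - 1) * (u - r)"
    have d: "(?g has_real_derivative \<alpha> * u powr (\<alpha> - 1) - \<alpha> * r powr (\<alpha> - 1)) (at u within ?S)" if "u \<in> ?S" for u
    proof (rule has_field_derivative_at_within)
      have "u > 0" using pos sub that by blast
      then have "(?g has_real_derivative \<alpha> * u powr (\<alpha> - 1) - \<alpha> * r powr (\<alpha> - 1) * (1 - 0)) (at u)"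
        by (intro DERIV_diff DERIV_cmult has_real_derivative_powr DERIV_ident DERIV_const)
      then show "(?g has_real_derivative \<alpha> * u powr (\<alpha> - 1) - \<alpha> * r powr (\<alpha> - 1)) (at u)" by simp
    qed
    have b: "norm (\<alpha> * u powr (\<alpha> - 1) - \<alpha> * r powr (\<alpha> - 1)) \<le> B * \<bar>s - r\<bar>" if u: "u \<in> ?S" for u
    proof -
      have "\<bar>u - r\<bar> \<le> \<bar>s - r\<bar>" using u by (auto simp: closed_segment_eq_real_ivl split: if_splits)
      then have "B * \<bar>u - r\<bar> \<le> B * \<bar>s - r\<bar>" using B0 by (intro mult_left_mono)
      then show ?thesis using lip[of u] u sub by force
    qed
    have "norm (?g s - ?g r) \<le> (B * \<bar>s - r\<bar>) * norm (s - r)"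
      by (rule field_differentiable_bound[OF convex_closed_segment d b]) auto
    then show ?thesis by (simp add: power2_eq_square algebra_simps abs_mult[symmetric])
  qed
  then show ?thesis using that B0 by blast
qed

lemma power_eq_powr:
  assumes "s > 0" "N \<ge> (1::nat)"
  shows "s ^ (N - 1) = s powr (real N - 1)" "s ^ (N - 1) / s\<^sup>2 = s powr (real N - 3)"
proof -
  show 1: "s ^ (N - 1) = s powr (real N - 1)" using assms by (simp add: powr_realpow[symmetric] of_nat_diff)
  have "s\<^sup>2 = s powr 2" using assms by (simp add: powr_numeral)
  then show "s ^ (N - 1) / s\<^sup>2 = s powr (real N - 3)" unfolding 1 by (simp add: powr_diff[symmetric])
qed

text \<open>The point is that \<open>K\<close> does not depend on \<open>e\<close>. In the vanishing
  integral of the flux equation, replacing \<open>p\<close> by 1 and the powers of t by their linear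
  parts costs O(e^2) pointwise, so O(e^3) after integration; dividing by 2 e r^(n-1) leaves
  O(e^2).\<close>

lemma root_asymptotics:
  fixes r sm sp L M :: real and N :: nat
  assumes r: "r > 0" and N: "N \<ge> 1"
  obtains K where "\<And>e \<Lambda> \<nu>. thin_shell r e sm sp N L M \<Longrightarrow> thin_shell.root r e sm sp N \<Lambda> \<nu> \<Longrightarrow>
     0 \<le> \<Lambda> \<Longrightarrow> \<Lambda> \<le> L \<Longrightarrow> 0 \<le> \<nu> \<Longrightarrow> \<nu> \<le> M \<Longrightarrow>
     \<bar>\<nu> - ((sm + sp) / 2 * (\<Lambda> / r\<^sup>2) + (real N - 3) / (4 * r) * (sp - sm) * (\<Lambda> / r\<^sup>2) * e)\<bar> \<le> K * e\<^sup>2"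
proof -
  define \<phi> where "\<phi> = r powr (real N - 1)"
  define \<psi> where "\<psi> = r powr (real N - 3)"
  define \<phi>' where "\<phi>' = (real N - 1) * r powr (real N - 1 - 1)"
  define \<psi>' where "\<psi>' = (real N - 3) * r powr (real N - 3 - 1)"
  obtain K1 where K1: "K1 \<ge> 0" "\<And>s. s \<in> {r/2..3*r/2} \<Longrightarrow> \<bar>s powr (real N - 1) - (\<phi> + \<phi>' * (s - r))\<bar> \<le> K1 * (s - r)\<^sup>2"
    using powr_second_order[OF r, of "real N - 1"] unfolding \<phi>_def \<phi>'_def by blast
  obtain K2 where K2: "K2 \<ge> 0" "\<And>s. s \<in> {r/2..3*r/2} \<Longrightarrow> \<bar>s powr (real N - 3) - (\<psi> + \<psi>' * (s - r))\<bar> \<le> K2 * (s - r)\<^sup>2"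
    using powr_second_order[OF r, of "real N - 3"] unfolding \<psi>_def \<psi>'_def by blast
  have \<phi>0: "\<phi> > 0" using r by (simp add: \<phi>_def)
  \<comment> \<open>\<open>near_one_const\<close> written out, since the constant has to be fixed
    before \<open>e\<close> is.\<close>
  define C where "C = 4 * (1 / (min sm sp * (r/2) ^ (N - 1))) * ((2 * r) ^ (N - 1) * (L * (sm + sp) / (r/2)\<^sup>2 + M))"
  define G where "G = (2 * r) ^ (N - 1) * (L * (sm + sp) / (r/2)\<^sup>2 + M)"
  define K3 where "K3 = L * (sm + sp) * K2 + M * K1 + G * (2 * C)"
  have "\<bar>\<nu> - ((sm + sp) / 2 * (\<Lambda> / r\<^sup>2) + (real N - 3) / (4 * r) * (sp - sm) * (\<Lambda> / r\<^sup>2) * e)\<bar> \<le> K3 / \<phi> * e\<^sup>2"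
    if ts: "thin_shell r e sm sp N L M" and root: "thin_shell.root r e sm sp N \<Lambda> \<nu>"
      and \<Lambda>: "0 \<le> \<Lambda>" "\<Lambda> \<le> L" and \<nu>: "0 \<le> \<nu>" "\<nu> \<le> M" for e \<Lambda> \<nu>
  proof -
    interpret thin_shell r e sm sp N L M by (rule ts)
    have CC: "near_one_const L M = C" by (simp add: near_one_const_def C_def)
    obtain p w where sh: "shooting \<Lambda> \<nu> p w" "w b = 0" using root by (auto simp: root_def)
    have bb: "b \<in> {a..b}" using ab by auto
    have "((\<lambda>s. s ^ (N - 1) * (\<Lambda> * \<sigma> s / s\<^sup>2 * p s - \<nu> * p s)) has_integral (w b - w a)) {a..b}"
      by (rule radial_sol_has_integral(2)[OF _ bb]) (use sh in \<open>simp add: shooting_def\<close>)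
    then have int1: "((\<lambda>s. s ^ (N - 1) * (\<Lambda> * \<sigma> s / s\<^sup>2 * p s - \<nu> * p s)) has_integral 0) {a..b}"
      using sh by (simp add: shooting_def)
    \<comment> \<open>The linearised integrand for a constant conductivity \<open>S\<close>;
      \<open>P\<close> is its primitive vanishing at \<open>r\<close>.\<close>
    define l where "l S s = \<Lambda> * S * (\<psi> + \<psi>' * (s - r)) - \<nu> * (\<phi> + \<phi>' * (s - r))" for S s
    define P where "P S s = \<Lambda> * S * (\<psi> * (s - r) + \<psi>' * (s - r)\<^sup>2 / 2) - \<nu> * (\<phi> * (s - r) + \<phi>' * (s - r)\<^sup>2 / 2)" for S s
    have P: "(l S has_integral (P S y - P S x)) {x..y}" if "x \<le> y" for S x y
      unfolding l_def[abs_def] P_def[abs_def] using that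
      by (intro fundamental_theorem_of_calculus)
        (auto intro!: derivative_eq_intros simp: has_real_derivative_iff_has_vector_derivative[symmetric] field_simps)
    have "((\<lambda>s. l (\<sigma> s) s) has_integral (P sm r - P sm a)) {a..r}"
      by (rule has_integral_eq[OF _ P]) (use e0 in \<open>auto simp: phase_coef_def\<close>)
    moreover have "((\<lambda>s. l (\<sigma> s) s) has_integral (P sp b - P sp r)) {r..b}"
      by (rule has_integral_spike[OF negligible_sing _ P, of r]) (use e0 in \<open>auto simp: phase_coef_def\<close>)
    ultimately have int2: "((\<lambda>s. l (\<sigma> s) s) has_integral (P sm r - P sm a + (P sp b - P sp r))) {a..b}"
      using e0 by (intro has_integral_combine[of a r b]) auto
    have "((\<lambda>s. l (\<sigma> s) s - s ^ (N - 1) * (\<Lambda> * \<sigma> s / s\<^sup>2 * p s - \<nu> * p s)) has_integral (P sm r - P sm a + (P sp b - P sp r) - 0)) {a..b}"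
      by (rule has_integral_diff[OF int2 int1])
    then have "norm (P sm r - P sm a + (P sp b - P sp r) - 0) \<le> (K3 * e\<^sup>2) * measure lborel {a..b}"
    proof (rule has_integral_Icc_bound)
      have pos: "0 \<le> sm + sp" "0 \<le> L" "0 \<le> M" using sm0 sp0 L0 M0 by auto
      have G0: "G \<ge> 0" using pos r by (simp add: G_def)
      have C0: "C \<ge> 0" using pos r sm0 sp0 by (simp add: C_def)
      show "0 \<le> K3 * e\<^sup>2" using pos G0 C0 K1(1) K2(1) by (simp add: K3_def)
      fix s assume s: "s \<in> {a..b}"
      have sI: "s \<in> {r/2..3*r/2}" and s0: "s > 0" "s \<le> 2 * r" "r / 2 \<le> s" using s e_half r by auto
      have "\<bar>s - r\<bar> \<le> e" using s by auto
      then have se: "(s - r)\<^sup>2 \<le> e\<^sup>2" using power_mono[of "\<bar>s - r\<bar>" e 2] by simp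
      define g where "g = \<Lambda> * \<sigma> s * s powr (real N - 3) - \<nu> * s powr (real N - 1)"
      have g_eq: "g = s ^ (N - 1) * (\<Lambda> * \<sigma> s / s\<^sup>2 - \<nu>)"
        unfolding g_def power_eq_powr(2)[OF s0(1) N, symmetric] power_eq_powr(1)[OF s0(1) N, symmetric]
        by (simp add: algebra_simps)
      have e1: "\<bar>l (\<sigma> s) s - g\<bar> \<le> (L * (sm + sp) * K2 + M * K1) * e\<^sup>2"
      proof -
        have A: "\<bar>s powr (real N - 3) - (\<psi> + \<psi>' * (s - r))\<bar> \<le> K2 * e\<^sup>2"
          using K2(2)[OF sI] mult_left_mono[OF se K2(1)] by linarith
        have B: "\<bar>s powr (real N - 1) - (\<phi> + \<phi>' * (s - r))\<bar> \<le> K1 * e\<^sup>2"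
          using K1(2)[OF sI] mult_left_mono[OF se K1(1)] by linarith
        have "l (\<sigma> s) s - g = \<nu> * (s powr (real N - 1) - (\<phi> + \<phi>' * (s - r))) - (\<Lambda> * \<sigma> s) * (s powr (real N - 3) - (\<psi> + \<psi>' * (s - r)))"
          by (simp add: l_def g_def algebra_simps)
        also have "\<bar>\<dots>\<bar> \<le> \<bar>\<nu> * (s powr (real N - 1) - (\<phi> + \<phi>' * (s - r)))\<bar> + \<bar>(\<Lambda> * \<sigma> s) * (s powr (real N - 3) - (\<psi> + \<psi>' * (s - r)))\<bar>"
          by (rule abs_triangle_ineq4)
        also have "\<dots> \<le> M * (K1 * e\<^sup>2) + L * (sm + sp) * (K2 * e\<^sup>2)"
        proof (rule add_mono)
          show "\<bar>\<nu> * (s powr (real N - 1) - (\<phi> + \<phi>' * (s - r)))\<bar> \<le> M * (K1 * e\<^sup>2)"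
            unfolding abs_mult using B \<nu> pos by (intro mult_mono) auto
          have "\<bar>\<Lambda> * \<sigma> s\<bar> \<le> L * (sm + sp)"
            unfolding abs_mult using \<Lambda> phase_coef_le[of s] phase_coef_pos[of s] pos by (intro mult_mono) auto
          then show "\<bar>(\<Lambda> * \<sigma> s) * (s powr (real N - 3) - (\<psi> + \<psi>' * (s - r)))\<bar> \<le> L * (sm + sp) * (K2 * e\<^sup>2)"
            unfolding abs_mult[of "\<Lambda> * \<sigma> s"] using A pos by (intro mult_mono) auto
        qed
        also have "\<dots> = (L * (sm + sp) * K2 + M * K1) * e\<^sup>2" by (simp add: algebra_simps)
        finally show ?thesis .
      qed
      have "\<bar>p s - 1\<bar> \<le> 2 * near_one_const L M * e\<^sup>2"
        using radial_sol_near_one[of \<Lambda> \<nu> p w L M s] sh \<Lambda> \<nu> e_half e_small s by (auto simp: shooting_def)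
      then have p1: "\<bar>1 - p s\<bar> \<le> 2 * C * e\<^sup>2" by (simp add: CC abs_minus_commute)
      have "\<bar>\<Lambda> * \<sigma> s / s\<^sup>2 - \<nu>\<bar> \<le> \<bar>\<Lambda> * \<sigma> s / s\<^sup>2\<bar> + \<bar>\<nu>\<bar>" by (rule abs_triangle_ineq4)
      also have "\<bar>\<Lambda> * \<sigma> s / s\<^sup>2\<bar> = \<Lambda> * \<sigma> s / s\<^sup>2" using phase_coef_pos[of s] \<Lambda> by (simp add: abs_mult)
      also have "\<dots> \<le> L * (sm + sp) / (r/2)\<^sup>2"
        using s0 r \<Lambda> phase_coef_le[of s] phase_coef_pos[of s] sm0 sp0 by (intro frac_le mult_mono power_mono) auto
      finally have "\<bar>\<Lambda> * \<sigma> s / s\<^sup>2 - \<nu>\<bar> \<le> L * (sm + sp) / (r/2)\<^sup>2 + M" using \<nu> by simp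
      then have gG: "\<bar>g\<bar> \<le> G"
        unfolding g_eq G_def abs_mult using s0 pos power_mono[of s "2 * r" "N - 1"] by (intro mult_mono) auto
      have e2: "\<bar>g * (1 - p s)\<bar> \<le> G * (2 * C * e\<^sup>2)"
        unfolding abs_mult using gG p1 G0 by (intro mult_mono) auto
      have "l (\<sigma> s) s - s ^ (N - 1) * (\<Lambda> * \<sigma> s / s\<^sup>2 * p s - \<nu> * p s) = (l (\<sigma> s) s - g) + g * (1 - p s)"
        unfolding g_eq by (simp add: algebra_simps add_divide_distrib diff_divide_distrib)
      also have "\<bar>\<dots>\<bar> \<le> (L * (sm + sp) * K2 + M * K1) * e\<^sup>2 + G * (2 * C * e\<^sup>2)"
        using e1 e2 abs_triangle_ineq[of "l (\<sigma> s) s - g" "g * (1 - p s)"] by linarith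
      also have "\<dots> = K3 * e\<^sup>2" by (simp add: K3_def algebra_simps)
      finally show "norm (l (\<sigma> s) s - s ^ (N - 1) * (\<Lambda> * \<sigma> s / s\<^sup>2 * p s - \<nu> * p s)) \<le> K3 * e\<^sup>2" by simp
    qed
    also have "measure lborel {a..b} = 2 * e" using e0 by simp
    \<comment> \<open>By symmetry about \<open>r\<close> the contributions of \<open>\<phi>'\<close>
      from the two halves cancel, while those of \<open>\<psi>'\<close> carry different
      conductivities and leave their difference.\<close>
    also have "P sm r - P sm a + (P sp b - P sp r) - 0 =
      e * (\<Lambda> * (sm + sp) * \<psi>) + e\<^sup>2 / 2 * (\<Lambda> * (sp - sm) * \<psi>') - 2 * e * \<nu> * \<phi>"
      by (simp add: P_def power2_eq_square field_simps)
    also have "\<psi> = \<phi> / r\<^sup>2"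
      unfolding \<psi>_def \<phi>_def power_eq_powr(2)[OF r N, symmetric] power_eq_powr(1)[OF r N, symmetric] ..
    also have "\<psi>' = (real N - 3) * (\<phi> / r\<^sup>2) / r"
    proof -
      have "r powr (real N - 3 - 1) = r powr (real N - 3) / r" by (subst powr_diff) (use r in simp)
      then show ?thesis
        unfolding \<psi>'_def \<phi>_def power_eq_powr(1)[OF r N, symmetric] using power_eq_powr(2)[OF r N] by simp
    qed
    finally have main: "\<bar>e * (\<Lambda> * (sm + sp) * (\<phi> / r\<^sup>2)) + e\<^sup>2 / 2 * (\<Lambda> * (sp - sm) * ((real N - 3) * (\<phi> / r\<^sup>2) / r)) - 2 * e * \<nu> * \<phi>\<bar>
       \<le> K3 * e\<^sup>2 * (2 * e)" by simp
    define T where "T = (sm + sp) / 2 * (\<Lambda> / r\<^sup>2) + (real N - 3) / (4 * r) * (sp - sm) * (\<Lambda> / r\<^sup>2) * e"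
    have "e * (\<Lambda> * (sm + sp) * (\<phi> / r\<^sup>2)) + e\<^sup>2 / 2 * (\<Lambda> * (sp - sm) * ((real N - 3) * (\<phi> / r\<^sup>2) / r)) - 2 * e * \<nu> * \<phi>
      = (2 * e * \<phi>) * (T - \<nu>)"
      unfolding T_def using r by (simp add: field_simps power2_eq_square)
    then have "\<bar>(2 * e * \<phi>) * (T - \<nu>)\<bar> \<le> K3 * e\<^sup>2 * (2 * e)" using main by (simp only:)
    moreover have pos: "0 < 2 * e * \<phi>" using e0 \<phi>0 by simp
    moreover have "\<bar>(2 * e * \<phi>) * (T - \<nu>)\<bar> = (2 * e * \<phi>) * \<bar>\<nu> - T\<bar>"
      unfolding abs_mult[of "2 * e * \<phi>"] abs_of_pos[OF pos] by (simp only: abs_minus_commute)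
    moreover have "K3 * e\<^sup>2 * (2 * e) = (2 * e * \<phi>) * (K3 / \<phi> * e\<^sup>2)" using \<phi>0 by simp
    ultimately have "\<bar>\<nu> - T\<bar> \<le> K3 / \<phi> * e\<^sup>2" by (simp only: mult_le_cancel_left_pos)
    then show ?thesis by (simp only: T_def)
  qed
  then show ?thesis using that by blast
qed

theorem theorem1p4:
  fixes c :: "'a::euclidean_space" and r sm sp :: real and k :: nat
  assumes "DIM('a) \<ge> 2" and "r > 0" and "sm > 0" and "sp > 0" and "sm \<noteq> sp" and "k \<ge> 1"
  shows "(\<lambda>\<epsilon>. tp_eig c r sm sp \<epsilon> k
            - ((sm + sp) / 2 * LB_eig c r k
               + (real DIM('a) - 3) / (4 * r) * (sp - sm) * LB_eig c r k * \<epsilon>))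
         \<in> o[at_right 0](\<lambda>\<epsilon>. \<epsilon>)"
proof -
  note dim = assms(1) and r = assms(2)
  let ?N = "DIM('a)"
  define \<mu> where "\<mu> = LB_eig c r k"
  define \<Lambda> where "\<Lambda> = \<mu> * r\<^sup>2"
  have \<Lambda>0: "0 \<le> \<Lambda>"
    using LB_eig_attained(3)[OF dim r assms(6), where c = c] lb_eigenvalue_nonneg[OF dim] by (auto simp: \<Lambda>_def \<mu>_def)
  \<comment> \<open>The added 1 makes the inequality demanded by \<open>root_exists\<close>
    strict.\<close>
  define M where "M = \<Lambda> * (sm + sp) / (r/2)\<^sup>2 + 1"
  \<comment> \<open>The first entry brings the given \<Lambda> below \<open>L\<close>, the second is
    the requirement \<open>LM\<close> of \<open>thin_shell\<close>.\<close>
  define L where "L = max \<Lambda> (M * (2 * r)\<^sup>2 / min sm sp)"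
  have Mgt: "\<Lambda> * (sm + sp) < M * (r/2)\<^sup>2" using r by (simp add: M_def field_simps)
  have Mge: "M \<ge> 0" using \<Lambda>0 assms by (simp add: M_def)
  have Lge: "L \<ge> 0" "\<Lambda> \<le> L" using \<Lambda>0 by (auto simp: L_def)
  have LM: "M * (2 * r)\<^sup>2 \<le> L * min sm sp"
  proof -
    have "M * (2 * r)\<^sup>2 / min sm sp \<le> L" by (simp add: L_def)
    then show ?thesis using assms(3,4) by (simp only: pos_divide_le_eq min_less_iff_conj)
  qed
  obtain K where K: "\<And>e \<Lambda> \<nu>. thin_shell r e sm sp ?N L M \<Longrightarrow> thin_shell.root r e sm sp ?N \<Lambda> \<nu> \<Longrightarrow>
     0 \<le> \<Lambda> \<Longrightarrow> \<Lambda> \<le> L \<Longrightarrow> 0 \<le> \<nu> \<Longrightarrow> \<nu> \<le> M \<Longrightarrow>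
     \<bar>\<nu> - ((sm + sp) / 2 * (\<Lambda> / r\<^sup>2) + (real ?N - 3) / (4 * r) * (sp - sm) * (\<Lambda> / r\<^sup>2) * e)\<bar> \<le> K * e\<^sup>2"
    using root_asymptotics[OF r, of ?N sm sp L M] DIM_positive[where 'a = 'a] by (metis One_nat_def Suc_leI)
  \<comment> \<open>Again \<open>near_one_const\<close>, spelled out because the smallness condition
    has to be shown for all small \<open>e\<close> before a shell is fixed.\<close>
  define C where "C = 4 * (1 / (min sm sp * (r/2) ^ (?N - 1))) * ((2 * r) ^ (?N - 1) * (L * (sm + sp) / (r/2)\<^sup>2 + M))"
  have "((\<lambda>e. C * e\<^sup>2) \<longlongrightarrow> C * 0\<^sup>2) (at_right (0::real))" by (intro tendsto_intros)
  then have ev1: "eventually (\<lambda>e. C * e\<^sup>2 < 1 / 4) (at_right (0::real))" by (intro order_tendstoD(2)) auto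
  have ev2: "eventually (\<lambda>e. e \<in> {0<..<r/2}) (at_right (0::real))" using r by (intro eventually_at_right_real) auto
  have "eventually (\<lambda>\<epsilon>. norm (tp_eig c r sm sp \<epsilon> k - ((sm + sp) / 2 * LB_eig c r k
               + (real ?N - 3) / (4 * r) * (sp - sm) * LB_eig c r k * \<epsilon>)) \<le> K * norm (\<epsilon>\<^sup>2)) (at_right 0)"
    using ev1 ev2
  proof eventually_elim
    case (elim e)
    interpret s1: radial_interval r e sm sp ?N using elim assms by unfold_locales auto
    interpret thin c r e sm sp L M
      using elim assms Mge Lge LM s1.near_one_const_def[of L M]
      by unfold_locales (auto simp: C_def)
    have ts: "thin_shell r e sm sp ?N L M" by unfold_locales
    obtain \<nu> where \<nu>: "root \<Lambda> \<nu>" "0 \<le> \<nu>" "\<nu> \<le> M" "tp_eig c r sm sp e k = \<nu>"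
      using tp_eig_eq_root[OF dim assms(6)] Lge(2) Mgt unfolding \<Lambda>_def \<mu>_def by blast
    have "\<Lambda> / r\<^sup>2 = LB_eig c r k" using r by (simp add: \<Lambda>_def \<mu>_def)
    then show ?case using K[OF ts \<nu>(1) \<Lambda>0 Lge(2) \<nu>(2,3)] \<nu>(4) by simp
  qed
  then have "(\<lambda>\<epsilon>. tp_eig c r sm sp \<epsilon> k - ((sm + sp) / 2 * LB_eig c r k
               + (real ?N - 3) / (4 * r) * (sp - sm) * LB_eig c r k * \<epsilon>)) \<in> O[at_right 0](\<lambda>\<epsilon>. \<epsilon>\<^sup>2)"
    by (rule bigoI)
  moreover have "(\<lambda>\<epsilon>::real. \<epsilon>\<^sup>2) \<in> o[at_right 0](\<lambda>\<epsilon>. \<epsilon>)" by real_asymp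
  ultimately show ?thesis by (rule landau_o.big_small_trans)
qed

end
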